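(* Let $\lambda>-1/2$, $\lambda\ne0$, $1<p<\infty$, and $\gamma_p=\max\{1,\frac{1}{p-1}\}$. (1) If for some real $\theta$ an estimate of the form $$\|R_\lambda f\|_{L^p(\mathbb{R}_+,w\,dx)}\le C_{p,\lambda}[w]_{A_{p,\lambda}}^{\theta}\|f\|_{L^p(\mathbb{R}_+,w\,dx)}$$ holds for all $w\in A_{p,\lambda}$ and all compactly supported $f\in L^p(\mathbb{R}_+,w\,dx)$, with $C_{p,\lambda}$ independent of $w$ and $f$, then $\theta\ge\gamma_p$. (2) If for some real $\delta$ an estimate of the form $$\|[b,R_\lambda]f\|_{L^p(\mathbb{R}_+,w\,dx)}\le C_{p,\lambda}\|b\|_{\mathrm{BMO}_\lambda}[w]_{A_{p,\lambda}}^{\delta}\|f\|_{L^p(\mathbb{R}_+,w\,dx)}$$ holds for all $w\in A_{p,\lambda}$, all compactly supported $f\in L^p(\mathbb{R}_+,w\,dx)$, and all real-valued $b\in\mathrm{BMO}_\lambda$, with $C_{p,\lambda}$ independent of $w$, $f$ and $b$, then $\delta\ge2\gamma_p$.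
   Context: $\mathbb{R}_+=(0,\infty)$ and $d\nu_\lambda(x)=x^{2\lambda+1}\,dx$. Compact support means compact support in $(0,\infty)$. A weight is a positive measurable function on $\mathbb{R}_+$, finite almost everywhere (no local integrability at $0$ is required). For $1<p<\infty$, $p'=p/(p-1)$, a weight $w$ belongs to the Andersen--Kerman class $A_{p,\lambda}$ if $$[w]_{A_{p,\lambda}}:=\sup_{I\subset\mathbb{R}_+}\left(\frac{1}{\nu_\lambda(I)}\int_I x^pw(x)\,dx\right)\left(\frac{1}{\nu_\lambda(I)}\int_I x^{2\lambda p'}w(x)^{-1/(p-1)}\,dx\right)^{p-1}<\infty,$$ the supremum being over finite intervals $I\subset\mathbb{R}_+$. A function $b\in L^1_{\mathrm{loc}}(\mathbb{R}_+,\nu_\lambda)$ belongs to $\mathrm{BMO}_\lambda$ if $\|b\|_{\mathrm{BMO}_\lambda}:=\sup_{I\subset\mathbb{R}_+}\frac{1}{\nu_\lambda(I)}\int_I|b-b_I^{\nu_\lambda}|\,d\nu_\lambda<\infty$, the supremum being over finite intervals $I\subset\mathbb{R}_+$, where $b_I^{\nu_\lambda}=\frac{1}{\nu_\lambda(I)}\int_I b\,d\nu_\lambda$. The Bessel Riesz transform is $R_\lambda=\frac{d}{dx}\Delta_\lambda^{-1/2}$, where $\Delta_\lambda=-\frac{d^2}{dx^2}-\frac{2\lambda}{x}\frac{d}{dx}$ on $\mathbb{R}_+$. Concretely, $R_\lambda f(x)=\mathrm{p.v.}\int_0^\infty K_\lambda(x,y)f(y)\,y^{2\lambda}\,dy$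 with, for $x\ne y$, $$K_\lambda(x,y)=\lim_{\tau\downarrow0}\;-(xy)^{-\lambda+1/2}\int_0^\infty e^{-\tau r}J_{\lambda+1/2}(xr)J_{\lambda-1/2}(yr)\,r\,dr,$$ where $J_\mu$ is the Bessel function of the first kind and $\mathrm{p.v.}$ means $\lim_{\varepsilon\to0^+}\int_{|x-y|>\varepsilon}$. The commutator is $[b,R_\lambda]f(x)=b(x)R_\lambda f(x)-R_\lambda(bf)(x)$. Operators are initially considered on bounded functions with compact support in $(0,\infty)$ and are extended to $L^p(\mathbb{R}_+,w\,dx)$ by density. *)

theory Defs
  imports "HOL-Analysis.Analysis"
begin

text \<open>
  Functions on the half-line \<open>(0, \<infinity>)\<close> are represented by functions of type \<open>real \<Rightarrow> real\<close>;
  their values on \<open>{..0}\<close> are never used. Measurability is Lebesgue measurability.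
\<close>

abbreviation half_line :: "real measure" where
  "half_line \<equiv> lebesgue_on {0<..}"

definition nu :: "real \<Rightarrow> real measure" where
  "nu lam = density half_line (\<lambda>x. ennreal (x powr (2 * lam + 1)))"

text \<open>
  Open intervals suffice, since end points are null sets. The left end point \<open>0\<close> is allowed:
  \<open>(0, b)\<close> is a finite interval contained in \<open>(0, \<infinity>)\<close>.
\<close>

definition finite_intervals :: "real set set" where
  "finite_intervals = {{a<..<b} | a b. 0 \<le> a \<and> a < b}"

text \<open>Real powers with exponent \<open>s > 0\<close> of extended nonnegative reals.\<close>

definition ennpowr :: "ennreal \<Rightarrow> real \<Rightarrow> ennreal" where
  "ennpowr a s = (if a = \<infinity> then \<infinity> else ennreal (enn2real a powr s))"

text \<open>
  Weights are defined up to null sets, so ``finite almost everywhere'' is expressed by taking a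
  real-valued representative. No local integrability is required.
\<close>

definition weight :: "(real \<Rightarrow> real) \<Rightarrow> bool" where
  "weight w \<longleftrightarrow> w \<in> borel_measurable half_line \<and> (\<forall>x>0. w x > 0)"

definition AK_const :: "real \<Rightarrow> real \<Rightarrow> (real \<Rightarrow> real) \<Rightarrow> ennreal" where
  "AK_const lam p w =
    (SUP I\<in>finite_intervals.
      ((\<integral>\<^sup>+x\<in>I. ennreal (x powr p * w x) \<partial>half_line) / emeasure (nu lam) I) *
      ennpowr
        ((\<integral>\<^sup>+x\<in>I. ennreal (x powr (2 * lam * (p / (p - 1))) * w x powr (- 1 / (p - 1))) \<partial>half_line)
          / emeasure (nu lam) I)
        (p - 1))"

definition AK_class :: "real \<Rightarrow> real \<Rightarrow> (real \<Rightarrow> real) set" where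
  "AK_class lam p = {w. weight w \<and> AK_const lam p w < \<infinity>}"

definition nu_avg :: "real \<Rightarrow> (real \<Rightarrow> real) \<Rightarrow> real set \<Rightarrow> real" where
  "nu_avg lam b I = (LINT x:I|nu lam. b x) / measure (nu lam) I"

text \<open>
  If \<open>b\<close> is not integrable on \<open>I = (0, c)\<close>, then \<open>nu_avg lam b I = 0\<close> by the convention for the
  Bochner integral, and the oscillation of \<open>b\<close> over \<open>I\<close> is \<open>\<infinity>\<close>; so such a \<open>b\<close> is not in BMO.
\<close>

definition BMO_norm :: "real \<Rightarrow> (real \<Rightarrow> real) \<Rightarrow> ennreal" where
  "BMO_norm lam b =
    (SUP I\<in>finite_intervals.
      (\<integral>\<^sup>+x\<in>I. ennreal \<bar>b x - nu_avg lam b I\<bar> \<partial>nu lam) / emeasure (nu lam) I)"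

definition BMO :: "real \<Rightarrow> (real \<Rightarrow> real) set" where
  "BMO lam = {b. (\<forall>K. compact K \<and> K \<subseteq> {0<..} \<longrightarrow> set_integrable (nu lam) K b)
                \<and> BMO_norm lam b < \<infinity>}"

definition Lp_norm :: "real \<Rightarrow> (real \<Rightarrow> real) \<Rightarrow> (real \<Rightarrow> real) \<Rightarrow> ennreal" where
  "Lp_norm p w f =
    ennpowr (\<integral>\<^sup>+x. ennreal (\<bar>f x\<bar> powr p) \<partial>(density half_line (\<lambda>x. ennreal (w x)))) (1 / p)"

definition Lp_space :: "real \<Rightarrow> (real \<Rightarrow> real) \<Rightarrow> (real \<Rightarrow> real) set" where
  "Lp_space p w = {f. f \<in> borel_measurable half_line \<and> Lp_norm p w f < \<infinity>}"

definition compactly_supported :: "(real \<Rightarrow> real) \<Rightarrow> bool" where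
  "compactly_supported f \<longleftrightarrow>
    compact (closure {x. 0 < x \<and> f x \<noteq> 0}) \<and> closure {x. 0 < x \<and> f x \<noteq> 0} \<subseteq> {0<..}"

text \<open>Bessel function of the first kind and real order, for arguments \<open>z > 0\<close>.\<close>

definition Bessel_J :: "real \<Rightarrow> real \<Rightarrow> real" where
  "Bessel_J \<mu> z =
    (\<Sum>k. (- 1) ^ k / fact k * rGamma (real k + \<mu> + 1) * (z / 2) powr (2 * real k + \<mu>))"

definition riesz_kernel :: "real \<Rightarrow> real \<Rightarrow> real \<Rightarrow> real" where
  "riesz_kernel lam x y =
    Lim (at_right 0) (\<lambda>\<tau>. - ((x * y) powr (- lam + 1 / 2)) *
      (LINT r|half_line.
        exp (- \<tau> * r) * Bessel_J (lam + 1 / 2) (x * r) * Bessel_J (lam - 1 / 2) (y * r) * r))"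

text \<open>
  The principal value exists for almost every \<open>x > 0\<close> whenever \<open>f\<close> is integrable with compact
  support in \<open>(0, \<infinity>)\<close>, in particular for every compactly supported \<open>f \<in> L\<^sup>p(w dx)\<close> with
  \<open>w\<close> in the Andersen--Kerman class, and for \<open>b f\<close> with \<open>b\<close> in BMO; there it agrees almost
  everywhere with the extension by density from bounded compactly supported functions.
\<close>

definition riesz :: "real \<Rightarrow> (real \<Rightarrow> real) \<Rightarrow> real \<Rightarrow> real" where
  "riesz lam f x =
    Lim (at_right 0) (\<lambda>\<epsilon>. LINT y:{y. \<bar>x - y\<bar> > \<epsilon>}|half_line.
      riesz_kernel lam x y * f y * y powr (2 * lam))"

definition riesz_commutator :: "real \<Rightarrow> (real \<Rightarrow> real) \<Rightarrow> (real \<Rightarrow> real) \<Rightarrow> real \<Rightarrow> real" where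
  "riesz_commutator lam b f x = b x * riesz lam f x - riesz lam (\<lambda>y. b y * f y) x"

end

theory Submission
  imports Defs "HOL-Complex_Analysis.Conformal_Mappings"
begin

text \<open>
  Near the diagonal the Bessel Riesz transform behaves like the Hilbert transform, and the exponents are sharp for
  the same reason as in Buckley's examples: power weights that are singular at an interior point, here at 1, and
  test functions at that point. Everything takes place at points \<open>x < 1 < y\<close>, so that the operators are ordinary
  integrals against the part of the kernel below the diagonal. This part is positive, so no
  cancellation has to be controlled, and it is at least \<open>c / (y - x)\<close> near 1
  (\<open>kernel_below_lower_bound\<close>).

  The information on the kernel is extracted from its definition. Poisson's integral represents
  \<open>J\<^bsub>\<lambda>+1/2\<^esub>(x r)\<close> as an average of cosines, and the remaining integral over \<open>r\<close> is the Laplace transform of a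
  Bessel function at the points \<open>\<tau> + i x \<surd>u\<close>. This transform is known in closed form
  (\<open>laplace_bessel_density\<close>): a binomial series for large real arguments, and analytic continuation elsewhere. For
  \<open>x < y\<close> the limit \<open>\<tau> \<rightarrow> 0\<close> can be taken under the integral, and an explicit integral with a positive integrand
  results (\<open>riesz_kernel_eq_kernel_below\<close>).

  The weights are \<open>w(x) = x\<^bsup>2\<lambda>+1-p\<^esup> \<bar>x - 1\<bar>\<^sup>\<sigma>\<close>. For them the Andersen--Kerman constant is the Muckenhoupt
  constant of \<open>\<bar>x - 1\<bar>\<^sup>\<sigma>\<close> for \<open>\<nu>\<^sub>\<lambda>\<close>, and since averages for \<open>\<nu>\<^sub>\<lambda>\<close> are dominated by Lebesgue averages
  (\<open>nu_average_le\<close>), it is easily estimated. For a large parameter \<open>L\<close> it is at most a multiple of \<open>L\<^sup>q\<close>, where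
  \<open>q = p - 1\<close> if \<open>\<sigma> = (p - 1) (1 - 1/L)\<close>, and \<open>q = 1\<close> if \<open>\<sigma> = - (1 - 1/L)\<close>.

  The test function \<open>f\<close> sits to the right of 1 on a shell of distances to 1 whose logarithmic length is \<open>L\<close>, and
  its image is measured to the left of 1 on another such shell, with a gap of logarithmic length \<open>L\<close>
  between them. Then \<open>\<parallel>R f\<parallel> \<ge> c L \<parallel>f\<parallel>\<close>. The function \<open>b(x) = ln \<bar>x - 1\<bar>\<close> has bounded mean oscillation, and it
  differs by at least \<open>L\<close> between the two shells with a constant sign, so the commutator gains one more factor
  \<open>L\<close> (\<open>sharpness_test\<close>). An estimate with exponent \<open>\<theta>\<close> therefore forces \<open>L \<le> C L\<^bsup>q\<theta>\<^esup>\<close> for all large \<open>L\<close>,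
  that is \<open>q \<theta> \<ge> 1\<close>, and in the same way \<open>q \<delta> \<ge> 2\<close>. The two values of \<open>q\<close> give the maximum in \<open>\<gamma>\<^sub>p\<close>.
\<close>

section \<open>The entire parts of Bessel functions\<close>

lemma Gamma_duplication_real:
  fixes x :: real
  assumes "x > 0"
  shows "Gamma x * Gamma (x + 1/2) = 2 powr (1 - 2 * x) * sqrt pi * Gamma (2 * x)"
proof -
  have "complex_of_real x \<notin> \<int>\<^sub>\<le>\<^sub>0" "complex_of_real x + 1/2 \<notin> \<int>\<^sub>\<le>\<^sub>0"
    using assms by (auto elim!: nonpos_Ints_cases simp: complex_eq_iff)
  from Gamma_legendre_duplication[OF this]
  have "complex_of_real (Gamma x * Gamma (x + 1/2)) =
        exp ((1 - 2 * of_real x) * of_real (ln 2)) * of_real (sqrt pi) * Gamma (2 * of_real x)"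
    using Gamma_complex_of_real[of "x + 1/2"] by (simp add: Gamma_complex_of_real)
  also have "\<dots> = complex_of_real (2 powr (1 - 2 * x) * sqrt pi * Gamma (2 * x))"
    using Gamma_complex_of_real[of "2 * x"]
    by (simp add: powr_def exp_of_real[symmetric])
  finally show ?thesis by (simp only: of_real_eq_iff)
qed

text \<open>
  The entire even function with \<open>J\<^sub>\<mu>(z) = (z/2)\<^sup>\<mu> bessel_entire \<mu> z\<close>.
\<close>

definition bessel_entire :: "real \<Rightarrow> real \<Rightarrow> real" where
  "bessel_entire \<mu> z = (\<Sum>k. (- 1) ^ k / fact k * rGamma (real k + \<mu> + 1) * (z / 2) ^ (2 * k))"

text \<open>
  The weight of Poisson's integral for Bessel functions after the substitution \<open>u = t\<^sup>2\<close>, which makes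
  every moment a Beta integral. It is zero outside \<open>(0, 1)\<close> so that all integrals run over the line.
\<close>

definition poisson_weight :: "real \<Rightarrow> real \<Rightarrow> real" where
  "poisson_weight a u = (if 0 < u \<and> u < 1 then u powr (- 1 / 2) * (1 - u) powr a else 0)"

lemma poisson_weight_nonneg [simp]: "poisson_weight a u \<ge> 0"
  by (simp add: poisson_weight_def)

lemma borel_measurable_poisson_weight [measurable]: "poisson_weight a \<in> borel_measurable borel"
  unfolding poisson_weight_def[abs_def] by measurable

lemma poisson_weight_moment:
  assumes "a > - 1"
  shows "integrable lborel (\<lambda>u. poisson_weight a u * u ^ k)"
    and "(LINT u|lborel. poisson_weight a u * u ^ k) = Beta (real k + 1 / 2) (a + 1)"
proof -
  let ?B = "\<lambda>u::real. u powr (real k + 1 / 2 - 1) * (1 - u) powr (a + 1 - 1)"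
  have "set_integrable lborel {0..1} ?B"
    using assms by (intro integrable_Beta) auto
  then have int: "integrable lborel (\<lambda>u. indicator {0..1} u *\<^sub>R ?B u)"
    by (simp add: set_integrable_def)
  have ae: "AE u in lborel. poisson_weight a u * u ^ k = indicator {0..1} u *\<^sub>R ?B u"
  proof -
    have "AE u in lborel. u \<noteq> (0::real)" "AE u in lborel. u \<noteq> (1::real)"
      by (auto simp: AE_lborel_singleton)
    then show ?thesis
    proof eventually_elim
      case (elim u)
      show ?case
      proof (cases "0 < u \<and> u < 1")
        case True
        have "u powr (real k + 1 / 2 - 1) = u powr (- 1 / 2) * u ^ k"
          using True by (simp add: powr_realpow[symmetric] powr_add[symmetric])
        with True show ?thesis by (simp add: poisson_weight_def)
      next
        case False
        with elim show ?thesis by (auto simp: poisson_weight_def)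
      qed
    qed
  qed
  show 1: "integrable lborel (\<lambda>u. poisson_weight a u * u ^ k)"
    by (subst integrable_cong_AE[OF _ _ ae]) (use int in auto)
  have "(LINT u|lborel. poisson_weight a u * u ^ k) = (LINT u:{0..1}|lborel. ?B u)"
    unfolding set_lebesgue_integral_def by (intro integral_cong_AE ae) auto
  also have "\<dots> = integral {0..1} ?B"
    using assms by (intro set_borel_integral_eq_integral integrable_Beta) auto
  also have "\<dots> = Beta (real k + 1 / 2) (a + 1)"
    using assms by (intro integral_unique has_integral_Beta_real) auto
  finally show "(LINT u|lborel. poisson_weight a u * u ^ k) = Beta (real k + 1 / 2) (a + 1)" .
qed

lemma integrable_poisson_weight: "a > - 1 \<Longrightarrow> integrable lborel (poisson_weight a)"
  using poisson_weight_moment(1)[of a 0] by simp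

text \<open>
  Poisson's integral, by term-by-term integration of the cosine series. The duplication formula
  identifies \<open>Beta (k + 1/2) (a + 1) / (2k)!\<close> with the Bessel coefficient of order \<open>a + 1/2\<close>.
\<close>

lemma poisson_cos_sums:
  assumes a: "a > - 1"
  shows "(\<lambda>k. (- 1) ^ k / fact k * rGamma (real k + a + 3 / 2) * (z / 2) ^ (2 * k)) sums
    ((LINT u|lborel. poisson_weight a u * cos (z * sqrt u)) / (sqrt pi * Gamma (a + 1)))"
proof -
  define f where "f k u = poisson_weight a u * u ^ k * ((- 1) ^ k * z ^ (2 * k) / fact (2 * k))"
    for k :: nat and u :: real
  have cosh: "summable (\<lambda>k. \<bar>z\<bar> ^ (2 * k) / fact (2 * k))"
  proof -
    have "summable (\<lambda>n. inverse (fact n) * \<bar>z\<bar> ^ n)"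
      using summable_exp[of "\<bar>z\<bar>"] by simp
    then have "summable ((\<lambda>n. inverse (fact n) * \<bar>z\<bar> ^ n) \<circ> (\<lambda>k. 2 * k))"
      by (rule summable_reindex) (auto simp: inj_on_def)
    then show ?thesis by (simp add: o_def field_simps)
  qed
  have int: "integrable lborel (f k)" for k
    unfolding f_def using poisson_weight_moment(1)[OF a, of k] by auto
  have bound: "norm (f k u) \<le> poisson_weight a u * (\<bar>z\<bar> ^ (2 * k) / fact (2 * k))" for k u
  proof -
    have "poisson_weight a u * \<bar>u\<bar> ^ k \<le> poisson_weight a u"
      by (cases "0 < u \<and> u < 1") (auto simp: poisson_weight_def power_le_one mult_left_le)
    then have "poisson_weight a u * \<bar>u\<bar> ^ k * (\<bar>z\<bar> ^ (2 * k) / fact (2 * k)) \<le>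
       poisson_weight a u * (\<bar>z\<bar> ^ (2 * k) / fact (2 * k))"
      by (intro mult_right_mono) auto
    then show ?thesis by (simp add: f_def abs_mult power_abs del: power_even_abs)
  qed
  have "(\<lambda>k. integral\<^sup>L lborel (f k)) sums (LINT u|lborel. (\<Sum>k. f k u))"
  proof (rule sums_integral[OF int])
    show "AE u in lborel. summable (\<lambda>k. norm (f k u))"
      using bound by (intro AE_I2 summable_comparison_test'[OF summable_mult[OF cosh]]) auto
    show "summable (\<lambda>k. LINT u|lborel. norm (f k u))"
    proof (rule summable_comparison_test'[OF summable_mult[OF cosh, of "integral\<^sup>L lborel (poisson_weight a)"]])
      fix k :: nat
      have "(LINT u|lborel. norm (f k u)) \<le> (LINT u|lborel. poisson_weight a u * (\<bar>z\<bar> ^ (2 * k) / fact (2 * k)))"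
        using bound integrable_poisson_weight[OF a] int by (intro integral_mono integrable_norm) auto
      then show "norm (LINT u|lborel. norm (f k u)) \<le>
        integral\<^sup>L lborel (poisson_weight a) * (\<bar>z\<bar> ^ (2 * k) / fact (2 * k))"
        by simp
    qed
  qed
  moreover have "(\<Sum>k. f k u) = poisson_weight a u * cos (z * sqrt u)" for u
  proof (cases "0 < u \<and> u < 1")
    case True
    have "(\<lambda>k. ((- 1) ^ k / fact (2 * k)) *\<^sub>R (z * sqrt u) ^ (2 * k)) sums cos (z * sqrt u)"
      by (rule cos_series)
    moreover have "(z * sqrt u) ^ (2 * k) = z ^ (2 * k) * u ^ k" for k
      using True by (simp add: power_mult_distrib power_mult)
    ultimately have "(\<lambda>k. poisson_weight a u * (u ^ k * ((- 1) ^ k * z ^ (2 * k) / fact (2 * k)))) sums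
        (poisson_weight a u * cos (z * sqrt u))"
      by (intro sums_mult) (simp add: mult_ac)
    then show ?thesis by (simp add: f_def sums_iff mult_ac)
  qed (auto simp: f_def poisson_weight_def)
  ultimately have "(\<lambda>k. integral\<^sup>L lborel (f k)) sums (LINT u|lborel. poisson_weight a u * cos (z * sqrt u))"
    by simp
  then have "(\<lambda>k. integral\<^sup>L lborel (f k) / (sqrt pi * Gamma (a + 1))) sums
     ((LINT u|lborel. poisson_weight a u * cos (z * sqrt u)) / (sqrt pi * Gamma (a + 1)))"
    by (rule sums_divide)
  moreover have "integral\<^sup>L lborel (f k) / (sqrt pi * Gamma (a + 1)) =
     (- 1) ^ k / fact k * rGamma (real k + a + 3 / 2) * (z / 2) ^ (2 * k)" for k
  proof -
    have "Gamma (real k + 1 / 2) * Gamma (real k + 1 / 2 + 1 / 2) =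
        2 powr (1 - 2 * (real k + 1 / 2)) * sqrt pi * Gamma (2 * (real k + 1 / 2))"
      by (rule Gamma_duplication_real) simp
    also have "2 * (real k + 1 / 2) = 1 + real (2 * k)" by simp
    also have "Gamma (1 + real (2 * k)) = fact (2 * k)" using Gamma_fact[of "2*k", where 'a=real] by simp
    also have "real k + 1 / 2 + 1 / 2 = 1 + real k" by simp
    also have "Gamma (1 + real k) = fact k" using Gamma_fact[of "k", where 'a=real] by simp
    also have "2 powr (1 - (1 + real (2 * k))) = 1 / 2 ^ (2 * k)"
      by (simp add: powr_minus powr_realpow[symmetric] field_simps)
    finally have half: "Gamma (real k + 1 / 2) = sqrt pi * fact (2 * k) / (2 ^ (2 * k) * fact k)"
      by (simp add: field_simps)
    have g: "Gamma (a + 1) > 0" using a by (simp add: Gamma_real_pos)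
    have "integral\<^sup>L lborel (f k) = Beta (real k + 1 / 2) (a + 1) * ((- 1) ^ k * z ^ (2 * k) / fact (2 * k))"
      unfolding f_def using poisson_weight_moment[OF a, of k] by simp
    also have "Beta (real k + 1 / 2) (a + 1) =
       sqrt pi * fact (2 * k) / (2 ^ (2 * k) * fact k) * Gamma (a + 1) * rGamma (real k + a + 3 / 2)"
      unfolding Beta_altdef half by (simp add: add_ac)
    finally show ?thesis using g by (simp add: field_simps)
  qed
  ultimately show ?thesis by simp
qed

lemma bessel_entire_poisson:
  assumes "a > - 1"
  shows "bessel_entire (a + 1 / 2) z =
    (LINT u|lborel. poisson_weight a u * cos (z * sqrt u)) / (sqrt pi * Gamma (a + 1))"
  using poisson_cos_sums[OF assms, of z] by (simp add: bessel_entire_def sums_iff add_ac)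

text \<open>
  The recurrence \<open>J\<^sub>\<mu> = (2 (\<mu> + 1) / z) J\<^bsub>\<mu>+1\<^esub> - J\<^bsub>\<mu>+2\<^esub>\<close>, read off the coefficients.
  It carries convergence and bounds from Poisson's integral, which covers only orders above \<open>-1/2\<close>, down to
  all orders above \<open>-1\<close>; the order \<open>\<lambda> - 1/2\<close> of the second factor of the kernel needs this range.
\<close>

lemma bessel_entire_sums:
  assumes "\<mu> > - 1"
  shows "(\<lambda>k. (- 1) ^ k / fact k * rGamma (real k + \<mu> + 1) * (z / 2) ^ (2 * k)) sums bessel_entire \<mu> z"
    and "bessel_entire \<mu> z =
      (\<mu> + 1) * bessel_entire (\<mu> + 1) z - (z / 2)\<^sup>2 * bessel_entire (\<mu> + 2) z"
proof -
  let ?t = "\<lambda>\<mu> k. (- 1) ^ k / fact k * rGamma (real k + \<mu> + 1) * (z / 2) ^ (2 * k)"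
  have S: "?t (b + 1 / 2) sums bessel_entire (b + 1 / 2) z" if "b > - 1" for b
    using poisson_cos_sums[OF that, of z] bessel_entire_poisson[OF that, of z] by (simp add: add_ac)
  have S1: "?t (\<mu> + 1) sums bessel_entire (\<mu> + 1) z"
    using S[of "\<mu> + 1 / 2"] assms by (simp add: add_ac)
  have S2: "?t (\<mu> + 2) sums bessel_entire (\<mu> + 2) z"
    using S[of "\<mu> + 3 / 2"] assms by (simp add: add_ac)
  have "(\<lambda>k. case k of 0 \<Rightarrow> 0 | Suc j \<Rightarrow> (z / 2)\<^sup>2 * ?t (\<mu> + 2) j) sums ((z / 2)\<^sup>2 * bessel_entire (\<mu> + 2) z)"
    by (rule sums_Suc_imp) (use sums_mult[OF S2, of "(z/2)\<^sup>2"] in simp_all)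
  from sums_diff[OF sums_mult[OF S1, of "\<mu> + 1"] this]
  have "(\<lambda>k. (\<mu> + 1) * ?t (\<mu> + 1) k - (case k of 0 \<Rightarrow> 0 | Suc j \<Rightarrow> (z / 2)\<^sup>2 * ?t (\<mu> + 2) j)) sums
     ((\<mu> + 1) * bessel_entire (\<mu> + 1) z - (z / 2)\<^sup>2 * bessel_entire (\<mu> + 2) z)" .
  moreover have "(\<mu> + 1) * ?t (\<mu> + 1) k - (case k of 0 \<Rightarrow> 0 | Suc j \<Rightarrow> (z / 2)\<^sup>2 * ?t (\<mu> + 2) j) = ?t \<mu> k" for k
  proof (cases k)
    case 0
    have "(\<mu> + 1) * rGamma (\<mu> + 1 + 1) = rGamma (\<mu> + 1)" by (rule rGamma_plus1)
    with 0 show ?thesis by (simp add: add_ac)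
  next
    case (Suc j)
    have r: "rGamma (real k + \<mu> + 1) = (real j + \<mu> + 2) * rGamma (real j + \<mu> + 3)"
      using rGamma_plus1[of "real j + \<mu> + 2"] Suc by (simp add: add_ac)
    define A B E where "A = (- 1) ^ j / (real (Suc j) * fact j)" and "B = rGamma (real j + \<mu> + 3)"
      and "E = (z / 2)\<^sup>2 * (z / 2) ^ (2 * j)"
    have "?t \<mu> k = - (A * ((real j + \<mu> + 2) * B) * E)"
      unfolding r A_def B_def E_def by (simp add: Suc power2_eq_square)
    moreover have "?t (\<mu> + 1) k = - (A * B * E)"
      unfolding A_def B_def E_def Suc by (simp add: power2_eq_square add_ac)
    moreover have "(case k of 0 \<Rightarrow> 0 | Suc j \<Rightarrow> (z / 2)\<^sup>2 * ?t (\<mu> + 2) j) = A * real (Suc j) * B * E"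
      unfolding A_def B_def E_def Suc by (simp add: add_ac)
    ultimately show ?thesis by (simp only:) (simp add: algebra_simps)
  qed
  ultimately have main: "?t \<mu> sums ((\<mu> + 1) * bessel_entire (\<mu> + 1) z - (z / 2)\<^sup>2 * bessel_entire (\<mu> + 2) z)"
    by simp
  then show eq: "bessel_entire \<mu> z = (\<mu> + 1) * bessel_entire (\<mu> + 1) z - (z / 2)\<^sup>2 * bessel_entire (\<mu> + 2) z"
    by (simp add: bessel_entire_def sums_iff)
  show "?t \<mu> sums bessel_entire \<mu> z" using main eq by simp
qed

lemma borel_measurable_bessel_entire [measurable]: "bessel_entire \<mu> \<in> borel_measurable borel"
  unfolding bessel_entire_def[abs_def] by measurable

text \<open>
  The power series alone only gives growth like \<open>exp \<bar>z\<bar>\<close>, and the factor \<open>exp (- \<tau> r)\<close> would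
  beat that for large \<open>\<tau>\<close> only. Polynomial growth on the real line, where the cosines in Poisson's integral are
  bounded, makes the integral that defines the kernel converge absolutely for every \<open>\<tau> > 0\<close>.
\<close>

lemma bessel_entire_bound:
  assumes "\<mu> > - 1"
  obtains B where "B > 0" "\<And>z. \<bar>bessel_entire \<mu> z\<bar> \<le> B * (1 + z\<^sup>2)"
proof -
  \<comment> \<open>In the range of Poisson's integral the function is even bounded.\<close>
  have *: "\<exists>B\<ge>0. \<forall>z. \<bar>bessel_entire (a + 1 / 2) z\<bar> \<le> B" if a: "a > - 1" for a
  proof (intro exI conjI allI)
    let ?W = "integral\<^sup>L lborel (poisson_weight a)"
    have g: "sqrt pi * Gamma (a + 1) > 0" using a by (simp add: Gamma_real_pos)
    show "?W / (sqrt pi * Gamma (a + 1)) \<ge> 0"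
      using g by (intro divide_nonneg_pos integral_nonneg) auto
    fix z
    have "\<bar>LINT u|lborel. poisson_weight a u * cos (z * sqrt u)\<bar> \<le>
        (LINT u|lborel. \<bar>poisson_weight a u * cos (z * sqrt u)\<bar>)"
      by (rule integral_abs_bound)
    also have "\<dots> \<le> ?W"
    proof (rule integral_mono_AE')
      show "integrable lborel (poisson_weight a)" by (rule integrable_poisson_weight[OF a])
      show "AE u in lborel. \<bar>poisson_weight a u * cos (z * sqrt u)\<bar> \<le> poisson_weight a u"
        by (auto simp: abs_mult intro!: mult_left_le)
    qed auto
    finally show "\<bar>bessel_entire (a + 1 / 2) z\<bar> \<le> ?W / (sqrt pi * Gamma (a + 1))"
      unfolding bessel_entire_poisson[OF a] using g by (simp add: abs_divide divide_right_mono)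
  qed
  obtain B1 where B1: "B1 \<ge> 0" "\<And>z. \<bar>bessel_entire (\<mu> + 1) z\<bar> \<le> B1"
    using *[of "\<mu> + 1 / 2"] assms by (auto simp: add_ac)
  obtain B2 where B2: "B2 \<ge> 0" "\<And>z. \<bar>bessel_entire (\<mu> + 2) z\<bar> \<le> B2"
    using *[of "\<mu> + 3 / 2"] assms by (auto simp: add_ac)
  show ?thesis
  proof (rule that)
    let ?B = "(\<mu> + 1) * B1 + B2 + 1"
    show "?B > 0" using assms B1 B2 by (simp add: add_nonneg_pos)
    fix z :: real
    have "\<bar>bessel_entire \<mu> z\<bar> \<le> \<bar>(\<mu> + 1) * bessel_entire (\<mu> + 1) z\<bar> + \<bar>(z / 2)\<^sup>2 * bessel_entire (\<mu> + 2) z\<bar>"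
      unfolding bessel_entire_sums(2)[OF assms] by (rule abs_triangle_ineq4)
    also have "\<dots> \<le> (\<mu> + 1) * B1 + (z / 2)\<^sup>2 * B2"
      using assms B1(2)[of z] B2(2)[of z] by (auto simp: abs_mult intro!: add_mono mult_left_mono)
    also have "\<dots> \<le> (\<mu> + 1) * B1 * (1 + z\<^sup>2) + B2 * (1 + z\<^sup>2)"
    proof (intro add_mono)
      show "(\<mu> + 1) * B1 \<le> (\<mu> + 1) * B1 * (1 + z\<^sup>2)" using mult_nonneg_nonneg[of "(\<mu> + 1) * B1" "z\<^sup>2"] mult_nonneg_nonneg[of "\<mu> + 1" B1] assms B1(1) by (simp add: algebra_simps)
      show "(z / 2)\<^sup>2 * B2 \<le> B2 * (1 + z\<^sup>2)"
        using B2(1) by (subst mult.commute, intro mult_left_mono) (auto simp: power2_eq_square)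
    qed
    also have "\<dots> \<le> ?B * (1 + z\<^sup>2)" by (simp add: algebra_simps)
    finally show "\<bar>bessel_entire \<mu> z\<bar> \<le> ?B * (1 + z\<^sup>2)" .
  qed
qed

section \<open>Laplace transforms\<close>

lemma laplace_powr:
  fixes a s :: real
  assumes a: "a > 0" and s: "s > 0"
  shows "has_bochner_integral lborel (\<lambda>r. indicator {0<..} r * r powr (a - 1) * exp (- (s * r))) (Gamma a * s powr (- a))"
proof -
  let ?f = "\<lambda>t::real. indicator {0<..} t * t powr (a - 1) * exp (- t)"
  have "has_bochner_integral lborel ?f (Gamma a)"
  proof (rule has_bochner_integral_nn_integral)
    have "(\<integral>\<^sup>+ t. ennreal (?f t) \<partial>lborel) = (\<integral>\<^sup>+ t. ennreal (indicator {0..} t * t powr (a - 1) / exp t) \<partial>lborel)"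
      by (intro nn_integral_cong) (auto simp: indicator_def exp_minus field_simps)
    then show "(\<integral>\<^sup>+ t. ennreal (?f t) \<partial>lborel) = ennreal (Gamma a)"
      using Gamma_conv_nn_integral_real[OF a] by simp
  qed (use a in \<open>auto simp: Gamma_real_pos less_imp_le\<close>)
  then have i: "integrable lborel ?f" and e: "integral\<^sup>L lborel ?f = Gamma a"
    by (auto simp: has_bochner_integral_iff)
  have eq: "?f (0 + s * r) = s powr (a - 1) * (indicator {0<..} r * r powr (a - 1) * exp (- (s * r)))" for r
    using s by (auto simp: indicator_def powr_mult zero_less_mult_iff)
  have "integrable lborel (\<lambda>r. ?f (0 + s * r))"
    using lborel_integrable_real_affine[OF i, of s 0] s by simp
  then have 1: "integrable lborel (\<lambda>r. indicator {0<..} r * r powr (a - 1) * exp (- (s * r)))"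
    unfolding eq using s by simp
  have "Gamma a = s * (LINT r|lborel. ?f (0 + s * r))"
    using lborel_integral_real_affine[of s ?f 0] s e by simp
  also have "\<dots> = s powr a * (LINT r|lborel. indicator {0<..} r * r powr (a - 1) * exp (- (s * r)))"
    unfolding eq using s powr_add[of s 1 "a - 1"] by (simp only: integral_mult_right_zero) simp
  finally show ?thesis using 1 s by (simp add: has_bochner_integral_iff powr_minus field_simps)
qed

text \<open>
  Differentiation under the integral: the difference quotients of \<open>exp (- s r)\<close> are at most
  \<open>r exp (- \<rho> r)\<close>, and the factor \<open>r\<close> is absorbed by giving up half of the exponential decay.
\<close>

lemma laplace_holomorphic:
  fixes \<psi> :: "real \<Rightarrow> real"
  assumes [measurable]: "\<psi> \<in> borel_measurable borel"
    and neg: "\<And>r. r \<le> 0 \<Longrightarrow> \<psi> r = 0"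
    and int: "\<And>\<rho>. \<rho> > 0 \<Longrightarrow> integrable lborel (\<lambda>r. \<psi> r * exp (- (\<rho> * r)))"
  shows "(\<lambda>s. LINT r|lborel. of_real (\<psi> r) * exp (- (s * of_real r))) holomorphic_on {s. Re s > 0}"
    and "\<And>s. Re s > 0 \<Longrightarrow> integrable lborel (\<lambda>r. complex_of_real (\<psi> r) * exp (- (s * of_real r)))"
proof -
  let ?h = "\<lambda>s r. complex_of_real (\<psi> r) * exp (- (s * of_real r))"
  show ci: "integrable lborel (?h s)" if "Re s > 0" for s
    by (rule Bochner_Integration.integrable_bound[OF int[OF that]]) (auto simp: norm_mult abs_mult)
  show "(\<lambda>s. integral\<^sup>L lborel (?h s)) holomorphic_on {s. Re s > 0}"
    unfolding holomorphic_on_open[OF open_halfspace_Re_gt]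
  proof (intro ballI)
    fix s0 :: complex assume "s0 \<in> {s. Re s > 0}"
    \<comment> \<open>A smaller half-plane that still contains the point, with a uniform rate of decay.\<close>
    define \<rho> where "\<rho> = Re s0 / 2"
    have \<rho>: "\<rho> > 0" "Re s0 > \<rho>" using \<open>s0 \<in> _\<close> by (auto simp: \<rho>_def)
    let ?U = "{s. Re s > \<rho>}"
    let ?D = "LINT r|lborel. complex_of_real (\<psi> r) * (- of_real r * exp (- (s0 * of_real r)))"
    have "((\<lambda>s. (integral\<^sup>L lborel (?h s) - integral\<^sup>L lborel (?h s0)) / (s - s0)) \<longlongrightarrow> ?D) (at s0 within ?U)"
      unfolding tendsto_at_iff_sequentially
    proof (intro allI impI)
      fix X :: "nat \<Rightarrow> complex"
      assume X: "\<forall>i. X i \<in> ?U - {s0}" and lim: "X \<longlonglongrightarrow> s0"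
      have bound: "norm ((exp (- (X i * of_real r)) - exp (- (s0 * of_real r))) / (X i - s0)) \<le>
          2 / \<rho> * exp (- (\<rho> / 2 * r))" if r: "r > 0" for i r
      proof -
        have "norm (exp (- (X i * of_real r)) - exp (- (s0 * of_real r))) \<le> (r * exp (- (\<rho> * r))) * norm (X i - s0)"
        proof (rule field_differentiable_bound[where S = ?U and f' = "\<lambda>s. - of_real r * exp (- (s * of_real r))"])
          show "convex ?U" by (rule convex_halfspace_Re_gt)
          fix z assume z: "z \<in> ?U"
          show "((\<lambda>s. exp (- (s * complex_of_real r))) has_field_derivative - of_real r * exp (- (z * of_real r))) (at z within ?U)"
            by (auto intro!: derivative_eq_intros)
          show "norm (- complex_of_real r * exp (- (z * of_real r))) \<le> r * exp (- (\<rho> * r))"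
            using z r by (auto simp: norm_mult)
        qed (use X \<rho> in auto)
        also have "r * exp (- (\<rho> * r)) \<le> 2 / \<rho> * exp (- (\<rho> / 2 * r))"
        proof -
          have "\<rho> / 2 * r \<le> exp (\<rho> / 2 * r)" using exp_ge_add_one_self[of "\<rho> / 2 * r"] by linarith
          then have "\<rho> / 2 * r * exp (- (\<rho> * r)) \<le> exp (\<rho> / 2 * r) * exp (- (\<rho> * r))" by (intro mult_right_mono) auto
          also have "\<dots> = exp (- (\<rho> / 2 * r))" by (simp add: exp_add[symmetric] field_simps)
          finally show ?thesis using \<rho> by (simp add: field_simps)
        qed
        finally show ?thesis using X by (simp add: norm_divide divide_le_eq mult_right_mono)
      qed
      have "(\<lambda>i. LINT r|lborel. of_real (\<psi> r) * ((exp (- (X i * of_real r)) - exp (- (s0 * of_real r))) / (X i - s0))) \<longlonglongrightarrow> ?D"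
      proof (rule integral_dominated_convergence)
        show "integrable lborel (\<lambda>r. 2 / \<rho> * \<bar>\<psi> r * exp (- (\<rho> / 2 * r))\<bar>)"
          using \<rho> int[of "\<rho> / 2"] by auto
        show "AE r in lborel. norm (of_real (\<psi> r) * ((exp (- (X i * of_real r)) - exp (- (s0 * of_real r))) / (X i - s0))) \<le>
           2 / \<rho> * \<bar>\<psi> r * exp (- (\<rho> / 2 * r))\<bar>" for i
        proof (intro AE_I2)
          fix r :: real
          show "norm (of_real (\<psi> r) * ((exp (- (X i * of_real r)) - exp (- (s0 * of_real r))) / (X i - s0))) \<le>
             2 / \<rho> * \<bar>\<psi> r * exp (- (\<rho> / 2 * r))\<bar>"
          proof (cases "r > 0")
            case True
            have "norm (of_real (\<psi> r) * ((exp (- (X i * of_real r)) - exp (- (s0 * of_real r))) / (X i - s0)))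
              \<le> \<bar>\<psi> r\<bar> * (2 / \<rho> * exp (- (\<rho> / 2 * r)))"
              unfolding norm_mult by (intro mult_mono bound True) auto
            then show ?thesis by (simp add: abs_mult mult_ac)
          qed (simp add: neg)
        qed
        show "AE r in lborel. (\<lambda>i. of_real (\<psi> r) * ((exp (- (X i * of_real r)) - exp (- (s0 * of_real r))) / (X i - s0))) \<longlonglongrightarrow>
           of_real (\<psi> r) * (- of_real r * exp (- (s0 * of_real r)))"
        proof (intro AE_I2 tendsto_mult tendsto_const)
          fix r :: real
          have "((\<lambda>s. exp (- (s * complex_of_real r))) has_field_derivative - of_real r * exp (- (s0 * of_real r))) (at s0)"
            by (auto intro!: derivative_eq_intros)
          then have "((\<lambda>s. (exp (- (s * complex_of_real r)) - exp (- (s0 * of_real r))) / (s - s0)) \<longlongrightarrow> - of_real r * exp (- (s0 * of_real r))) (at s0)"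
            by (simp add: has_field_derivative_iff)
          moreover have "filterlim X (at s0) sequentially"
            using lim X by (auto simp: filterlim_at)
          ultimately show "(\<lambda>i. (exp (- (X i * complex_of_real r)) - exp (- (s0 * of_real r))) / (X i - s0)) \<longlonglongrightarrow> - of_real r * exp (- (s0 * of_real r))"
            by (rule filterlim_compose)
        qed
      qed measurable
      moreover have "(integral\<^sup>L lborel (?h (X i)) - integral\<^sup>L lborel (?h s0)) / (X i - s0) =
          (LINT r|lborel. of_real (\<psi> r) * ((exp (- (X i * of_real r)) - exp (- (s0 * of_real r))) / (X i - s0)))" for i
      proof -
        have "Re (X i) > 0" "Re s0 > 0" using X \<rho> by (auto dest: spec[of _ i])
        then have "integral\<^sup>L lborel (?h (X i)) - integral\<^sup>L lborel (?h s0) = (LINT r|lborel. ?h (X i) r - ?h s0 r)"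
          by (intro Bochner_Integration.integral_diff[symmetric] ci)
        then have "(integral\<^sup>L lborel (?h (X i)) - integral\<^sup>L lborel (?h s0)) / (X i - s0) =
            (LINT r|lborel. (?h (X i) r - ?h s0 r) / (X i - s0))"
          by (simp only: integral_divide_zero)
        then show ?thesis by (simp only: right_diff_distrib times_divide_eq_right)
      qed
      ultimately show "((\<lambda>s. (integral\<^sup>L lborel (?h s) - integral\<^sup>L lborel (?h s0)) / (s - s0)) \<circ> X) \<longlonglongrightarrow> ?D"
        by (simp only: o_def)
    qed
    then have "((\<lambda>s. integral\<^sup>L lborel (?h s)) has_field_derivative ?D) (at s0 within ?U)"
      by (simp add: has_field_derivative_iff)
    moreover have "at s0 within ?U = at s0"
      using \<rho> by (intro at_within_open open_halfspace_Re_gt) auto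
    ultimately show "\<exists>D. ((\<lambda>s. integral\<^sup>L lborel (?h s)) has_field_derivative D) (at s0)" by auto
  qed
qed

text \<open>
  The binomial series and its image under \<open>z d/dz\<close>: the coefficients of the Laplace transform of
  \<open>bessel_density\<close> carry a factor that is linear in the index.
\<close>

lemma gbinomial_linear_sums:
  fixes a b z :: real
  assumes z: "\<bar>z\<bar> < 1"
  shows "(\<lambda>k. (real k + b) * ((a gchoose k) * z ^ k)) sums (b * (1 + z) powr a + a * z * (1 + z) powr (a - 1))"
proof -
  have "(\<lambda>k. real k * ((a gchoose k) * z ^ k)) sums (a * z * (1 + z) powr (a - 1))"
  proof (rule sums_Suc_imp)
    have "(\<lambda>k. a * z * ((a - 1 gchoose k) * z ^ k)) sums (a * z * (1 + z) powr (a - 1))"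
      by (intro sums_mult gen_binomial_real z)
    moreover have "real (Suc k) * ((a gchoose Suc k) * z ^ Suc k) = a * z * ((a - 1 gchoose k) * z ^ k)" for k
      using gbinomial_absorption'[of "Suc k" a] by (simp add: field_simps)
    ultimately show "(\<lambda>k. real (Suc k) * ((a gchoose Suc k) * z ^ Suc k)) sums (a * z * (1 + z) powr (a - 1))"
      by (simp only:)
  qed simp
  from sums_add[OF this sums_mult[OF gen_binomial_real[OF z, of a], of b]]
  show ?thesis by (simp add: algebra_simps)
qed

section \<open>The Laplace transform of a Bessel function\<close>

text \<open>
  The part of the integrand of the kernel that depends on \<open>y\<close>, with all powers of \<open>r\<close>:
  \<open>2\<lambda> + 1\<close> is the sum of the two orders \<open>\<lambda> + 1/2\<close> and \<open>\<lambda> - 1/2\<close> and of the explicit factor \<open>r\<close>.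
\<close>

definition bessel_density :: "real \<Rightarrow> real \<Rightarrow> real \<Rightarrow> real" where
  "bessel_density lam y r = indicator {0<..} r * r powr (2 * lam + 1) * bessel_entire (lam - 1 / 2) (y * r)"

lemma borel_measurable_bessel_density [measurable]: "bessel_density lam y \<in> borel_measurable borel"
  unfolding bessel_density_def[abs_def] by measurable

lemma integrable_bessel_density:
  assumes lam: "lam > - 1 / 2" and \<rho>: "\<rho> > 0"
  shows "integrable lborel (\<lambda>r. bessel_density lam y r * exp (- (\<rho> * r)))"
proof -
  obtain B where B: "B > 0" "\<And>z. \<bar>bessel_entire (lam - 1 / 2) z\<bar> \<le> B * (1 + z\<^sup>2)"
    using bessel_entire_bound[of "lam - 1 / 2"] lam by auto
  let ?g = "\<lambda>a r. indicator {0<..} r * r powr (a - 1) * exp (- (\<rho> * r))"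
  have g: "integrable lborel (?g a)" if "a > 0" for a
    using integrable.intros[OF laplace_powr[OF that \<rho>]] .
  have "integrable lborel (?g (2 * lam + 2))" "integrable lborel (?g (2 * lam + 4))"
    by (rule g, use lam in linarith)+
  then have "integrable lborel (\<lambda>r. B * ?g (2 * lam + 2) r + B * y\<^sup>2 * ?g (2 * lam + 4) r)"
    by (intro Bochner_Integration.integrable_add integrable_mult_right) auto
  then show ?thesis
  proof (rule Bochner_Integration.integrable_bound)
    show "AE r in lborel. norm (bessel_density lam y r * exp (- (\<rho> * r))) \<le>
      norm (B * ?g (2 * lam + 2) r + B * y\<^sup>2 * ?g (2 * lam + 4) r)"
    proof (intro AE_I2)
      fix r :: real
      show "norm (bessel_density lam y r * exp (- (\<rho> * r))) \<le>
        norm (B * ?g (2 * lam + 2) r + B * y\<^sup>2 * ?g (2 * lam + 4) r)"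
      proof (cases "r > 0")
        case True
        have e: "r powr (2 * lam + 4 - 1) = r\<^sup>2 * r powr (2 * lam + 2 - 1)"
          using True powr_add[of r 2 "2 * lam + 1"] by (simp add: add_ac)
        have "norm (bessel_density lam y r * exp (- (\<rho> * r))) =
            r powr (2 * lam + 1) * \<bar>bessel_entire (lam - 1 / 2) (y * r)\<bar> * exp (- (\<rho> * r))"
          using True by (simp add: bessel_density_def abs_mult)
        also have "\<dots> \<le> r powr (2 * lam + 1) * (B * (1 + (y * r)\<^sup>2)) * exp (- (\<rho> * r))"
          by (intro mult_right_mono mult_left_mono B) auto
        also have "\<dots> = B * ?g (2 * lam + 2) r + B * y\<^sup>2 * ?g (2 * lam + 4) r"
          unfolding e using True by (simp add: algebra_simps power_mult_distrib)
        also have "\<dots> \<le> norm \<dots>" by simp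
        finally show ?thesis .
      qed (simp add: bessel_density_def)
    qed
  qed measurable
qed

text \<open>
  The \<open>k\<close>-th power of the Bessel series contributes a Gamma integral at \<open>2 (k + \<lambda> + 1)\<close>; the
  duplication formula splits it so that one factor cancels against the coefficient of the series up to
  \<open>k + \<lambda> + 1/2\<close>, and the other one is a binomial coefficient.
\<close>

lemma laplace_bessel_density_term:
  fixes k :: nat
  assumes lam: "lam > - 1 / 2" and s: "s > 0"
  shows "(- 1) ^ k / fact k * rGamma (real k + lam + 1 / 2) * (y / 2) ^ (2 * k) *
      (Gamma (2 * real k + 2 * lam + 2) * s powr (- (2 * real k + 2 * lam + 2))) =
    2 powr (2 * lam + 1) * Gamma (lam + 1) / sqrt pi * s powr (- 2 * lam - 2) *
      ((real k + (lam + 1 / 2)) * ((- lam - 1 gchoose k) * ((y / s)\<^sup>2) ^ k))"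
proof -
  define G where "G = Gamma (real k + lam + 1)"
  have pos: "real k + lam + 1 > 0" "real k + lam + 1 / 2 > 0" using lam by auto
  have "G * Gamma (real k + lam + 1 + 1 / 2) =
      2 powr (1 - 2 * (real k + lam + 1)) * sqrt pi * Gamma (2 * (real k + lam + 1))"
    unfolding G_def by (rule Gamma_duplication_real) (use pos in simp)
  also have "Gamma (real k + lam + 1 + 1 / 2) = (real k + lam + 1 / 2) * Gamma (real k + lam + 1 / 2)"
  proof -
    have "real k + lam + 1 / 2 \<notin> \<int>\<^sub>\<le>\<^sub>0" using pos by (metis nonpos_Ints_nonpos not_less)
    from Gamma_plus1[OF this] show ?thesis by (simp add: add_ac)
  qed
  also have "2 powr (1 - 2 * (real k + lam + 1)) = 1 / (2 powr (2 * lam + 1) * 2 ^ (2 * k))"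
    by (simp add: powr_minus[symmetric] powr_add[symmetric] powr_realpow[symmetric] divide_inverse algebra_simps)
  finally have g1: "Gamma (2 * (real k + lam + 1)) * rGamma (real k + lam + 1 / 2) =
      2 powr (2 * lam + 1) * 2 ^ (2 * k) / sqrt pi * (G * (real k + lam + 1 / 2))"
    using Gamma_real_pos[OF pos(2)] by (simp add: field_simps rGamma_inverse_Gamma)
  have "pochhammer (lam + 1) k = Gamma (lam + 1 + real k) / Gamma (lam + 1)"
    using lam by (intro pochhammer_Gamma) (auto elim!: nonpos_Ints_cases)
  moreover have "Gamma (lam + 1) > 0" by (rule Gamma_real_pos) (use lam in simp)
  ultimately have g2: "G = Gamma (lam + 1) * ((- 1) ^ k * fact k * (- lam - 1 gchoose k))"
    by (simp add: gbinomial_pochhammer G_def field_simps)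
  have s1: "s powr (- (2 * real k + 2 * lam + 2)) = s powr (- 2 * lam - 2) / s ^ (2 * k)"
  proof -
    have "- (2 * real k + 2 * lam + 2) = (- 2 * lam - 2) - real (2 * k)" by simp
    then show ?thesis using s by (simp only: powr_diff powr_realpow)
  qed
  have "(- 1) ^ k / fact k * rGamma (real k + lam + 1 / 2) * (y / 2) ^ (2 * k) *
      (Gamma (2 * real k + 2 * lam + 2) * s powr (- (2 * real k + 2 * lam + 2))) =
      (- 1) ^ k / fact k * (y / 2) ^ (2 * k) * (Gamma (2 * (real k + lam + 1)) * rGamma (real k + lam + 1 / 2)) *
      (s powr (- 2 * lam - 2) / s ^ (2 * k))"
    unfolding s1 by (simp add: algebra_simps)
  also have "\<dots> = 2 powr (2 * lam + 1) * Gamma (lam + 1) / sqrt pi * s powr (- 2 * lam - 2) *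
      ((real k + (lam + 1 / 2)) * ((- lam - 1 gchoose k) * (y ^ (2 * k) / s ^ (2 * k))))"
  proof -
    have *: "e / f * (Y / W) * (Q * W / q * (g * (e * f * B) * b)) * (S / T) = Q * g / q * S * (b * (B * (Y / T)))"
      if "e * e = 1" "f \<noteq> 0" "W \<noteq> 0" for e f Y W Q q g B b S T :: real
    proof -
      have "e / f * (Y / W) * (Q * W / q * (g * (e * f * B) * b)) * (S / T) =
        (e * e) * (inverse f * f) * (inverse W * W) * (Q * g / q * S * (b * (B * (Y / T))))"
        by (simp only: divide_inverse mult_ac)
      then show ?thesis using that by simp
    qed
    have "(- 1 :: real) ^ k * (- 1) ^ k = 1" by (simp add: power_mult_distrib[symmetric])
    then show ?thesis
      unfolding g1 g2 power_divide[of y 2 "2 * k"] unfolding add.assoc by (intro *) auto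
  qed
  also have "y ^ (2 * k) / s ^ (2 * k) = ((y / s)\<^sup>2) ^ k" by (simp add: power_divide power_mult)
  finally show ?thesis .
qed

text \<open>
  For \<open>s > y\<close> the Bessel series can be integrated term by term: the result is a binomial series in
  \<open>(y/s)\<^sup>2 < 1\<close>, and it converges absolutely.
\<close>

lemma laplace_bessel_density_real:
  assumes lam: "lam > - 1 / 2" and y: "0 < y" "y < s"
  shows "(LINT r|lborel. bessel_density lam y r * exp (- (s * r))) =
    2 powr (2 * lam) * Gamma (lam + 1) / sqrt pi * ((2 * lam + 1) * s\<^sup>2 - y\<^sup>2) * (s\<^sup>2 + y\<^sup>2) powr (- lam - 2)"
proof -
  define c where "c k = (- 1) ^ k / fact k * rGamma (real k + lam + 1 / 2) * (y / 2) ^ (2 * k)" for k :: nat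
  let ?g = "\<lambda>k r. indicator {0<..} r * r powr (2 * real k + 2 * lam + 2 - 1) * exp (- (s * r))"
  define f where "f k r = c k * ?g k r" for k r
  have s: "s > 0" using y by simp
  have g: "has_bochner_integral lborel (?g k) (Gamma (2 * real k + 2 * lam + 2) * s powr (- (2 * real k + 2 * lam + 2)))" for k
    using laplace_powr[of "2 * real k + 2 * lam + 2" s] lam s by simp
  define P where "P = 2 powr (2 * lam + 1) * Gamma (lam + 1) / sqrt pi * s powr (- 2 * lam - 2)"
  define q where "q = (y / s)\<^sup>2"
  have q: "0 < q" "q < 1" using y by (auto simp: q_def power_less_one_iff)
  have val: "c k * (Gamma (2 * real k + 2 * lam + 2) * s powr (- (2 * real k + 2 * lam + 2))) =
     P * ((real k + (lam + 1 / 2)) * ((- lam - 1 gchoose k) * q ^ k))" for k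
    unfolding c_def P_def q_def by (rule laplace_bessel_density_term[OF lam s])
  have "(\<lambda>k. integral\<^sup>L lborel (f k)) sums (LINT r|lborel. (\<Sum>k. f k r))"
  proof (rule sums_integral)
    show "integrable lborel (f k)" for k
      unfolding f_def using g[of k] by (auto simp: has_bochner_integral_iff)
    have c_abs: "\<bar>c k\<bar> = (- 1) ^ k * c k" for k
    proof -
      have "rGamma (real k + lam + 1 / 2) > 0"
        using lam Gamma_real_pos[of "real k + lam + 1 / 2"] by (simp add: rGamma_inverse_Gamma)
      then have "\<bar>c k\<bar> = 1 / fact k * rGamma (real k + lam + 1 / 2) * (y / 2) ^ (2 * k)"
        using y by (simp add: c_def abs_mult power_abs)
      then show ?thesis by (simp add: c_def)
    qed
    show "AE r in lborel. summable (\<lambda>k. norm (f k r))"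
    proof (intro AE_I2)
      fix r :: real
      show "summable (\<lambda>k. norm (f k r))"
      proof (cases "r > 0")
        case True
        define t where "t k = (- 1) ^ k / fact k * rGamma (real k + (lam - 1 / 2) + 1)" for k :: nat
        \<comment> \<open>Convergence at a slightly larger argument makes the power series converge absolutely.\<close>
        have "summable (\<lambda>k. t k * (((y * r + 1) / 2) ^ 2) ^ k)"
          using bessel_entire_sums(1)[of "lam - 1 / 2" "y * r + 1"] lam
          by (auto simp: t_def sums_iff power_mult)
        then have "summable (\<lambda>k. norm (t k * (((y * r) / 2) ^ 2) ^ k))"
        proof (rule powser_insidea)
          have "(y * r / 2)\<^sup>2 < ((y * r + 1) / 2)\<^sup>2" using y True by (intro power_strict_mono) auto
          then show "norm ((y * r / 2)\<^sup>2) < norm (((y * r + 1) / 2)\<^sup>2)" by simp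
        qed
        then have "summable (\<lambda>k. norm (t k * (((y * r) / 2) ^ 2) ^ k) * (r powr (2 * lam + 1) * exp (- (s * r))))"
          by (rule summable_mult2)
        moreover have "norm (t k * (((y * r) / 2) ^ 2) ^ k) * (r powr (2 * lam + 1) * exp (- (s * r))) = norm (f k r)" for k
        proof -
          have "r powr (2 * real k + 2 * lam + 2 - 1) = r ^ (2 * k) * r powr (2 * lam + 1)"
            using True by (simp add: powr_realpow[symmetric] powr_add[symmetric] algebra_simps)
          moreover have "(((y * r) / 2) ^ 2) ^ k = (y / 2) ^ (2 * k) * r ^ (2 * k)"
            by (simp add: power_mult power_mult_distrib power_divide)
          ultimately have "f k r = t k * (((y * r) / 2) ^ 2) ^ k * (r powr (2 * lam + 1) * exp (- (s * r)))"
            using True by (simp add: f_def c_def t_def add_ac)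
          then show ?thesis by (simp add: abs_mult)
        qed
        ultimately show ?thesis by simp
      qed (simp add: f_def)
    qed
    \<comment> \<open>Taking absolute values amounts to replacing q by -q, still inside the disc of convergence.\<close>
    have "(LINT r|lborel. norm (f k r)) = P * ((real k + (lam + 1 / 2)) * ((- lam - 1 gchoose k) * (- q) ^ k))" for k
    proof -
      have "(LINT r|lborel. norm (f k r)) = (LINT r|lborel. \<bar>c k\<bar> * ?g k r)"
        by (intro Bochner_Integration.integral_cong) (auto simp: f_def abs_mult)
      also have "\<dots> = (- 1) ^ k * (c k * (Gamma (2 * real k + 2 * lam + 2) * s powr (- (2 * real k + 2 * lam + 2))))"
        using g[of k] by (simp add: has_bochner_integral_iff c_abs)
      also have "\<dots> = P * ((real k + (lam + 1 / 2)) * ((- lam - 1 gchoose k) * ((- 1) ^ k * q ^ k)))"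
        unfolding val by simp
      also have "(- 1) ^ k * q ^ k = (- q) ^ k" by (simp add: power_mult_distrib[symmetric])
      finally show ?thesis .
    qed
    then show "summable (\<lambda>k. LINT r|lborel. norm (f k r))"
      using sums_mult[OF gbinomial_linear_sums[of "- q" "lam + 1 / 2" "- lam - 1"], of P] q
      by (auto simp: sums_iff)
  qed
  moreover have "(\<Sum>k. f k r) = bessel_density lam y r * exp (- (s * r))" for r
  proof (cases "r > 0")
    case True
    have "f k r = ((- 1) ^ k / fact k * rGamma (real k + (lam - 1 / 2) + 1) * (y * r / 2) ^ (2 * k)) * (r powr (2 * lam + 1) * exp (- (s * r)))" for k
    proof -
      have "r powr (2 * real k + 2 * lam + 2 - 1) = r ^ (2 * k) * r powr (2 * lam + 1)"
        using True by (simp add: powr_realpow[symmetric] powr_add[symmetric] algebra_simps)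
      then show ?thesis
        using True by (simp add: f_def c_def power_mult_distrib power_divide add_ac)
    qed
    then have "(\<lambda>k. f k r) sums (bessel_entire (lam - 1 / 2) (y * r) * (r powr (2 * lam + 1) * exp (- (s * r))))"
      using sums_mult2[OF bessel_entire_sums(1)[of "lam - 1 / 2" "y * r"]] lam by simp
    then show ?thesis using True by (simp add: sums_iff bessel_density_def)
  qed (simp add: f_def bessel_density_def)
  moreover have "integral\<^sup>L lborel (f k) = P * ((real k + (lam + 1 / 2)) * ((- lam - 1 gchoose k) * q ^ k))" for k
    unfolding f_def val[symmetric] using g[of k] by (simp add: has_bochner_integral_iff)
  ultimately have "(\<lambda>k. P * ((real k + (lam + 1 / 2)) * ((- lam - 1 gchoose k) * q ^ k))) sums
      (LINT r|lborel. bessel_density lam y r * exp (- (s * r)))" by simp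
  moreover have "(\<lambda>k. P * ((real k + (lam + 1 / 2)) * ((- lam - 1 gchoose k) * q ^ k))) sums
      (P * ((lam + 1 / 2) * (1 + q) powr (- lam - 1) + (- lam - 1) * q * (1 + q) powr (- lam - 1 - 1)))"
    using q by (intro sums_mult gbinomial_linear_sums) auto
  ultimately have "(LINT r|lborel. bessel_density lam y r * exp (- (s * r))) =
     P * ((lam + 1 / 2) * (1 + q) powr (- lam - 1) + (- lam - 1) * q * (1 + q) powr (- lam - 1 - 1))"
    by (rule sums_unique2)
  also have "(1 + q) powr (- lam - 1) = (1 + q) * (1 + q) powr (- lam - 2)"
  proof -
    have "- lam - 1 = 1 + (- lam - 2)" by simp
    then show ?thesis using q powr_add[of "1 + q" 1 "- lam - 2"] by (simp only:) simp
  qed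
  also have "(1 + q) powr (- lam - 1 - 1) = (1 + q) powr (- lam - 2)" by (simp add: algebra_simps)
  also have "P * ((lam + 1 / 2) * ((1 + q) * (1 + q) powr (- lam - 2)) + (- lam - 1) * q * (1 + q) powr (- lam - 2)) =
     P / 2 * (2 * lam + 1 - q) * (1 + q) powr (- lam - 2)" by (simp add: field_simps)
  also have "(1 + q) powr (- lam - 2) = (s\<^sup>2 + y\<^sup>2) powr (- lam - 2) * s powr (2 * lam + 4)"
  proof -
    have "1 + q = (s\<^sup>2 + y\<^sup>2) / s\<^sup>2" using s by (simp add: q_def field_simps)
    then have "(1 + q) powr (- lam - 2) = (s\<^sup>2 + y\<^sup>2) powr (- lam - 2) / (s\<^sup>2) powr (- lam - 2)"
      by (simp add: powr_divide)
    also have "(s\<^sup>2) powr (- lam - 2) = s powr (- (2 * lam + 4))"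
    proof -
      have "(s powr 2) powr (- lam - 2) = s powr (2 * (- lam - 2))" by (rule powr_powr)
      also have "2 * (- lam - 2) = - (2 * lam + 4)" by simp
      finally show ?thesis using s by simp
    qed
    also have "(s\<^sup>2 + y\<^sup>2) powr (- lam - 2) / s powr (- (2 * lam + 4)) = (s\<^sup>2 + y\<^sup>2) powr (- lam - 2) * s powr (2 * lam + 4)"
      unfolding powr_minus[of s "2 * lam + 4"] by (simp add: divide_inverse)
    finally show ?thesis .
  qed
  also have "P / 2 * (2 * lam + 1 - q) * ((s\<^sup>2 + y\<^sup>2) powr (- lam - 2) * s powr (2 * lam + 4)) =
     2 powr (2 * lam) * Gamma (lam + 1) / sqrt pi * ((2 * lam + 1) * s\<^sup>2 - y\<^sup>2) * (s\<^sup>2 + y\<^sup>2) powr (- lam - 2)"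
  proof -
    have e1: "s powr (- 2 * lam - 2) * s powr (2 * lam + 4) = s\<^sup>2"
      using s powr_realpow[of s 2] by (simp add: powr_add[symmetric])
    have e2: "(2 * lam + 1 - q) * s\<^sup>2 = (2 * lam + 1) * s\<^sup>2 - y\<^sup>2"
      using s by (simp add: q_def field_simps)
    have e3: "2 powr (2 * lam + 1) = 2 * 2 powr (2 * lam)" by (simp add: powr_add)
    have "P / 2 * (2 * lam + 1 - q) * ((s\<^sup>2 + y\<^sup>2) powr (- lam - 2) * s powr (2 * lam + 4)) =
      2 powr (2 * lam + 1) / 2 * Gamma (lam + 1) / sqrt pi * (2 * lam + 1 - q) *
        (s powr (- 2 * lam - 2) * s powr (2 * lam + 4)) * (s\<^sup>2 + y\<^sup>2) powr (- lam - 2)"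
      by (simp add: P_def mult_ac)
    also have "\<dots> = 2 powr (2 * lam) * Gamma (lam + 1) / sqrt pi * ((2 * lam + 1 - q) * s\<^sup>2) * (s\<^sup>2 + y\<^sup>2) powr (- lam - 2)"
      unfolding e1 e3 by simp
    finally show ?thesis unfolding e2 .
  qed
  finally show ?thesis .
qed

text \<open>
  The Laplace transform of \<open>bessel_density\<close> as a function on the right half-plane.
\<close>

definition bessel_laplace :: "real \<Rightarrow> real \<Rightarrow> complex \<Rightarrow> complex" where
  "bessel_laplace lam y s =
    of_real (2 powr (2 * lam) * Gamma (lam + 1) / sqrt pi) * (of_real (2 * lam + 1) * s\<^sup>2 - of_real (y\<^sup>2)) *
    (s\<^sup>2 + of_real (y\<^sup>2)) powr of_real (- lam - 2)"

lemma square_plus_not_nonpos: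
  fixes s :: complex
  assumes "Re s > 0" and "y > 0"
  shows "s\<^sup>2 + of_real (y\<^sup>2) \<notin> \<real>\<^sub>\<le>\<^sub>0"
proof
  assume "s\<^sup>2 + of_real (y\<^sup>2) \<in> \<real>\<^sub>\<le>\<^sub>0"
  then have "Im (s\<^sup>2 + of_real (y\<^sup>2)) = 0" "Re (s\<^sup>2 + of_real (y\<^sup>2)) \<le> 0"
    by (auto simp: complex_nonpos_Reals_iff)
  then have "Im s = 0" "(Re s)\<^sup>2 - (Im s)\<^sup>2 + y\<^sup>2 \<le> 0"
    using assms by (auto simp: power2_eq_square)
  moreover have "(Re s)\<^sup>2 > 0" "y\<^sup>2 > 0" using assms by auto
  ultimately show False by auto
qed

text \<open>
  Analytic continuation from the ray \<open>s > y\<close>. The points with small real part are out of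
  reach of the series, and they are the ones that matter: the kernel is a limit as the real part tends to 0.
\<close>

lemma laplace_bessel_density:
  assumes lam: "lam > - 1 / 2" and y: "y > 0" and s: "Re s > 0"
  shows "integrable lborel (\<lambda>r. complex_of_real (bessel_density lam y r) * exp (- (s * of_real r)))"
    and "(LINT r|lborel. complex_of_real (bessel_density lam y r) * exp (- (s * of_real r))) = bessel_laplace lam y s"
proof -
  let ?L = "\<lambda>s. LINT r|lborel. complex_of_real (bessel_density lam y r) * exp (- (s * of_real r))"
  have hol: "?L holomorphic_on {s. Re s > 0}"
    using integrable_bessel_density[OF lam] by (intro laplace_holomorphic(1)) (auto simp: bessel_density_def)
  show "integrable lborel (\<lambda>r. complex_of_real (bessel_density lam y r) * exp (- (s * of_real r)))"
    using integrable_bessel_density[OF lam] s by (intro laplace_holomorphic(2)) (auto simp: bessel_density_def)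
  have hol': "bessel_laplace lam y holomorphic_on {s. Re s > 0}"
    unfolding bessel_laplace_def[abs_def]
    using square_plus_not_nonpos[OF _ y] by (intro holomorphic_intros) auto
  have "?L s - bessel_laplace lam y s = 0"
  proof (rule analytic_continuation[where f = "\<lambda>s. ?L s - bessel_laplace lam y s" and w = s and S = "{s. Re s > 0}" and U = "complex_of_real ` {y<..}" and \<xi> = "of_real (y + 1)"])
    show "(\<lambda>s. ?L s - bessel_laplace lam y s) holomorphic_on {s. Re s > 0}"
      by (intro holomorphic_intros hol hol')
    show "open {s. Re s > 0}" by (rule open_halfspace_Re_gt)
    show "connected {s. Re s > 0}" by (intro convex_connected convex_halfspace_Re_gt)
    show "complex_of_real ` {y<..} \<subseteq> {s. Re s > 0}" using y by auto
    show "complex_of_real (y + 1) \<in> {s. Re s > 0}" using y by simp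
    show "complex_of_real (y + 1) islimpt complex_of_real ` {y<..}"
    proof (rule islimpt_approachable[THEN iffD2], intro allI impI)
      fix e :: real assume "e > 0"
      then show "\<exists>x'\<in>complex_of_real ` {y<..}. x' \<noteq> complex_of_real (y + 1) \<and> dist x' (complex_of_real (y + 1)) < e"
        by (intro bexI[of _ "complex_of_real (y + 1 + e / 2)"])
           (auto simp: dist_norm simp flip: of_real_add of_real_diff of_real_divide intro!: imageI)
    qed
    fix z assume "z \<in> complex_of_real ` {y<..}"
    then obtain t where t: "t > y" "z = of_real t" by auto
    have "?L z = (LINT r|lborel. complex_of_real (bessel_density lam y r * exp (- (t * r))))"
      unfolding t by (simp add: exp_of_real[symmetric])
    also have "\<dots> = of_real (LINT r|lborel. bessel_density lam y r * exp (- (t * r)))"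
      by (rule integral_complex_of_real)
    also have "\<dots> = bessel_laplace lam y z"
      unfolding laplace_bessel_density_real[OF lam y t(1)] bessel_laplace_def t(2)
      using powr_of_real[of "t\<^sup>2 + y\<^sup>2" "- lam - 2"] by simp
    finally show "?L z - bessel_laplace lam y z = 0" by simp
  qed (use s in auto)
  then show "?L s = bessel_laplace lam y s" by simp
qed

section \<open>The Riesz kernel below the diagonal\<close>

lemma integral_half_line:
  fixes f :: "real \<Rightarrow> real"
  assumes [measurable]: "f \<in> borel_measurable borel"
  shows "integral\<^sup>L half_line f = (LINT x|lborel. indicator {0<..} x * f x)"
proof -
  have "integral\<^sup>L half_line f = (LINT x|lebesgue. indicator {0<..} x *\<^sub>R f x)"
    by (rule integral_restrict_space) simp
  also have "\<dots> = (LINT x|lborel. indicator {0<..} x *\<^sub>R f x)"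
    by (rule integral_completion) measurable
  finally show ?thesis by simp
qed

lemma Bessel_J_entire:
  assumes "\<mu> > - 1" "z > 0"
  shows "Bessel_J \<mu> z = (z / 2) powr \<mu> * bessel_entire \<mu> z"
proof -
  have "(- 1) ^ k / fact k * rGamma (real k + \<mu> + 1) * (z / 2) powr (2 * real k + \<mu>) =
      (z / 2) powr \<mu> * ((- 1) ^ k / fact k * rGamma (real k + \<mu> + 1) * (z / 2) ^ (2 * k))" for k
    using assms powr_realpow[of "z / 2" "2 * k"] by (simp add: powr_add)
  moreover have "(\<lambda>k. (z / 2) powr \<mu> * ((- 1) ^ k / fact k * rGamma (real k + \<mu> + 1) * (z / 2) ^ (2 * k))) sums
      ((z / 2) powr \<mu> * bessel_entire \<mu> z)"
    by (intro sums_mult bessel_entire_sums(1) assms)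
  ultimately show ?thesis
    unfolding Bessel_J_def by (simp only: sums_iff)
qed

lemma Re_laplace_bessel_density:
  assumes "lam > - 1 / 2" "y > 0" "\<tau> > 0"
  shows "(LINT r|lborel. bessel_density lam y r * exp (- (\<tau> * r)) * cos (\<xi> * r)) = Re (bessel_laplace lam y (Complex \<tau> \<xi>))"
proof -
  let ?f = "\<lambda>r. complex_of_real (bessel_density lam y r) * exp (- (Complex \<tau> \<xi> * of_real r))"
  have "Re (bessel_laplace lam y (Complex \<tau> \<xi>)) = Re (integral\<^sup>L lborel ?f)"
    using laplace_bessel_density[of lam y "Complex \<tau> \<xi>"] assms by simp
  also have "\<dots> = (LINT r|lborel. Re (?f r))"
    using laplace_bessel_density[of lam y "Complex \<tau> \<xi>"] assms by (intro integral_Re[symmetric]) simp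
  also have "\<dots> = (LINT r|lborel. bessel_density lam y r * exp (- (\<tau> * r)) * cos (\<xi> * r))"
    by (simp add: Re_exp mult.assoc)
  finally show ?thesis by simp
qed

text \<open>
  Poisson's integral writes the factor of order \<open>\<lambda> + 1/2\<close> as an average of \<open>cos (x \<surd>u r)\<close>.
  By Fubini's theorem the integral over \<open>r\<close> comes first, and it is the real part of the Laplace transform of the
  other factor at \<open>\<tau> + i x \<surd>u\<close>.
\<close>

lemma damped_riesz_integral:
  assumes lam: "lam > - 1 / 2" and x: "x > 0" and y: "y > 0" and \<tau>: "\<tau> > 0"
  shows "- ((x * y) powr (- lam + 1 / 2)) *
      (LINT r|half_line. exp (- \<tau> * r) * Bessel_J (lam + 1 / 2) (x * r) * Bessel_J (lam - 1 / 2) (y * r) * r) =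
    - (x * 2 powr (- 2 * lam) / (sqrt pi * Gamma (lam + 1))) *
      (LINT u|lborel. poisson_weight lam u * Re (bessel_laplace lam y (Complex \<tau> (x * sqrt u))))"
proof -
  have [measurable]: "Bessel_J \<mu> \<in> borel_measurable borel" for \<mu>
    unfolding Bessel_J_def[abs_def] by measurable
  let ?J = "\<lambda>r. exp (- \<tau> * r) * Bessel_J (lam + 1 / 2) (x * r) * Bessel_J (lam - 1 / 2) (y * r) * r"
  let ?c = "sqrt pi * Gamma (lam + 1)"
  define h where "h r = bessel_density lam y r * exp (- (\<tau> * r))" for r
  have [measurable]: "h \<in> borel_measurable borel" unfolding h_def[abs_def] by measurable
  have h: "integrable lborel h" unfolding h_def[abs_def] by (rule integrable_bessel_density[OF lam \<tau>])
  have point: "(x * y) powr (- lam + 1 / 2) * (indicator {0<..} r * ?J r) =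
     x * 2 powr (- 2 * lam) / ?c * (LINT u|lborel. poisson_weight lam u * h r * cos (x * sqrt u * r))" for r
  proof (cases "r > 0")
    case True
    have "(x * y) powr (- lam + 1 / 2) * ((x * r / 2) powr (lam + 1 / 2) * (y * r / 2) powr (lam - 1 / 2) * r)
        = x * 2 powr (- 2 * lam) * r powr (2 * lam + 1)"
    proof -
      have e1: "lam + 1 / 2 = 1 + (lam - 1 / 2)" by simp
      have e2: "2 * lam + 1 = (lam + 1 / 2) + (lam - 1 / 2) + 1" by simp
      have e3: "- 2 * lam = - (lam + 1 / 2) - (lam - 1 / 2)" by simp
      have e4: "x powr (- lam + 1 / 2) * x powr (lam + 1 / 2) = x" using x by (simp add: powr_add[symmetric])
      have e5: "y powr (- lam + 1 / 2) * y powr (lam - 1 / 2) = 1" using y by (simp add: powr_add[symmetric])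
      have "(x * y) powr (- lam + 1 / 2) * ((x * r / 2) powr (lam + 1 / 2) * (y * r / 2) powr (lam - 1 / 2) * r)
        = (x powr (- lam + 1 / 2) * x powr (lam + 1 / 2)) * (y powr (- lam + 1 / 2) * y powr (lam - 1 / 2)) *
          (r powr (lam + 1 / 2) * r powr (lam - 1 / 2) * r) / (2 powr (lam + 1 / 2) * 2 powr (lam - 1 / 2))"
        using x y True by (simp add: powr_mult powr_divide)
      also have "r powr (lam + 1 / 2) * r powr (lam - 1 / 2) * r = r powr (2 * lam + 1)"
        unfolding e2 powr_add using True by simp
      also have "2 powr (lam + 1 / 2) * 2 powr (lam - 1 / 2) = 1 / (2::real) powr (- 2 * lam)"
        unfolding powr_add[symmetric] by (simp add: powr_minus_divide)
      finally show ?thesis unfolding e4 e5 by simp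
    qed
    then have "(x * y) powr (- lam + 1 / 2) * ?J r = x * 2 powr (- 2 * lam) * r powr (2 * lam + 1) *
       (exp (- \<tau> * r) * bessel_entire (lam + 1 / 2) (x * r) * bessel_entire (lam - 1 / 2) (y * r))"
      using Bessel_J_entire[of "lam + 1 / 2" "x * r"] Bessel_J_entire[of "lam - 1 / 2" "y * r"] lam x y True
      by (simp add: mult_ac)
    also have "\<dots> = x * 2 powr (- 2 * lam) * bessel_entire (lam + 1 / 2) (x * r) * h r"
      using True by (simp add: h_def bessel_density_def mult_ac)
    also have "bessel_entire (lam + 1 / 2) (x * r) = (LINT u|lborel. poisson_weight lam u * cos (x * r * sqrt u)) / ?c"
      using lam by (intro bessel_entire_poisson) simp
    also have "x * 2 powr (- 2 * lam) * ((LINT u|lborel. poisson_weight lam u * cos (x * r * sqrt u)) / ?c) * h r =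
       x * 2 powr (- 2 * lam) / ?c * ((LINT u|lborel. poisson_weight lam u * cos (x * r * sqrt u)) * h r)"
      by simp
    also have "(LINT u|lborel. poisson_weight lam u * cos (x * r * sqrt u)) * h r =
       (LINT u|lborel. poisson_weight lam u * h r * cos (x * sqrt u * r))"
      unfolding integral_mult_left_zero[symmetric] by (simp add: mult_ac)
    finally show ?thesis using True by simp
  qed (simp add: h_def bessel_density_def)
  have "(x * y) powr (- lam + 1 / 2) * integral\<^sup>L half_line ?J =
      (LINT r|lborel. (x * y) powr (- lam + 1 / 2) * (indicator {0<..} r * ?J r))"
    by (subst integral_half_line) auto
  also have "\<dots> = x * 2 powr (- 2 * lam) / ?c * (LINT r|lborel. (LINT u|lborel. poisson_weight lam u * h r * cos (x * sqrt u * r)))"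
    unfolding point by (rule integral_mult_right_zero)
  also have "(LINT r|lborel. (LINT u|lborel. poisson_weight lam u * h r * cos (x * sqrt u * r))) =
     (LINT u|lborel. (LINT r|lborel. poisson_weight lam u * h r * cos (x * sqrt u * r)))"
  proof (rule lborel_pair.Fubini_integral)
    show "integrable (lborel \<Otimes>\<^sub>M lborel) (\<lambda>(u, r). poisson_weight lam u * h r * cos (x * sqrt u * r))"
    proof (rule Bochner_Integration.integrable_bound)
      show "integrable (lborel \<Otimes>\<^sub>M lborel) (\<lambda>(u, r). poisson_weight lam u * h r)"
      proof (rule lborel_pair.Fubini_integrable)
        have "integrable lborel (\<lambda>u. poisson_weight lam u * (LINT r|lborel. \<bar>h r\<bar>))"
          using integrable_poisson_weight[of lam] lam by simp
        then show "integrable lborel (\<lambda>u. LINT r|lborel. norm (case (u, r) of (u, r) \<Rightarrow> poisson_weight lam u * h r))"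
          by (simp add: abs_mult)
      qed (use h in auto)
    qed (auto simp: abs_mult split: prod.split intro!: AE_I2 mult_left_le)
  qed
  also have "\<dots> = (LINT u|lborel. poisson_weight lam u * Re (bessel_laplace lam y (Complex \<tau> (x * sqrt u))))"
    using Re_laplace_bessel_density[OF lam y \<tau>, symmetric] by (simp add: h_def mult.assoc)
  finally show ?thesis by simp
qed

lemma powr_two_sided:
  fixes B t s :: real
  assumes "B \<ge> 1" "1 / B \<le> t" "t \<le> B"
  shows "B powr (- \<bar>s\<bar>) \<le> t powr s" and "t powr s \<le> B powr \<bar>s\<bar>"
proof -
  have t: "t > 0" using assms by (smt (verit) divide_pos_pos)
  have "\<bar>ln t\<bar> \<le> ln B"
  proof -
    have "ln t \<le> ln B" using t assms by simp
    moreover have "ln (1 / B) \<le> ln t" using t assms by (subst ln_le_cancel_iff) auto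
    then have "- ln B \<le> ln t" using assms by (simp add: ln_div)
    ultimately show ?thesis by simp
  qed
  then have "\<bar>s * ln t\<bar> \<le> \<bar>s\<bar> * ln B" by (simp add: abs_mult mult_left_mono)
  then show "B powr (- \<bar>s\<bar>) \<le> t powr s" "t powr s \<le> B powr \<bar>s\<bar>"
    using t assms by (auto simp: powr_def)
qed

text \<open>
  An expression for the Riesz kernel that is valid for \<open>0 < x < y\<close>, where the integrand is visibly
  positive. For \<open>\<lambda> = 0\<close> it is \<open>(1/\<pi>) (1/(y - x) - 1/(y + x))\<close>.
\<close>

definition kernel_below :: "real \<Rightarrow> real \<Rightarrow> real \<Rightarrow> real" where
  "kernel_below lam x y = x / pi *
    (LINT u|lborel. poisson_weight lam u * (((2 * lam + 1) * (x\<^sup>2 * u) + y\<^sup>2) * (y\<^sup>2 - x\<^sup>2 * u) powr (- lam - 2)))"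

text \<open>
  At the boundary point \<open>i\<xi>\<close> one has \<open>s\<^sup>2 + y\<^sup>2 = y\<^sup>2 - \<xi>\<^sup>2 > 0\<close>, so the complex power is a
  real one and the value has a constant sign.
\<close>

lemma bessel_laplace_boundary:
  assumes "\<bar>\<xi>\<bar> < y"
  shows "Re (bessel_laplace lam y (Complex 0 \<xi>)) =
    - (2 powr (2 * lam) * Gamma (lam + 1) / sqrt pi) * (((2 * lam + 1) * \<xi>\<^sup>2 + y\<^sup>2) * (y\<^sup>2 - \<xi>\<^sup>2) powr (- lam - 2))"
proof -
  have "\<bar>\<xi>\<bar>\<^sup>2 < y\<^sup>2" using assms by (intro power_strict_mono) auto
  then have pos: "y\<^sup>2 - \<xi>\<^sup>2 \<ge> 0" by simp
  have sq: "(Complex 0 \<xi>)\<^sup>2 = of_real (- (\<xi>\<^sup>2))"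
    by (simp add: complex_eq_iff power2_eq_square)
  have "bessel_laplace lam y (Complex 0 \<xi>) =
      of_real (2 powr (2 * lam) * Gamma (lam + 1) / sqrt pi) *
      of_real ((2 * lam + 1) * - (\<xi>\<^sup>2) - y\<^sup>2) * (of_real (y\<^sup>2 - \<xi>\<^sup>2)) powr of_real (- lam - 2)"
    unfolding bessel_laplace_def sq by simp
  also have "\<dots> = of_real (2 powr (2 * lam) * Gamma (lam + 1) / sqrt pi * ((2 * lam + 1) * - (\<xi>\<^sup>2) - y\<^sup>2) * (y\<^sup>2 - \<xi>\<^sup>2) powr (- lam - 2))"
    unfolding powr_of_real[OF pos] by simp
  finally have "Re (bessel_laplace lam y (Complex 0 \<xi>)) =
     2 powr (2 * lam) * Gamma (lam + 1) / sqrt pi * ((2 * lam + 1) * - (\<xi>\<^sup>2) - y\<^sup>2) * (y\<^sup>2 - \<xi>\<^sup>2) powr (- lam - 2)"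
    by (simp only: Re_complex_of_real)
  also have "(2 * lam + 1) * - (\<xi>\<^sup>2) - y\<^sup>2 = - ((2 * lam + 1) * \<xi>\<^sup>2 + y\<^sup>2)" by simp
  finally show ?thesis by (simp only: mult_minus_left mult_minus_right mult.assoc)
qed

text \<open>
  For \<open>x < y\<close> the quantity \<open>s\<^sup>2 + y\<^sup>2\<close> at \<open>s = \<tau> + i x \<surd>u\<close> avoids the branch cut also for \<open>\<tau> = 0\<close>.
  Compactness then gives the bound that dominates the passage to the limit.
\<close>

lemma continuous_bessel_laplace_strip:
  assumes "0 < x" "x < y"
  shows "continuous_on ({0..} \<times> {0..1}) (\<lambda>(\<tau>, u). Re (bessel_laplace lam y (Complex \<tau> (x * sqrt u))))"
proof -
  have "(Complex \<tau> (x * sqrt u))\<^sup>2 + of_real (y\<^sup>2) \<notin> \<real>\<^sub>\<le>\<^sub>0" if "\<tau> \<ge> 0" "0 \<le> u" "u \<le> 1" for \<tau> u :: real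
  proof (cases "\<tau> > 0")
    case True
    then show ?thesis using square_plus_not_nonpos[of "Complex \<tau> (x * sqrt u)" y] assms by simp
  next
    case False
    with that have "\<tau> = 0" by simp
    then have "Re ((Complex \<tau> (x * sqrt u))\<^sup>2 + of_real (y\<^sup>2)) = y\<^sup>2 - x\<^sup>2 * u"
      using that by (simp add: power2_eq_square)
    moreover have "x\<^sup>2 * u \<le> x\<^sup>2" using that by (simp add: mult_left_le)
    moreover have "x\<^sup>2 < y\<^sup>2" using assms by (intro power_strict_mono) auto
    ultimately show ?thesis by (auto simp: complex_nonpos_Reals_iff)
  qed
  then have *: "(Complex (fst p) (x * sqrt (snd p)))\<^sup>2 + of_real (y\<^sup>2) \<notin> \<real>\<^sub>\<le>\<^sub>0"
    if "p \<in> {0..} \<times> {0..1}" for p using that by auto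
  have 1: "(Complex (fst p) (x * sqrt (snd p)))\<^sup>2 + of_real (y\<^sup>2) \<noteq> 0"
    and 2: "Re ((Complex (fst p) (x * sqrt (snd p)))\<^sup>2 + of_real (y\<^sup>2)) \<ge> 0 \<or>
      Im ((Complex (fst p) (x * sqrt (snd p)))\<^sup>2 + of_real (y\<^sup>2)) \<noteq> 0"
    if "p \<in> {0..} \<times> {0..1}" for p
    using *[OF that] unfolding complex_nonpos_Reals_iff by (fastforce simp del: of_real_power, linarith)
  have c: "continuous_on ({0..} \<times> {0..1}) (\<lambda>p. Complex (fst p) (x * sqrt (snd p)))"
    unfolding Complex_eq by (intro continuous_intros)
  have "continuous_on ({0..} \<times> {0..1}) (\<lambda>p. Re (bessel_laplace lam y (Complex (fst p) (x * sqrt (snd p)))))"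
    unfolding bessel_laplace_def
    by (intro continuous_on_Re continuous_on_mult continuous_on_const continuous_on_diff continuous_on_power
        continuous_on_add c continuous_on_powr_complex subsetI CollectI 2) (use 1 in blast)+
  then show ?thesis by (simp add: case_prod_unfold)
qed

text \<open>
  Let \<open>\<tau>\<close> tend to 0 under the integral over \<open>u\<close>. The Gamma factors of Poisson's integral and of the
  Laplace transform cancel, and only \<open>x / \<pi>\<close> remains.
\<close>

lemma riesz_kernel_eq_kernel_below:
  assumes lam: "lam > - 1 / 2" and xy: "0 < x" "x < y"
  shows "riesz_kernel lam x y = kernel_below lam x y"
proof -
  have y: "y > 0" using xy by simp
  let ?F = "\<lambda>\<tau> u. Re (bessel_laplace lam y (Complex \<tau> (x * sqrt u)))"
  let ?c = "x * 2 powr (- 2 * lam) / (sqrt pi * Gamma (lam + 1))"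
  have meas: "(\<lambda>u. poisson_weight lam u * ?F \<tau> u) \<in> borel_measurable borel" if "\<tau> \<ge> 0" for \<tau>
  proof -
    have "continuous_on {0..1} (\<lambda>u. (\<lambda>(\<tau>, u). ?F \<tau> u) (\<tau>, u))"
      by (rule continuous_on_compose2[OF continuous_bessel_laplace_strip[OF xy, of lam]])
         (use that in \<open>auto intro!: continuous_intros\<close>)
    then have "(\<lambda>u. indicator {0..1} u *\<^sub>R ?F \<tau> u) \<in> borel_measurable borel"
      by (intro borel_measurable_continuous_on_indicator) auto
    then have "(\<lambda>u. poisson_weight lam u * (indicator {0..1} u *\<^sub>R ?F \<tau> u)) \<in> borel_measurable borel"
      by measurable
    moreover have "poisson_weight lam u * (indicator {0..1} u *\<^sub>R ?F \<tau> u) = poisson_weight lam u * ?F \<tau> u" for u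
      by (auto simp: poisson_weight_def)
    ultimately show ?thesis by (simp only:)
  qed
  have lim: "((\<lambda>\<tau>. LINT u|lborel. poisson_weight lam u * ?F \<tau> u) \<longlongrightarrow> (LINT u|lborel. poisson_weight lam u * ?F 0 u)) (at_right 0)"
    unfolding tendsto_at_iff_sequentially
  proof (intro allI impI)
    fix X :: "nat \<Rightarrow> real"
    assume X: "\<forall>i. X i \<in> {0<..} - {0}" and lim: "X \<longlonglongrightarrow> 0"
    from lim have "Bseq X" by (intro convergent_imp_Bseq convergentI)
    then obtain M where M: "\<And>i. \<bar>X i\<bar> \<le> M" by (auto simp: Bseq_def)
    have Xpos: "X i \<ge> 0" for i using X by (auto intro: less_imp_le)
    have "compact ((\<lambda>(\<tau>, u). ?F \<tau> u) ` ({0..M} \<times> {0..1}))"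
      by (intro compact_continuous_image continuous_on_subset[OF continuous_bessel_laplace_strip[OF xy]] compact_Times compact_Icc) auto
    then obtain B where B: "\<And>\<tau> u. 0 \<le> \<tau> \<Longrightarrow> \<tau> \<le> M \<Longrightarrow> 0 \<le> u \<Longrightarrow> u \<le> 1 \<Longrightarrow> \<bar>?F \<tau> u\<bar> \<le> B"
      by (fastforce dest!: compact_imp_bounded simp: bounded_iff)
    have "(\<lambda>i. LINT u|lborel. poisson_weight lam u * ?F (X i) u) \<longlonglongrightarrow> (LINT u|lborel. poisson_weight lam u * ?F 0 u)"
    proof (rule integral_dominated_convergence)
      show "integrable lborel (\<lambda>u. poisson_weight lam u * B)"
        using integrable_poisson_weight[of lam] lam by simp
      show "AE u in lborel. norm (poisson_weight lam u * ?F (X i) u) \<le> poisson_weight lam u * B" for i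
      proof (intro AE_I2)
        fix u
        show "norm (poisson_weight lam u * ?F (X i) u) \<le> poisson_weight lam u * B"
          using B[of "X i" u] M[of i] Xpos[of i]
          by (cases "0 < u \<and> u < 1") (auto simp: abs_mult poisson_weight_def intro!: mult_left_mono)
      qed
      show "AE u in lborel. (\<lambda>i. poisson_weight lam u * ?F (X i) u) \<longlonglongrightarrow> poisson_weight lam u * ?F 0 u"
      proof (intro AE_I2)
        fix u
        show "(\<lambda>i. poisson_weight lam u * ?F (X i) u) \<longlonglongrightarrow> poisson_weight lam u * ?F 0 u"
        proof (cases "0 < u \<and> u < 1")
          case True
          have "(\<lambda>i. (\<lambda>(\<tau>, u). ?F \<tau> u) (X i, u)) \<longlonglongrightarrow> (\<lambda>(\<tau>, u). ?F \<tau> u) (0, u)"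
            by (rule continuous_on_tendsto_compose[OF continuous_bessel_laplace_strip[OF xy, of lam]])
               (use True Xpos lim in \<open>auto intro!: tendsto_intros\<close>)
          then show ?thesis by (intro tendsto_mult tendsto_const) simp
        qed (auto simp: poisson_weight_def)
      qed
    qed (use meas Xpos in auto)
    then show "((\<lambda>\<tau>. LINT u|lborel. poisson_weight lam u * ?F \<tau> u) \<circ> X) \<longlonglongrightarrow> (LINT u|lborel. poisson_weight lam u * ?F 0 u)"
      by (simp only: o_def)
  qed
  have "riesz_kernel lam x y = - ?c * (LINT u|lborel. poisson_weight lam u * ?F 0 u)"
    unfolding riesz_kernel_def
  proof (rule tendsto_Lim)
    show "((\<lambda>\<tau>. - ((x * y) powr (- lam + 1 / 2)) *
      (LINT r|half_line. exp (- \<tau> * r) * Bessel_J (lam + 1 / 2) (x * r) * Bessel_J (lam - 1 / 2) (y * r) * r))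
      \<longlongrightarrow> - ?c * (LINT u|lborel. poisson_weight lam u * ?F 0 u)) (at_right 0)"
    proof (rule Lim_transform_eventually[OF tendsto_mult[OF tendsto_const lim]])
      show "\<forall>\<^sub>F \<tau> in at_right 0. - ?c * (LINT u|lborel. poisson_weight lam u * ?F \<tau> u) =
        - ((x * y) powr (- lam + 1 / 2)) *
        (LINT r|half_line. exp (- \<tau> * r) * Bessel_J (lam + 1 / 2) (x * r) * Bessel_J (lam - 1 / 2) (y * r) * r)"
        using eventually_at_right_less[of 0]
        by eventually_elim (rule damped_riesz_integral[OF lam xy(1) y, symmetric])
    qed
  qed simp
  also have "(\<lambda>u. poisson_weight lam u * ?F 0 u) = (\<lambda>u. - (2 powr (2 * lam) * Gamma (lam + 1) / sqrt pi) *
      (poisson_weight lam u * (((2 * lam + 1) * (x\<^sup>2 * u) + y\<^sup>2) * (y\<^sup>2 - x\<^sup>2 * u) powr (- lam - 2))))"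
  proof
    fix u
    show "poisson_weight lam u * ?F 0 u = - (2 powr (2 * lam) * Gamma (lam + 1) / sqrt pi) *
      (poisson_weight lam u * (((2 * lam + 1) * (x\<^sup>2 * u) + y\<^sup>2) * (y\<^sup>2 - x\<^sup>2 * u) powr (- lam - 2)))"
    proof (cases "0 < u \<and> u < 1")
      case True
      then have "x * sqrt u < y * 1" using xy by (intro mult_strict_mono) auto
      then have "\<bar>x * sqrt u\<bar> < y" using xy True by simp
      from bessel_laplace_boundary[OF this, of lam] True show ?thesis
        by (simp add: power_mult_distrib)
    qed (auto simp: poisson_weight_def)
  qed
  also have "(LINT u|lborel. - (2 powr (2 * lam) * Gamma (lam + 1) / sqrt pi) *
      (poisson_weight lam u * (((2 * lam + 1) * (x\<^sup>2 * u) + y\<^sup>2) * (y\<^sup>2 - x\<^sup>2 * u) powr (- lam - 2)))) =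
      - (2 powr (2 * lam) * Gamma (lam + 1) / sqrt pi) * (kernel_below lam x y * pi / x)"
    unfolding integral_mult_right_zero kernel_below_def using xy by simp
  also have "- ?c * (- (2 powr (2 * lam) * Gamma (lam + 1) / sqrt pi) * (kernel_below lam x y * pi / x)) =
      (2 powr (- 2 * lam) * 2 powr (2 * lam)) * (Gamma (lam + 1) / Gamma (lam + 1)) * (pi / (sqrt pi * sqrt pi)) * (x / x) * kernel_below lam x y"
    by (simp add: mult_ac)
  also have "\<dots> = kernel_below lam x y"
  proof -
    have "Gamma (lam + 1) > 0" by (rule Gamma_real_pos) (use lam in simp)
    then show ?thesis using xy by (simp add: powr_add[symmetric])
  qed
  finally show ?thesis .
qed

lemma borel_measurable_kernel_below [measurable]: "kernel_below lam x \<in> borel_measurable borel"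
  unfolding kernel_below_def[abs_def]
proof (rule borel_measurable_times[OF borel_measurable_const])
  show "(\<lambda>y. LINT u|lborel. poisson_weight lam u * (((2 * lam + 1) * (x\<^sup>2 * u) + y\<^sup>2) * (y\<^sup>2 - x\<^sup>2 * u) powr (- lam - 2)))
      \<in> borel_measurable borel"
    by (rule lborel.borel_measurable_lebesgue_integral) measurable
qed

lemma integrable_kernel_below:
  assumes lam: "lam > - 1 / 2" and xy: "0 < x" "x < y"
  shows "integrable lborel (\<lambda>u. poisson_weight lam u * (((2 * lam + 1) * (x\<^sup>2 * u) + y\<^sup>2) * (y\<^sup>2 - x\<^sup>2 * u) powr (- lam - 2)))"
    and "0 \<le> kernel_below lam x y"
    and "kernel_below lam x y \<le> x / pi * (integral\<^sup>L lborel (poisson_weight lam) *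
      (((2 * lam + 1) * x\<^sup>2 + y\<^sup>2) * (y\<^sup>2 - x\<^sup>2) powr (- lam - 2)))"
proof -
  let ?f = "\<lambda>u. poisson_weight lam u * (((2 * lam + 1) * (x\<^sup>2 * u) + y\<^sup>2) * (y\<^sup>2 - x\<^sup>2 * u) powr (- lam - 2))"
  let ?C = "((2 * lam + 1) * x\<^sup>2 + y\<^sup>2) * (y\<^sup>2 - x\<^sup>2) powr (- lam - 2)"
  have sq: "x\<^sup>2 < y\<^sup>2" using xy by (intro power_strict_mono) auto
  have nonneg: "0 \<le> ?f u" for u
    using lam by (cases "0 < u \<and> u < 1") (auto simp: poisson_weight_def)
  have bound: "?f u \<le> poisson_weight lam u * ?C" for u
  proof (cases "0 < u \<and> u < 1")
    case True
    then have u: "x\<^sup>2 * u \<le> x\<^sup>2" by (simp add: mult_left_le)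
    show ?thesis
    proof (intro mult_left_mono mult_mono add_mono)
      show "(y\<^sup>2 - x\<^sup>2 * u) powr (- lam - 2) \<le> (y\<^sup>2 - x\<^sup>2) powr (- lam - 2)"
        using u sq lam by (intro powr_mono2') auto
    qed (use u lam in auto)
  qed (auto simp: poisson_weight_def)
  have i: "integrable lborel (\<lambda>u. poisson_weight lam u * ?C)"
    using integrable_poisson_weight[of lam] lam by simp
  show 1: "integrable lborel ?f"
    by (rule Bochner_Integration.integrable_bound[OF i])
       (use nonneg bound in \<open>auto intro!: AE_I2 intro: order_trans[OF _ abs_ge_self]\<close>)
  show "0 \<le> kernel_below lam x y"
    unfolding kernel_below_def using xy nonneg by (intro mult_nonneg_nonneg integral_nonneg) auto
  have "integral\<^sup>L lborel ?f \<le> (LINT u|lborel. poisson_weight lam u * ?C)"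
    by (intro integral_mono 1 i bound)
  then show "kernel_below lam x y \<le> x / pi * (integral\<^sup>L lborel (poisson_weight lam) * ?C)"
    unfolding kernel_below_def using xy by (intro mult_left_mono) auto
qed

text \<open>
  Put \<open>h = y - x\<close>. Where \<open>1 - u\<close> is comparable to \<open>h\<close>, so is \<open>y\<^sup>2 - x\<^sup>2 u\<close>, and the integrand is of
  size \<open>h\<^sup>\<lambda> h\<^bsup>-\<lambda>-2\<^esup>\<close> on an interval of length about \<open>h\<close>. As the integrand is positive everywhere, this
  piece alone shows the singularity \<open>1/h\<close> of the Hilbert transform.
\<close>

lemma kernel_below_lower_bound:
  assumes lam: "lam > - 1 / 2"
  obtains c where "c > 0"
    "\<And>x y. 1 / 2 < x \<Longrightarrow> x < 1 \<Longrightarrow> 1 < y \<Longrightarrow> y < 2 \<Longrightarrow> c / (y - x) \<le> kernel_below lam x y"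
proof
  define c where "c = 1 / (2 * pi) * (1 / 4 * (4 powr (- \<bar>lam\<bar>) * 5 powr (- lam - 2)))"
  show "c > 0" by (simp add: c_def)
  fix x y :: real assume xy: "1 / 2 < x" "x < 1" "1 < y" "y < 2"
  define h where "h = y - x"
  have h: "0 < h" "h < 3 / 2" using xy by (auto simp: h_def)
  let ?f = "\<lambda>u. poisson_weight lam u * (((2 * lam + 1) * (x\<^sup>2 * u) + y\<^sup>2) * (y\<^sup>2 - x\<^sup>2 * u) powr (- lam - 2))"
  \<comment> \<open>On this interval 1 - u lies between h/4 and h/2.\<close>
  let ?I = "{1 - h / 2..1 - h / 4}"
  let ?C = "h powr lam * 4 powr (- \<bar>lam\<bar>) * (5 * h) powr (- lam - 2)"
  have le: "indicator ?I u * ?C \<le> ?f u" for u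
  proof (cases "u \<in> ?I")
    case True
    then have u: "0 < u" "u < 1" using h by auto
    define t where "t = (1 - u) / h"
    have t: "1 / 4 \<le> t" "t \<le> 4" "1 - u = h * t" using True h by (auto simp: t_def field_simps)
    have w: "h powr lam * 4 powr (- \<bar>lam\<bar>) \<le> poisson_weight lam u"
    proof -
      have "h powr lam * 4 powr (- \<bar>lam\<bar>) \<le> h powr lam * t powr lam"
        by (intro mult_left_mono powr_two_sided t) auto
      also have "\<dots> = 1 * (1 - u) powr lam" unfolding t(3) using t h by (simp add: powr_mult)
      also have "\<dots> \<le> u powr (- 1 / 2) * (1 - u) powr lam"
        using u by (intro mult_right_mono) (auto simp: powr_minus_divide powr_le1)
      finally show ?thesis using u by (simp add: poisson_weight_def)
    qed
    have "x\<^sup>2 * u \<le> x\<^sup>2" using u by (simp add: mult_left_le)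
    moreover have sq: "x\<^sup>2 < y\<^sup>2" using xy by (intro power_strict_mono) auto
    ultimately have pos: "0 < y\<^sup>2 - x\<^sup>2 * u" by simp
    have "y\<^sup>2 - x\<^sup>2 * u = (y + x) * h + x\<^sup>2 * (1 - u)" by (simp add: h_def algebra_simps power2_eq_square)
    also have "\<dots> \<le> 4 * h + 1 * h"
      using xy u h True by (intro add_mono mult_mono) (auto simp: power_le_one)
    finally have d: "(5 * h) powr (- lam - 2) \<le> (y\<^sup>2 - x\<^sup>2 * u) powr (- lam - 2)"
      using pos lam by (intro powr_mono2') auto
    have "1 \<le> y\<^sup>2" using xy by simp
    moreover have "0 \<le> (2 * lam + 1) * (x\<^sup>2 * u)" using lam u by simp
    ultimately have n: "1 \<le> (2 * lam + 1) * (x\<^sup>2 * u) + y\<^sup>2" by simp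
    have "?C \<le> poisson_weight lam u * (y\<^sup>2 - x\<^sup>2 * u) powr (- lam - 2)"
      by (intro mult_mono w d) auto
    also have "\<dots> = poisson_weight lam u * (1 * (y\<^sup>2 - x\<^sup>2 * u) powr (- lam - 2))" by simp
    also have "\<dots> \<le> ?f u" by (intro mult_left_mono mult_right_mono n) auto
    finally show ?thesis using True by simp
  next
    case False
    then show ?thesis using lam by (auto simp: poisson_weight_def)
  qed
  have "h / 4 * ?C = (LINT u|lborel. indicator ?I u * ?C)" using h by simp
  also have "\<dots> \<le> integral\<^sup>L lborel ?f"
    using lam xy le h by (intro integral_mono integrable_kernel_below) auto
  finally have "1 / (2 * pi) * (h / 4 * ?C) \<le> x / pi * integral\<^sup>L lborel ?f"
    using xy h by (intro mult_mono) (auto simp: field_simps)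
  moreover have "1 / (2 * pi) * (h / 4 * ?C) = c / h"
  proof -
    have "h powr lam * (5 * h) powr (- lam - 2) = 5 powr (- lam - 2) * (h powr lam * h powr (- lam - 2))"
      using h by (simp add: powr_mult)
    also have "h powr lam * h powr (- lam - 2) = h powr (- 2)" by (simp add: powr_add[symmetric])
    also have "h powr (- 2) = 1 / (h * h)" using h by (simp add: powr_minus_divide power2_eq_square)
    finally have "h * ?C = 4 powr (- \<bar>lam\<bar>) * 5 powr (- lam - 2) / h" using h by (simp add: field_simps)
    then show ?thesis unfolding c_def by simp
  qed
  ultimately show "c / (y - x) \<le> kernel_below lam x y"
    by (simp add: kernel_below_def h_def)
qed

section \<open>Averages of powers of the distance to 1\<close>

lemma borel_measurable_half_line:
  assumes "f \<in> borel_measurable borel"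
  shows "f \<in> borel_measurable half_line"
  using assms by (intro measurable_restrict_space1 measurable_completion) simp

lemma nn_integral_half_line:
  fixes f :: "real \<Rightarrow> ennreal"
  assumes [measurable]: "f \<in> borel_measurable borel"
  shows "integral\<^sup>N half_line f = (\<integral>\<^sup>+x\<in>{0<..}. f x \<partial>lborel)"
proof -
  have "integral\<^sup>N half_line f = (\<integral>\<^sup>+x\<in>{0<..}. f x \<partial>lebesgue)"
    by (rule nn_integral_restrict_space) simp
  also have "\<dots> = (\<integral>\<^sup>+x\<in>{0<..}. f x \<partial>lborel)"
    by (rule nn_integral_completion)
  finally show ?thesis .
qed

lemma nn_integral_half_line_interval:
  fixes f :: "real \<Rightarrow> ennreal"
  assumes [measurable]: "f \<in> borel_measurable borel" and "0 \<le> a"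
  shows "(\<integral>\<^sup>+x\<in>{a<..<b}. f x \<partial>half_line) = (\<integral>\<^sup>+x\<in>{a<..<b}. f x \<partial>lborel)"
proof -
  have "(\<integral>\<^sup>+x\<in>{a<..<b}. f x \<partial>half_line) = (\<integral>\<^sup>+x. f x * indicator {a<..<b} x * indicator {0<..} x \<partial>lborel)"
    by (subst nn_integral_half_line) auto
  also have "\<dots> = (\<integral>\<^sup>+x\<in>{a<..<b}. f x \<partial>lborel)"
    using assms by (intro nn_integral_cong) (auto simp: indicator_def)
  finally show ?thesis .
qed

lemma has_integral_powr_interval:
  fixes c e \<kappa> :: real
  assumes "\<kappa> > - 1" "0 \<le> c" "c \<le> e"
  shows "((\<lambda>x. x powr \<kappa>) has_integral (e powr (\<kappa> + 1) - c powr (\<kappa> + 1)) / (\<kappa> + 1)) {c..e}"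
proof (cases "c = 0")
  case True
  then show ?thesis using has_integral_powr_from_0[of \<kappa> e] assms by simp
next
  case False
  have "((\<lambda>x. x powr \<kappa>) has_integral (e powr (\<kappa> + 1) / (\<kappa> + 1) - c powr (\<kappa> + 1) / (\<kappa> + 1))) {c..e}"
  proof (rule fundamental_theorem_of_calculus)
    fix x assume "x \<in> {c..e}"
    then have "x > 0" using False assms by auto
    then have "((\<lambda>x. x powr (\<kappa> + 1) / (\<kappa> + 1)) has_real_derivative x powr \<kappa>) (at x)"
      using assms by (auto intro!: derivative_eq_intros)
    then show "((\<lambda>x. x powr (\<kappa> + 1) / (\<kappa> + 1)) has_vector_derivative x powr \<kappa>) (at x within {c..e})"
      by (simp add: has_real_derivative_iff_has_vector_derivative has_vector_derivative_at_within)
  qed (use assms in auto)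
  then show ?thesis by (simp add: diff_divide_distrib)
qed

text \<open>
  The point is the factor \<open>e - c\<close>: the bound is one for the average of \<open>x\<^sup>\<kappa>\<close> over \<open>(c, e)\<close>, and
  \<open>c\<close> does not enter the constant. It rests on \<open>e\<^sup>\<kappa> c \<le> c\<^bsup>\<kappa>+1\<^esup>\<close>.
\<close>

lemma nn_integral_powr_le:
  fixes c e \<kappa> :: real
  assumes \<kappa>: "- 1 < \<kappa>" "\<kappa> \<le> 0" and ce: "0 \<le> c" "c < e"
  shows "(\<integral>\<^sup>+x\<in>{c<..<e}. ennreal (x powr \<kappa>) \<partial>lborel) \<le> ennreal (1 / (1 + \<kappa>) * e powr \<kappa> * (e - c))"
proof -
  have "(\<integral>\<^sup>+x\<in>{c<..<e}. ennreal (x powr \<kappa>) \<partial>lborel) \<le> (\<integral>\<^sup>+x\<in>{c..e}. ennreal (x powr \<kappa>) \<partial>lborel)"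
    by (intro nn_integral_mono) (auto simp: indicator_def)
  also have "\<dots> = ennreal ((e powr (\<kappa> + 1) - c powr (\<kappa> + 1)) / (\<kappa> + 1))"
    using assms by (intro nn_integral_has_integral_lebesgue' has_integral_powr_interval) auto
  also have "\<dots> \<le> ennreal (1 / (1 + \<kappa>) * e powr \<kappa> * (e - c))"
  proof (intro ennreal_leI)
    have "e powr (\<kappa> + 1) = e powr \<kappa> * e" using ce by (simp add: powr_add)
    moreover have "e powr \<kappa> * c \<le> c powr (\<kappa> + 1)"
    proof (cases "c = 0")
      case False
      then have "e powr \<kappa> \<le> c powr \<kappa>" using ce \<kappa> by (intro powr_mono2') auto
      then show ?thesis using ce False by (simp add: powr_add mult_right_mono)
    qed simp
    ultimately have "e powr (\<kappa> + 1) - c powr (\<kappa> + 1) \<le> e powr \<kappa> * (e - c)" by (simp add: right_diff_distrib)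
    then show "(e powr (\<kappa> + 1) - c powr (\<kappa> + 1)) / (\<kappa> + 1) \<le> 1 / (1 + \<kappa>) * e powr \<kappa> * (e - c)"
      using divide_right_mono[of "e powr (\<kappa> + 1) - c powr (\<kappa> + 1)" "e powr \<kappa> * (e - c)" "\<kappa> + 1"] \<kappa>
      by (simp add: add.commute)
  qed
  finally show ?thesis .
qed

text \<open>
  The value at the point 1 is changed because weights have to be positive everywhere.
\<close>

definition dist_one :: "real \<Rightarrow> real" where
  "dist_one x = (if x = 1 then 1 else \<bar>x - 1\<bar>)"

lemma dist_one_pos [simp]: "dist_one x > 0"
  by (simp add: dist_one_def)

lemma dist_one_nonneg [simp]: "dist_one x \<ge> 0"
  by (simp add: dist_one_def)

lemma dist_one_nonzero [simp]: "dist_one x \<noteq> 0"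
  using dist_one_pos[of x] by linarith

lemma borel_measurable_dist_one [measurable]: "dist_one \<in> borel_measurable borel"
  unfolding dist_one_def[abs_def] by measurable

lemma AE_dist_one: "AE x in lborel. dist_one x = \<bar>x - 1\<bar>"
  using AE_lborel_singleton[of "1::real"] by eventually_elim (simp add: dist_one_def)

text \<open>
  The average of \<open>\<bar>x - 1\<bar>\<^sup>\<kappa>\<close> over an interval is controlled by the value at the endpoint that is
  farther from 1, with a constant that blows up only like \<open>1 / (1 + \<kappa>)\<close>. If 1 is inside the interval, the interval is
  first enlarged to a symmetric one, at the cost of a factor 2.
\<close>

lemma nn_integral_dist_one_powr_le:
  fixes a b \<kappa> :: real
  assumes \<kappa>: "- 1 < \<kappa>" and ab: "a < b"
  shows "(\<integral>\<^sup>+x\<in>{a<..<b}. ennreal (dist_one x powr \<kappa>) \<partial>lborel) \<le>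
    ennreal (2 * max 1 (1 / (1 + \<kappa>)) * (max \<bar>a - 1\<bar> \<bar>b - 1\<bar>) powr \<kappa> * (b - a))"
proof -
  define d where "d = max \<bar>a - 1\<bar> \<bar>b - 1\<bar>"
  have d: "d > 0" using ab by (auto simp: d_def)
  define J where "J = (\<integral>\<^sup>+x\<in>{a<..<b}. ennreal (\<bar>x - 1\<bar> powr \<kappa>) \<partial>lborel)"
  have eq: "(\<integral>\<^sup>+x\<in>{a<..<b}. ennreal (dist_one x powr \<kappa>) \<partial>lborel) = J"
    unfolding J_def using AE_dist_one by (intro nn_integral_cong_AE) (auto elim: eventually_mono)
  have up: "(\<integral>\<^sup>+x\<in>{1 + c<..<1 + e}. ennreal (\<bar>x - 1\<bar> powr \<kappa>) \<partial>lborel) = (\<integral>\<^sup>+x\<in>{c<..<e}. ennreal (\<bar>x\<bar> powr \<kappa>) \<partial>lborel)"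
    for c e
    by (subst nn_integral_real_affine[where t = 1 and c = 1]) (auto intro!: nn_integral_cong simp: indicator_def)
  have down: "(\<integral>\<^sup>+x\<in>{1 - e<..<1 - c}. ennreal (\<bar>x - 1\<bar> powr \<kappa>) \<partial>lborel) = (\<integral>\<^sup>+x\<in>{c<..<e}. ennreal (\<bar>x\<bar> powr \<kappa>) \<partial>lborel)"
    for c e
    by (subst nn_integral_real_affine[where t = 1 and c = "- 1"]) (auto intro!: nn_integral_cong simp: indicator_def)
  have "J \<le> ennreal (2 * max 1 (1 / (1 + \<kappa>)) * d powr \<kappa> * (b - a))"
  proof (cases "\<kappa> \<ge> 0")
    case True
    have "J \<le> (\<integral>\<^sup>+x\<in>{a<..<b}. ennreal (d powr \<kappa>) \<partial>lborel)"
      unfolding J_def using True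
      by (intro nn_integral_mono) (auto simp: indicator_def d_def intro!: ennreal_leI powr_mono2)
    also have "\<dots> = ennreal (d powr \<kappa> * (b - a))"
      using ab by (simp add: nn_integral_cmult_indicator ennreal_mult)
    also have "\<dots> \<le> ennreal (2 * max 1 (1 / (1 + \<kappa>)) * d powr \<kappa> * (b - a))"
      using ab by (intro ennreal_leI) (auto simp: mult_le_cancel_right1 intro!: mult_right_mono)
    finally show ?thesis .
  next
    case False
    then have k: "\<kappa> \<le> 0" "1 / (1 + \<kappa>) \<ge> 1" using \<kappa> by (auto simp: field_simps)
    have k2: "1 / (1 + \<kappa>) \<le> 2 * (1 / (1 + \<kappa>))" using k(2) by linarith
    have base: "(\<integral>\<^sup>+x\<in>{c<..<e}. ennreal (\<bar>x\<bar> powr \<kappa>) \<partial>lborel) \<le> ennreal (1 / (1 + \<kappa>) * e powr \<kappa> * (e - c))"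
      if "0 \<le> c" "c < e" for c e
    proof -
      have "(\<integral>\<^sup>+x\<in>{c<..<e}. ennreal (\<bar>x\<bar> powr \<kappa>) \<partial>lborel) = (\<integral>\<^sup>+x\<in>{c<..<e}. ennreal (x powr \<kappa>) \<partial>lborel)"
        using that by (intro nn_integral_cong) (auto simp: indicator_def)
      also have "\<dots> \<le> ennreal (1 / (1 + \<kappa>) * e powr \<kappa> * (e - c))"
        by (rule nn_integral_powr_le[OF \<kappa> k(1) that])
      finally show ?thesis .
    qed
    have "J \<le> ennreal (2 * (1 / (1 + \<kappa>)) * d powr \<kappa> * (b - a))"
    proof -
      consider "1 \<le> a" | "b \<le> 1" | "a < 1" "1 < b" by linarith
      then show ?thesis
      proof cases
        case 1
        then have "d = b - 1" using ab by (auto simp: d_def)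
        then have "J \<le> ennreal (1 / (1 + \<kappa>) * d powr \<kappa> * (b - a))"
          using base[of "a - 1" "b - 1"] up[of "a - 1" "b - 1"] 1 ab by (simp add: J_def)
        also have "\<dots> \<le> ennreal (2 * (1 / (1 + \<kappa>)) * d powr \<kappa> * (b - a))"
          using ab k2 by (intro ennreal_leI mult_right_mono) auto
        finally show ?thesis .
      next
        case 2
        then have "d = 1 - a" using ab by (auto simp: d_def)
        then have "J \<le> ennreal (1 / (1 + \<kappa>) * d powr \<kappa> * (b - a))"
          using base[of "1 - b" "1 - a"] down[of "1 - a" "1 - b"] 2 ab by (simp add: J_def)
        also have "\<dots> \<le> ennreal (2 * (1 / (1 + \<kappa>)) * d powr \<kappa> * (b - a))"
          using ab k2 by (intro ennreal_leI mult_right_mono) auto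
        finally show ?thesis .
      next
        case 3
        let ?g = "\<lambda>x. ennreal (\<bar>x - 1\<bar> powr \<kappa>)"
        have "J \<le> (\<integral>\<^sup>+x. ?g x * indicator {1 - d<..<1 - 0} x + ?g x * indicator {1 + 0<..<1 + d} x \<partial>lborel)"
          unfolding J_def
        proof (intro nn_integral_mono_AE)
          show "AE x in lborel. ?g x * indicator {a<..<b} x \<le> ?g x * indicator {1 - d<..<1 - 0} x + ?g x * indicator {1 + 0<..<1 + d} x"
            using AE_lborel_singleton[of "1::real"] by eventually_elim (auto simp: indicator_def d_def)
        qed
        also have "\<dots> = (\<integral>\<^sup>+x\<in>{1 - d<..<1 - 0}. ?g x \<partial>lborel) + (\<integral>\<^sup>+x\<in>{1 + 0<..<1 + d}. ?g x \<partial>lborel)"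
          by (intro nn_integral_add) auto
        also have "\<dots> \<le> ennreal (1 / (1 + \<kappa>) * d powr \<kappa> * (d - 0)) + ennreal (1 / (1 + \<kappa>) * d powr \<kappa> * (d - 0))"
          unfolding up down using d by (intro add_mono base) auto
        also have "\<dots> = ennreal (2 * (1 / (1 + \<kappa>)) * d powr \<kappa> * d)"
          using d \<kappa> by (subst ennreal_plus[symmetric]) auto
        also have "\<dots> \<le> ennreal (2 * (1 / (1 + \<kappa>)) * d powr \<kappa> * (b - a))"
          using 3 \<kappa> by (intro ennreal_leI mult_left_mono) (auto simp: d_def)
        finally show ?thesis .
      qed
    qed
    also have "\<dots> = ennreal (2 * max 1 (1 / (1 + \<kappa>)) * d powr \<kappa> * (b - a))"
      using k by (simp add: max_def)
    finally show ?thesis .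
  qed
  then show ?thesis unfolding eq d_def .
qed

lemma emeasure_nu_interval:
  assumes "0 \<le> a"
  shows "emeasure (nu lam) {a<..<b} = (\<integral>\<^sup>+x\<in>{a<..<b}. ennreal (x powr (2 * lam + 1)) \<partial>lborel)"
proof -
  have "{a<..<b} \<in> sets half_line"
    using assms by (auto simp: sets_restrict_space intro!: image_eqI[of _ _ "{a<..<b}"])
  then have "emeasure (nu lam) {a<..<b} = (\<integral>\<^sup>+x\<in>{a<..<b}. ennreal (x powr (2 * lam + 1)) \<partial>half_line)"
    unfolding nu_def by (intro emeasure_density borel_measurable_half_line) auto
  then show ?thesis using assms by (subst (asm) nn_integral_half_line_interval) auto
qed

lemma emeasure_nu_interval_ge:
  assumes lam: "lam > - 1 / 2" and ab: "0 \<le> a" "a < b"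
  shows "ennreal ((b / 2) powr (2 * lam + 1) * ((b - a) / 2)) \<le> emeasure (nu lam) {a<..<b}"
proof -
  have "(\<integral>\<^sup>+x\<in>{(a + b) / 2<..<b}. ennreal ((b / 2) powr (2 * lam + 1)) \<partial>lborel) =
      ennreal ((b / 2) powr (2 * lam + 1)) * ennreal (b - (a + b) / 2)"
    using ab by (subst nn_integral_cmult_indicator) auto
  also have "\<dots> = ennreal ((b / 2) powr (2 * lam + 1) * (b - (a + b) / 2))"
    using ab by (intro ennreal_mult[symmetric]) auto
  also have "b - (a + b) / 2 = (b - a) / 2" by (simp add: field_simps)
  finally have "ennreal ((b / 2) powr (2 * lam + 1) * ((b - a) / 2)) =
      (\<integral>\<^sup>+x\<in>{(a + b) / 2<..<b}. ennreal ((b / 2) powr (2 * lam + 1)) \<partial>lborel)" ..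
  also have "\<dots> \<le> (\<integral>\<^sup>+x\<in>{a<..<b}. ennreal (x powr (2 * lam + 1)) \<partial>lborel)"
    using ab lam by (intro nn_integral_mono) (auto simp: indicator_def intro!: ennreal_leI powr_mono2)
  finally show ?thesis unfolding emeasure_nu_interval[OF ab(1)] .
qed

lemma emeasure_nu_interval_finite:
  assumes lam: "lam > - 1 / 2" and ab: "0 \<le> a" "a < b"
  shows "emeasure (nu lam) {a<..<b} < \<infinity>" "emeasure (nu lam) {a<..<b} > 0"
proof -
  have "emeasure (nu lam) {a<..<b} \<le> (\<integral>\<^sup>+x\<in>{a<..<b}. ennreal (b powr (2 * lam + 1)) \<partial>lborel)"
    unfolding emeasure_nu_interval[OF ab(1)]
    using ab lam by (intro nn_integral_mono) (auto simp: indicator_def intro!: ennreal_leI powr_mono2)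
  also have "\<dots> < \<infinity>" using ab by (simp add: nn_integral_cmult_indicator ennreal_mult_less_top)
  finally show "emeasure (nu lam) {a<..<b} < \<infinity>" .
  have "0 < ennreal ((b / 2) powr (2 * lam + 1) * ((b - a) / 2))" using ab by simp
  also have "\<dots> \<le> emeasure (nu lam) {a<..<b}" by (rule emeasure_nu_interval_ge[OF assms])
  finally show "emeasure (nu lam) {a<..<b} > 0" .
qed

lemma div_mono_ennreal:
  fixes a b c d :: ennreal
  assumes "a \<le> b" "d \<le> c"
  shows "a / c \<le> b / d"
proof -
  have "inverse c \<le> inverse d"
  proof (cases c)
    case (real r)
    then obtain q where q: "d = ennreal q" "0 \<le> q" "q \<le> r" using assms(2) by (cases d) (auto simp: top_unique)
    show ?thesis
    proof (cases "q = 0")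
      case False
      then show ?thesis using q real by (auto simp: inverse_ennreal intro!: ennreal_leI le_imp_inverse_le)
    qed (use q in simp)
  qed simp
  then show ?thesis unfolding divide_ennreal_def using assms by (intro mult_mono) auto
qed

text \<open>
  The density \<open>x\<^bsup>2\<lambda>+1\<^esup>\<close> is increasing, and on the right half of an interval \<open>(a, b)\<close> it is at least
  \<open>2\<^bsup>-2\<lambda>-1\<^esup>\<close> times its value at \<open>b\<close>. Hence averages of nonnegative functions for \<open>\<nu>\<^sub>\<lambda>\<close> are bounded by a fixed
  multiple of Lebesgue averages, also for the long intervals and for those that touch 0.
\<close>

lemma nu_average_le:
  assumes lam: "lam > - 1 / 2" and ab: "0 \<le> a" "a < b" and [measurable]: "h \<in> borel_measurable borel"
    and h: "\<And>x. h x \<ge> 0"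
    and le: "(\<integral>\<^sup>+x\<in>{a<..<b}. ennreal (h x) \<partial>lborel) \<le> ennreal (A * (b - a))" and A: "A \<ge> 0"
  shows "(\<integral>\<^sup>+x\<in>{a<..<b}. ennreal (x powr (2 * lam + 1) * h x) \<partial>half_line) / emeasure (nu lam) {a<..<b} \<le>
    ennreal (2 powr (2 * lam + 2) * A)"
proof -
  let ?m = "2 * lam + 1"
  have "(\<integral>\<^sup>+x\<in>{a<..<b}. ennreal (x powr ?m * h x) \<partial>half_line) =
      (\<integral>\<^sup>+x\<in>{a<..<b}. ennreal (x powr ?m * h x) \<partial>lborel)"
    using ab by (intro nn_integral_half_line_interval) auto
  also have "\<dots> \<le> (\<integral>\<^sup>+x. ennreal (b powr ?m) * (ennreal (h x) * indicator {a<..<b} x) \<partial>lborel)"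
    using ab lam h by (intro nn_integral_mono)
      (auto simp: indicator_def ennreal_mult[symmetric] intro!: ennreal_leI mult_right_mono powr_mono2)
  also have "\<dots> = ennreal (b powr ?m) * (\<integral>\<^sup>+x\<in>{a<..<b}. ennreal (h x) \<partial>lborel)"
    by (intro nn_integral_cmult) auto
  also have "\<dots> \<le> ennreal (b powr ?m) * ennreal (A * (b - a))"
    by (intro mult_left_mono le) auto
  also have "\<dots> = ennreal (b powr ?m * (A * (b - a)))"
    using A ab by (simp add: ennreal_mult)
  finally have "(\<integral>\<^sup>+x\<in>{a<..<b}. ennreal (x powr ?m * h x) \<partial>half_line) / emeasure (nu lam) {a<..<b} \<le>
     ennreal (b powr ?m * (A * (b - a))) / ennreal ((b / 2) powr ?m * ((b - a) / 2))"
    using emeasure_nu_interval_ge[OF lam ab] by (rule div_mono_ennreal)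
  also have "\<dots> = ennreal ((b powr ?m * (A * (b - a))) / ((b / 2) powr ?m * ((b - a) / 2)))"
    using A ab by (intro divide_ennreal) auto
  also have "(b powr ?m * (A * (b - a))) / ((b / 2) powr ?m * ((b - a) / 2)) = 2 powr (2 * lam + 2) * A"
  proof -
    have "2 powr (2 * lam + 2) = 2 * 2 powr ?m" using powr_add[of 2 1 ?m] by (simp add: add_ac)
    moreover have "(b / 2) powr ?m = b powr ?m / 2 powr ?m" using ab by (simp add: powr_divide)
    ultimately show ?thesis using ab by simp
  qed
  finally show ?thesis .
qed

lemma nu_average_dist_one_powr_le:
  assumes lam: "lam > - 1 / 2" and ab: "0 \<le> a" "a < b" and \<kappa>: "\<kappa> > - 1"
  shows "(\<integral>\<^sup>+x\<in>{a<..<b}. ennreal (x powr (2 * lam + 1) * dist_one x powr \<kappa>) \<partial>half_line) / emeasure (nu lam) {a<..<b} \<le>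
    ennreal (2 powr (2 * lam + 3) * max 1 (1 / (1 + \<kappa>)) * (max \<bar>a - 1\<bar> \<bar>b - 1\<bar>) powr \<kappa>)"
proof -
  have "2 powr (2 * lam + 3) = 2 powr (2 * lam + 2) * (2::real)"
    by (simp add: powr_add)
  then show ?thesis
    using nu_average_le[OF lam ab _ _ nn_integral_dist_one_powr_le[OF \<kappa> ab(2)]] by (simp add: mult_ac)
qed

section \<open>Power weights and their Andersen--Kerman constants\<close>

lemma ennpowr_mono:
  assumes "a \<le> b" "0 \<le> s"
  shows "ennpowr a s \<le> ennpowr b s"
proof (cases "b = \<infinity>")
  case False
  then have b: "b < top" by (simp add: less_top)
  then have "a \<noteq> \<infinity>" using assms(1) by auto
  moreover have "enn2real a \<le> enn2real b" using assms(1) b by (rule enn2real_mono)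
  ultimately show ?thesis
    using False assms(2) by (simp add: ennpowr_def ennreal_leI powr_mono2)
qed (simp add: ennpowr_def)

lemma ennpowr_ennreal: "0 \<le> r \<Longrightarrow> ennpowr (ennreal r) s = ennreal (r powr s)"
  by (simp add: ennpowr_def)

text \<open>
  The power of \<open>x\<close> is chosen such that both integrands of the Andersen--Kerman condition get the
  factor \<open>x\<^bsup>2\<lambda>+1\<^esup>\<close>: the condition becomes Muckenhoupt's \<open>A\<^sub>p\<close> condition for \<open>\<bar>x - 1\<bar>\<^sup>\<sigma>\<close> and the measure
  \<open>\<nu>\<^sub>\<lambda>\<close>.
\<close>

definition power_weight :: "real \<Rightarrow> real \<Rightarrow> real \<Rightarrow> real \<Rightarrow> real" where
  "power_weight lam p \<sigma> x = x powr (2 * lam + 1 - p) * dist_one x powr \<sigma>"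

lemma borel_measurable_power_weight [measurable]: "power_weight lam p \<sigma> \<in> borel_measurable borel"
  unfolding power_weight_def[abs_def] by measurable

lemma power_weight_pos: "0 < x \<Longrightarrow> power_weight lam p \<sigma> x > 0"
  by (simp add: power_weight_def less_imp_neq[OF dist_one_pos, symmetric])

lemma weight_power_weight: "weight (power_weight lam p \<sigma>)"
  unfolding weight_def by (auto intro: borel_measurable_half_line power_weight_pos)

lemma power_weight_averages:
  assumes p: "p > 1" and x: "x > 0"
  shows "x powr p * power_weight lam p \<sigma> x = x powr (2 * lam + 1) * dist_one x powr \<sigma>"
    and "x powr (2 * lam * (p / (p - 1))) * power_weight lam p \<sigma> x powr (- 1 / (p - 1)) =
      x powr (2 * lam + 1) * dist_one x powr (- \<sigma> / (p - 1))"
proof -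
  show "x powr p * power_weight lam p \<sigma> x = x powr (2 * lam + 1) * dist_one x powr \<sigma>"
    by (simp add: power_weight_def powr_add[symmetric] mult.assoc[symmetric])
  have pw: "power_weight lam p \<sigma> x powr (- 1 / (p - 1)) =
      x powr ((2 * lam + 1 - p) * (- 1 / (p - 1))) * dist_one x powr (- \<sigma> / (p - 1))"
    by (simp add: power_weight_def powr_mult powr_powr)
  have "2 * lam * (p / (p - 1)) + (2 * lam + 1 - p) * (- 1 / (p - 1)) = (2 * lam + 1) * (p - 1) / (p - 1)"
    by (simp add: divide_inverse algebra_simps)
  then have "2 * lam * (p / (p - 1)) + (2 * lam + 1 - p) * (- 1 / (p - 1)) = 2 * lam + 1"
    using p by simp
  with pw show "x powr (2 * lam * (p / (p - 1))) * power_weight lam p \<sigma> x powr (- 1 / (p - 1)) =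
      x powr (2 * lam + 1) * dist_one x powr (- \<sigma> / (p - 1))"
    by (simp add: powr_add[symmetric] mult.assoc[symmetric])
qed

lemma AK_integrals_power_weight:
  assumes p: "p > 1"
  shows "(\<integral>\<^sup>+x\<in>{a<..<b}. ennreal (x powr p * power_weight lam p \<sigma> x) \<partial>half_line) =
      (\<integral>\<^sup>+x\<in>{a<..<b}. ennreal (x powr (2 * lam + 1) * dist_one x powr \<sigma>) \<partial>half_line)"
    and "(\<integral>\<^sup>+x\<in>{a<..<b}. ennreal (x powr (2 * lam * (p / (p - 1))) * power_weight lam p \<sigma> x powr (- 1 / (p - 1))) \<partial>half_line) =
      (\<integral>\<^sup>+x\<in>{a<..<b}. ennreal (x powr (2 * lam + 1) * dist_one x powr (- \<sigma> / (p - 1))) \<partial>half_line)"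
proof -
  have "x > 0" if "x \<in> space half_line" for x using that by (simp add: space_restrict_space)
  note av = power_weight_averages[OF p this]
  show "(\<integral>\<^sup>+x\<in>{a<..<b}. ennreal (x powr p * power_weight lam p \<sigma> x) \<partial>half_line) =
      (\<integral>\<^sup>+x\<in>{a<..<b}. ennreal (x powr (2 * lam + 1) * dist_one x powr \<sigma>) \<partial>half_line)"
    by (intro nn_integral_cong) (simp only: av)
  show "(\<integral>\<^sup>+x\<in>{a<..<b}. ennreal (x powr (2 * lam * (p / (p - 1))) * power_weight lam p \<sigma> x powr (- 1 / (p - 1))) \<partial>half_line) =
      (\<integral>\<^sup>+x\<in>{a<..<b}. ennreal (x powr (2 * lam + 1) * dist_one x powr (- \<sigma> / (p - 1))) \<partial>half_line)"
    by (intro nn_integral_cong) (simp only: av)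
qed

text \<open>
  The powers of the larger distance \<open>d\<close> of an endpoint from 1 cancel between the two averages.
\<close>

lemma AK_const_power_weight_le:
  assumes lam: "lam > - 1 / 2" and p: "p > 1" and \<sigma>: "- 1 < \<sigma>" "\<sigma> < p - 1"
  shows "AK_const lam p (power_weight lam p \<sigma>) \<le>
    ennreal (2 powr ((2 * lam + 3) * p) * max 1 (1 / (1 + \<sigma>)) * max 1 (1 / (1 - \<sigma> / (p - 1))) powr (p - 1))"
  unfolding AK_const_def
proof (rule SUP_least)
  fix I assume "I \<in> finite_intervals"
  then obtain a b where I: "I = {a<..<b}" and ab: "0 \<le> a" "a < b" by (auto simp: finite_intervals_def)
  define d where "d = max \<bar>a - 1\<bar> \<bar>b - 1\<bar>"
  have d: "d > 0" using ab by (auto simp: d_def)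
  define M1 M2 where "M1 = max 1 (1 / (1 + \<sigma>))" and "M2 = max 1 (1 / (1 - \<sigma> / (p - 1)))"
  have M: "M1 > 0" "M2 > 0" by (auto simp: M1_def M2_def)
  let ?m = "2 * lam + 3"
  let ?A1 = "(\<integral>\<^sup>+x\<in>I. ennreal (x powr p * power_weight lam p \<sigma> x) \<partial>half_line) / emeasure (nu lam) I"
  let ?A2 = "(\<integral>\<^sup>+x\<in>I. ennreal (x powr (2 * lam * (p / (p - 1))) * power_weight lam p \<sigma> x powr (- 1 / (p - 1))) \<partial>half_line)
    / emeasure (nu lam) I"
  have "- \<sigma> / (p - 1) > - 1" using \<sigma> p by (simp add: field_simps)
  then have 2: "?A2 \<le> ennreal (2 powr ?m * M2 * d powr (- \<sigma> / (p - 1)))"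
    unfolding I AK_integrals_power_weight[OF p] d_def M2_def
    using nu_average_dist_one_powr_le[OF lam ab, of "- \<sigma> / (p - 1)"] by simp
  have 1: "?A1 \<le> ennreal (2 powr ?m * M1 * d powr \<sigma>)"
    unfolding I AK_integrals_power_weight[OF p] d_def M1_def
    by (rule nu_average_dist_one_powr_le[OF lam ab \<sigma>(1)])
  have "?A1 * ennpowr ?A2 (p - 1) \<le>
      ennreal (2 powr ?m * M1 * d powr \<sigma>) * ennpowr (ennreal (2 powr ?m * M2 * d powr (- \<sigma> / (p - 1)))) (p - 1)"
    using p by (intro mult_mono 1 ennpowr_mono 2) auto
  also have "\<dots> = ennreal (2 powr ?m * M1 * d powr \<sigma> * (2 powr ?m * M2 * d powr (- \<sigma> / (p - 1))) powr (p - 1))"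
    using M by (subst ennpowr_ennreal) (auto simp: ennreal_mult)
  also have "2 powr ?m * M1 * d powr \<sigma> * (2 powr ?m * M2 * d powr (- \<sigma> / (p - 1))) powr (p - 1) =
     2 powr (?m * p) * M1 * M2 powr (p - 1)"
  proof -
    have "(2 powr ?m * M2 * d powr (- \<sigma> / (p - 1))) powr (p - 1) =
        2 powr (?m * (p - 1)) * M2 powr (p - 1) * d powr (- \<sigma>)"
      using M d p by (simp add: powr_mult powr_powr)
    moreover have "2 powr ?m * 2 powr (?m * (p - 1)) = (2 :: real) powr (?m * p)"
      unfolding powr_add[symmetric] by (simp add: algebra_simps)
    moreover have "d powr \<sigma> * d powr (- \<sigma>) = 1" using d by (simp add: powr_add[symmetric])
    moreover have "2 powr ?m * M1 * d powr \<sigma> * (2 powr (?m * (p - 1)) * M2 powr (p - 1) * d powr (- \<sigma>)) =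
       (2 powr ?m * 2 powr (?m * (p - 1))) * (d powr \<sigma> * d powr (- \<sigma>)) * M1 * M2 powr (p - 1)"
      by (simp only: mult_ac)
    ultimately show ?thesis by (simp only: mult_1_right)
  qed
  finally show "?A1 * ennpowr ?A2 (p - 1) \<le>
    ennreal (2 powr (?m * p) * max 1 (1 / (1 + \<sigma>)) * max 1 (1 / (1 - \<sigma> / (p - 1))) powr (p - 1))"
    unfolding M1_def M2_def .
qed

text \<open>
  On the interval \<open>(2, 3)\<close>, where the distance to 1 lies between 1 and 2. This bound serves to
  exclude negative exponents in the estimates.
\<close>

lemma AK_const_power_weight_ge:
  assumes lam: "lam > - 1 / 2" and p: "p > 1"
  shows "ennreal (2 powr (- 2 * \<bar>\<sigma>\<bar>)) \<le> AK_const lam p (power_weight lam p \<sigma>)"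
proof -
  let ?I = "{2<..<3::real}"
  let ?N = "emeasure (nu lam) ?I"
  have N: "?N < top" "?N > 0" using emeasure_nu_interval_finite[OF lam, of 2 3] by auto
  have avg: "ennreal (2 powr (- \<bar>\<kappa>\<bar>)) \<le>
      (\<integral>\<^sup>+x\<in>?I. ennreal (x powr (2 * lam + 1) * dist_one x powr \<kappa>) \<partial>half_line) / ?N" for \<kappa>
  proof -
    have "ennreal (2 powr (- \<bar>\<kappa>\<bar>)) * ?N = (\<integral>\<^sup>+x. ennreal (2 powr (- \<bar>\<kappa>\<bar>)) * (ennreal (x powr (2 * lam + 1)) * indicator ?I x) \<partial>lborel)"
      by (subst emeasure_nu_interval) (auto intro!: nn_integral_cmult[symmetric])
    also have "\<dots> \<le> (\<integral>\<^sup>+x\<in>?I. ennreal (x powr (2 * lam + 1) * dist_one x powr \<kappa>) \<partial>lborel)"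
    proof (intro nn_integral_mono)
      fix x :: real
      show "ennreal (2 powr (- \<bar>\<kappa>\<bar>)) * (ennreal (x powr (2 * lam + 1)) * indicator ?I x) \<le>
          ennreal (x powr (2 * lam + 1) * dist_one x powr \<kappa>) * indicator ?I x"
      proof (cases "x \<in> ?I")
        case True
        then have "2 powr (- \<bar>\<kappa>\<bar>) \<le> dist_one x powr \<kappa>"
          by (intro powr_two_sided) (auto simp: dist_one_def)
        then have "x powr (2 * lam + 1) * 2 powr (- \<bar>\<kappa>\<bar>) \<le> x powr (2 * lam + 1) * dist_one x powr \<kappa>"
          by (intro mult_left_mono) auto
        then show ?thesis using True by (simp add: ennreal_mult[symmetric] mult.commute ennreal_leI)
      qed simp
    qed
    also have "\<dots> = (\<integral>\<^sup>+x\<in>?I. ennreal (x powr (2 * lam + 1) * dist_one x powr \<kappa>) \<partial>half_line)"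
      by (rule nn_integral_half_line_interval[symmetric]) auto
    finally have "ennreal (2 powr (- \<bar>\<kappa>\<bar>)) * ?N / ?N \<le>
      (\<integral>\<^sup>+x\<in>?I. ennreal (x powr (2 * lam + 1) * dist_one x powr \<kappa>) \<partial>half_line) / ?N"
      by (rule divide_right_mono_ennreal)
    then show ?thesis using N by (simp add: ennreal_mult_divide_eq)
  qed
  have "2 powr (- 2 * \<bar>\<sigma>\<bar>) = 2 powr (- \<bar>\<sigma>\<bar>) * (2 powr (- \<bar>- \<sigma> / (p - 1)\<bar>)) powr (p - 1)"
    using p by (simp add: powr_powr powr_add[symmetric] abs_divide)
  then have "ennreal (2 powr (- 2 * \<bar>\<sigma>\<bar>)) = ennreal (2 powr (- \<bar>\<sigma>\<bar>)) * ennpowr (ennreal (2 powr (- \<bar>- \<sigma> / (p - 1)\<bar>))) (p - 1)"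
    by (simp add: ennpowr_ennreal ennreal_mult)
  also have "\<dots> \<le> ((\<integral>\<^sup>+x\<in>?I. ennreal (x powr p * power_weight lam p \<sigma> x) \<partial>half_line) / ?N) *
     ennpowr ((\<integral>\<^sup>+x\<in>?I. ennreal (x powr (2 * lam * (p / (p - 1))) * power_weight lam p \<sigma> x powr (- 1 / (p - 1))) \<partial>half_line) / ?N) (p - 1)"
    unfolding AK_integrals_power_weight[OF p]
    using p by (intro mult_mono avg ennpowr_mono) auto
  also have "\<dots> \<le> AK_const lam p (power_weight lam p \<sigma>)"
    unfolding AK_const_def
  proof (rule SUP_upper[of ?I])
    show "?I \<in> finite_intervals"
      unfolding finite_intervals_def by (rule CollectI, rule exI[of _ 2], rule exI[of _ 3]) simp
  qed
  finally show ?thesis .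
qed

section \<open>The logarithm of the distance to 1 has bounded mean oscillation\<close>

lemma nn_integral_nu:
  assumes [measurable]: "f \<in> borel_measurable borel"
  shows "integral\<^sup>N (nu lam) f = (\<integral>\<^sup>+x. ennreal (x powr (2 * lam + 1)) * f x \<partial>half_line)"
  unfolding nu_def by (intro nn_integral_density borel_measurable_half_line) auto

text \<open>
  As \<open>ln t \<le> 2 \<surd>t\<close> for \<open>t = d / \<bar>x - 1\<bar>\<close>, the claim follows from the bound for the average of
  \<open>\<bar>x - 1\<bar>\<^bsup>-1/2\<^esup>\<close>.
\<close>

lemma log_deviation_average:
  assumes lam: "lam > - 1 / 2" and ab: "0 \<le> a" "a < b"
  shows "(\<integral>\<^sup>+x\<in>{a<..<b}. ennreal \<bar>ln (dist_one x) - ln (max \<bar>a - 1\<bar> \<bar>b - 1\<bar>)\<bar> \<partial>nu lam) / emeasure (nu lam) {a<..<b} \<le>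
    ennreal (2 powr (2 * lam + 5))"
proof -
  define d where "d = max \<bar>a - 1\<bar> \<bar>b - 1\<bar>"
  have d: "d > 0" using ab by (auto simp: d_def)
  have ln_le: "\<bar>ln (dist_one x) - ln d\<bar> \<le> 2 * d powr (1 / 2) * dist_one x powr (- 1 / 2)" if "dist_one x \<le> d" for x
  proof -
    define t where "t = d / dist_one x"
    have t: "t \<ge> 1" using that by (simp add: t_def)
    have "\<bar>ln (dist_one x) - ln d\<bar> = ln t" using d that by (simp add: t_def ln_div)
    also have "ln t = 2 * ln (sqrt t)" using t by (simp add: ln_sqrt)
    also have "ln (sqrt t) \<le> sqrt t" using t by (intro less_imp_le ln_less_self) auto
    also have "sqrt t = d powr (1 / 2) * dist_one x powr (- 1 / 2)"
      using d t by (simp add: powr_half_sqrt[symmetric] t_def powr_divide powr_minus_divide less_imp_le)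
    finally show ?thesis by simp
  qed
  have "(\<integral>\<^sup>+x\<in>{a<..<b}. ennreal \<bar>ln (dist_one x) - ln d\<bar> \<partial>nu lam) =
     (\<integral>\<^sup>+x\<in>{a<..<b}. ennreal (x powr (2 * lam + 1)) * ennreal \<bar>ln (dist_one x) - ln d\<bar> \<partial>lborel)"
    using ab by (subst nn_integral_nu) (auto simp: mult.assoc[symmetric] nn_integral_half_line_interval)
  also have "\<dots> \<le> (\<integral>\<^sup>+x. ennreal (2 * d powr (1 / 2)) * (ennreal (x powr (2 * lam + 1) * dist_one x powr (- 1 / 2)) * indicator {a<..<b} x) \<partial>lborel)"
  proof (intro nn_integral_mono_AE)
    show "AE x in lborel. ennreal (x powr (2 * lam + 1)) * ennreal \<bar>ln (dist_one x) - ln d\<bar> * indicator {a<..<b} x \<le>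
      ennreal (2 * d powr (1 / 2)) * (ennreal (x powr (2 * lam + 1) * dist_one x powr (- 1 / 2)) * indicator {a<..<b} x)"
      using AE_dist_one
    proof eventually_elim
      case (elim x)
      show ?case
      proof (cases "x \<in> {a<..<b}")
        case True
        then have "dist_one x \<le> d" unfolding elim d_def by auto
        from mult_left_mono[OF ln_le[OF this], of "x powr (2 * lam + 1)"] True show ?thesis
          by (simp add: ennreal_mult[symmetric] mult_ac ennreal_leI)
      qed simp
    qed
  qed
  also have "\<dots> = ennreal (2 * d powr (1 / 2)) * (\<integral>\<^sup>+x\<in>{a<..<b}. ennreal (x powr (2 * lam + 1) * dist_one x powr (- 1 / 2)) \<partial>half_line)"
    using ab by (subst nn_integral_half_line_interval) (auto intro!: nn_integral_cmult)
  finally have "(\<integral>\<^sup>+x\<in>{a<..<b}. ennreal \<bar>ln (dist_one x) - ln d\<bar> \<partial>nu lam) / emeasure (nu lam) {a<..<b} \<le>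
     ennreal (2 * d powr (1 / 2)) * (\<integral>\<^sup>+x\<in>{a<..<b}. ennreal (x powr (2 * lam + 1) * dist_one x powr (- 1 / 2)) \<partial>half_line) /
       emeasure (nu lam) {a<..<b}"
    by (rule divide_right_mono_ennreal)
  also have "\<dots> \<le> ennreal (2 * d powr (1 / 2)) * ennreal (2 powr (2 * lam + 3) * max 1 (1 / (1 + - 1 / 2)) * d powr (- 1 / 2))"
    unfolding ennreal_times_divide[symmetric] d_def
    by (intro mult_left_mono nu_average_dist_one_powr_le lam ab) auto
  also have "\<dots> = ennreal (2 * d powr (1 / 2) * (2 powr (2 * lam + 3) * 2 * d powr (- 1 / 2)))"
    using d by (simp add: ennreal_mult[symmetric])
  also have "2 * d powr (1 / 2) * (2 powr (2 * lam + 3) * 2 * d powr (- 1 / 2)) = 2 powr (2 * lam + 5)"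
  proof -
    have "d powr (1 / 2) * d powr (- 1 / 2) = 1" using d by (simp add: powr_add[symmetric])
    moreover have "2 powr (2 * lam + 5) = 4 * (2::real) powr (2 * lam + 3)"
      using powr_add[of 2 2 "2 * lam + 3"] by (simp add: add_ac)
    ultimately show ?thesis by (simp add: mult_ac)
  qed
  finally show ?thesis unfolding d_def .
qed

lemma sets_nu: "sets (nu lam) = sets half_line"
  by (simp add: nu_def)

lemma interval_in_sets_nu: "0 \<le> a \<Longrightarrow> {a<..<b} \<in> sets (nu lam)"
  unfolding sets_nu by (auto simp: sets_restrict_space intro!: image_eqI[of _ _ "{a<..<b}"])

lemma measurable_nu: "f \<in> borel_measurable borel \<Longrightarrow> f \<in> borel_measurable (nu lam)"
  unfolding nu_def by (simp add: borel_measurable_half_line)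

text \<open>
  Passing from the constant \<open>ln d\<close> to the mean value costs a factor 2.
\<close>

lemma BMO_norm_log_le:
  assumes lam: "lam > - 1 / 2"
  shows "BMO_norm lam (\<lambda>x. ln (dist_one x)) \<le> ennreal (2 powr (2 * lam + 6))"
    and "0 \<le> a \<Longrightarrow> a < b \<Longrightarrow> set_integrable (nu lam) {a<..<b} (\<lambda>x. ln (dist_one x))"
proof -
  let ?b = "\<lambda>x. ln (dist_one x)"
  have int: "set_integrable (nu lam) {a<..<b} (\<lambda>x. ?b x - ln (max \<bar>a - 1\<bar> \<bar>b - 1\<bar>))" if ab: "0 \<le> a" "a < b" for a b
    unfolding set_integrable_def
  proof (rule integrableI_bounded)
    let ?f = "\<lambda>x. ?b x - ln (max \<bar>a - 1\<bar> \<bar>b - 1\<bar>)"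
    show "(\<lambda>x. indicator {a<..<b} x *\<^sub>R ?f x) \<in> borel_measurable (nu lam)"
      by (intro measurable_nu) measurable
    have "(\<integral>\<^sup>+x. ennreal (norm (indicator {a<..<b} x *\<^sub>R ?f x)) \<partial>nu lam) = (\<integral>\<^sup>+x\<in>{a<..<b}. ennreal \<bar>?f x\<bar> \<partial>nu lam)"
      by (intro nn_integral_cong) (auto simp: indicator_def)
    also have "\<dots> < \<infinity>"
    proof (rule ccontr)
      assume "\<not> ?thesis"
      then have "(\<integral>\<^sup>+x\<in>{a<..<b}. ennreal \<bar>?f x\<bar> \<partial>nu lam) = top" by (simp add: not_less top_unique)
      then show False
        using log_deviation_average[OF lam ab] emeasure_nu_interval_finite[OF lam ab]
        by (auto simp: ennreal_top_divide top_unique split: if_splits)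
    qed
    finally show "(\<integral>\<^sup>+x. ennreal (norm (indicator {a<..<b} x *\<^sub>R ?f x)) \<partial>nu lam) < \<infinity>" .
  qed
  have const: "set_integrable (nu lam) {a<..<b} (\<lambda>x. c)" if ab: "0 \<le> a" "a < b" for a b and c :: real
    using emeasure_nu_interval_finite[OF lam ab] interval_in_sets_nu[OF ab(1)]
    unfolding set_integrable_def by (intro integrable_scaleR_left integrable_real_indicator) auto
  show int': "set_integrable (nu lam) {a<..<b} ?b" if ab: "0 \<le> a" "a < b" for a b
    using set_integral_add(1)[OF int[OF ab] const[OF ab, of "ln (max \<bar>a - 1\<bar> \<bar>b - 1\<bar>)"]] by simp
  show "BMO_norm lam ?b \<le> ennreal (2 powr (2 * lam + 6))"
    unfolding BMO_norm_def
  proof (rule SUP_least)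
    fix I assume "I \<in> finite_intervals"
    then obtain a b where I: "I = {a<..<b}" and ab: "0 \<le> a" "a < b" by (auto simp: finite_intervals_def)
    define c where "c = ln (max \<bar>a - 1\<bar> \<bar>b - 1\<bar>)"
    let ?N = "emeasure (nu lam) I"
    have N: "?N < top" "?N > 0" using emeasure_nu_interval_finite[OF lam ab] I by auto
    have Im [measurable]: "I \<in> sets (nu lam)" unfolding I by (rule interval_in_sets_nu[OF ab(1)])
    define n where "n = measure (nu lam) I"
    have n1: "?N = ennreal n" unfolding n_def using N(1) by (intro emeasure_eq_ennreal_measure) auto
    have "0 < ennreal n" using N(2) unfolding n1 .
    then have n: "?N = ennreal n" "n > 0" using n1 by (auto simp del: ennreal_less_top)
    let ?osc = "\<integral>\<^sup>+x\<in>I. ennreal \<bar>?b x - c\<bar> \<partial>nu lam"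
    have osc: "?osc / ?N \<le> ennreal (2 powr (2 * lam + 5))"
      using log_deviation_average[OF lam ab] unfolding I c_def .
    have "nu_avg lam ?b I - c = (LINT x:I|nu lam. ?b x - c) / n"
    proof -
      have "(LINT x:I|nu lam. ?b x - c) = (LINT x:I|nu lam. ?b x) - (LINT x:I|nu lam. c)"
        unfolding I by (intro set_integral_diff int' const ab)
      also have "(LINT x:I|nu lam. c) = n * c"
        unfolding set_lebesgue_integral_def using N by (simp add: n_def)
      finally show ?thesis using n by (simp add: nu_avg_def n_def[symmetric] field_simps)
    qed
    then have "ennreal \<bar>nu_avg lam ?b I - c\<bar> \<le> ?osc / ?N"
    proof -
      assume e: "nu_avg lam ?b I - c = (LINT x:I|nu lam. ?b x - c) / n"
      have i: "integrable (nu lam) (\<lambda>x. indicator I x *\<^sub>R (?b x - c))"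
        using int[OF ab] unfolding I c_def set_integrable_def .
      have "ennreal \<bar>LINT x:I|nu lam. ?b x - c\<bar> \<le> ennreal (LINT x|nu lam. norm (indicator I x *\<^sub>R (?b x - c)))"
        unfolding set_lebesgue_integral_def using integral_norm_bound[of "nu lam" "\<lambda>x. indicator I x *\<^sub>R (?b x - c)"]
        by (intro ennreal_leI) simp
      also have "\<dots> = (\<integral>\<^sup>+x. ennreal (norm (indicator I x *\<^sub>R (?b x - c))) \<partial>nu lam)"
        using i by (intro nn_integral_eq_integral[symmetric]) auto
      also have "\<dots> = ?osc" by (intro nn_integral_cong) (auto simp: indicator_def)
      finally have "ennreal \<bar>LINT x:I|nu lam. ?b x - c\<bar> / ?N \<le> ?osc / ?N" by (rule divide_right_mono_ennreal)
      moreover have "ennreal \<bar>LINT x:I|nu lam. ?b x - c\<bar> / ?N = ennreal \<bar>nu_avg lam ?b I - c\<bar>"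
        unfolding e n(1) using n(2) by (simp add: divide_ennreal abs_divide)
      ultimately show ?thesis by simp
    qed
    then have avg: "ennreal \<bar>nu_avg lam ?b I - c\<bar> \<le> ennreal (2 powr (2 * lam + 5))" using osc by (rule order_trans)
    have "(\<integral>\<^sup>+x\<in>I. ennreal \<bar>?b x - nu_avg lam ?b I\<bar> \<partial>nu lam) \<le>
        (\<integral>\<^sup>+x. ennreal \<bar>?b x - c\<bar> * indicator I x + ennreal \<bar>nu_avg lam ?b I - c\<bar> * indicator I x \<partial>nu lam)"
      by (intro nn_integral_mono) (auto simp: indicator_def ennreal_plus[symmetric] simp del: ennreal_plus intro!: ennreal_leI)
    also have "\<dots> = ?osc + ennreal \<bar>nu_avg lam ?b I - c\<bar> * ?N"
    proof (subst nn_integral_add)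
      show "(\<lambda>x. ennreal \<bar>?b x - c\<bar> * indicator I x) \<in> borel_measurable (nu lam)"
        unfolding I by (intro measurable_nu) measurable
    qed (auto simp: nn_integral_cmult_indicator)
    finally have "(\<integral>\<^sup>+x\<in>I. ennreal \<bar>?b x - nu_avg lam ?b I\<bar> \<partial>nu lam) / ?N \<le>
       (?osc + ennreal \<bar>nu_avg lam ?b I - c\<bar> * ?N) / ?N" by (rule divide_right_mono_ennreal)
    also have "\<dots> = ?osc / ?N + ennreal \<bar>nu_avg lam ?b I - c\<bar>"
      unfolding add_divide_distrib_ennreal using N by (simp add: ennreal_mult_divide_eq)
    also have "\<dots> \<le> ennreal (2 powr (2 * lam + 5)) + ennreal (2 powr (2 * lam + 5))"
      by (intro add_mono osc avg)
    also have "\<dots> = ennreal (2 powr (2 * lam + 6))"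
      using powr_add[of 2 1 "2 * lam + 5"] by (simp add: ennreal_plus[symmetric] add_ac del: ennreal_plus)
    finally show "(\<integral>\<^sup>+x\<in>I. ennreal \<bar>?b x - nu_avg lam ?b I\<bar> \<partial>nu lam) / ?N \<le> ennreal (2 powr (2 * lam + 6))" .
  qed
qed

lemma log_in_BMO:
  assumes lam: "lam > - 1 / 2"
  shows "(\<lambda>x. ln (dist_one x)) \<in> BMO lam"
  unfolding BMO_def
proof (intro CollectI conjI allI impI)
  fix K :: "real set" assume K: "compact K \<and> K \<subseteq> {0<..}"
  then obtain B where B: "\<And>x. x \<in> K \<Longrightarrow> \<bar>x\<bar> \<le> B" using compact_imp_bounded[of K] unfolding bounded_iff real_norm_def by blast
  have KB: "K \<subseteq> {0<..<\<bar>B\<bar> + 1}"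
  proof
    fix x assume "x \<in> K"
    with K have "0 < x" by auto
    with B[OF \<open>x \<in> K\<close>] show "x \<in> {0<..<\<bar>B\<bar> + 1}" by simp
  qed
  have "K \<in> sets (nu lam)"
    unfolding sets_nu using K by (auto simp: sets_restrict_space intro!: image_eqI[of _ _ K] dest: compact_imp_closed)
  then show "set_integrable (nu lam) K (\<lambda>x. ln (dist_one x))"
    using KB by (rule set_integrable_subset[OF BMO_norm_log_le(2)[OF lam, of 0 "\<bar>B\<bar> + 1"], rotated 2]) simp_all
next
  show "BMO_norm lam (\<lambda>x. ln (dist_one x)) < \<infinity>"
    using BMO_norm_log_le(1)[OF lam] by (rule le_less_trans) simp
qed

section \<open>The operators to the left of the support\<close>

text \<open>
  To the left of the support the truncation in the principal value is inactive once \<open>\<epsilon> < 1 - x\<close>, and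
  only values of the kernel below the diagonal enter.
\<close>

lemma riesz_off_support:
  assumes lam: "lam > - 1 / 2" and x: "0 < x" "x < 1"
    and [measurable]: "g \<in> borel_measurable borel"
    and bdd: "\<And>y. \<bar>g y\<bar> \<le> G" and supp: "\<And>y. y \<notin> {1<..<2} \<Longrightarrow> g y = 0"
  shows "integrable lborel (\<lambda>y. kernel_below lam x y * g y * y powr (2 * lam))" (is "integrable lborel ?f")
    and "riesz lam g x = (LINT y|lborel. kernel_below lam x y * g y * y powr (2 * lam))"
proof -
  define W where "W = integral\<^sup>L lborel (poisson_weight lam)"
  have W: "W \<ge> 0" unfolding W_def by (intro Bochner_Integration.integral_nonneg) auto
  define M where "M = x / pi * (W * (((2 * lam + 1) * x\<^sup>2 + 2\<^sup>2) * (1\<^sup>2 - x\<^sup>2) powr (- lam - 2)))"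
  have kernel: "0 \<le> kernel_below lam x y" "kernel_below lam x y \<le> M" if y: "y \<in> {1<..<2}" for y
  proof -
    have xy: "0 < x" "x < y" using x y by auto
    show "0 \<le> kernel_below lam x y" by (rule integrable_kernel_below(2)[OF lam xy])
    have "kernel_below lam x y \<le> x / pi * (W * (((2 * lam + 1) * x\<^sup>2 + y\<^sup>2) * (y\<^sup>2 - x\<^sup>2) powr (- lam - 2)))"
      unfolding W_def by (rule integrable_kernel_below(3)[OF lam xy])
    also have "\<dots> \<le> M"
      unfolding M_def
    proof (intro mult_left_mono mult_mono add_mono)
      have "x\<^sup>2 < 1\<^sup>2" using x by (intro power_strict_mono) auto
      moreover have "1\<^sup>2 \<le> y\<^sup>2" using y by (intro power_mono) auto
      ultimately show "(y\<^sup>2 - x\<^sup>2) powr (- lam - 2) \<le> (1\<^sup>2 - x\<^sup>2) powr (- lam - 2)"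
        using lam by (intro powr_mono2') auto
      show "y\<^sup>2 \<le> 2\<^sup>2" using y by (intro power_mono) auto
    qed (use W x lam in auto)
    finally show "kernel_below lam x y \<le> M" .
  qed
  show int: "integrable lborel ?f"
  proof (rule Bochner_Integration.integrable_bound)
    show "integrable lborel (\<lambda>y. indicator {1<..<2::real} y * (M * G * 2 powr \<bar>2 * lam\<bar>))" by simp
    show "AE y in lborel. norm (?f y) \<le> norm (indicator {1<..<2} y * (M * G * 2 powr \<bar>2 * lam\<bar>))"
    proof (intro AE_I2)
      fix y
      show "norm (?f y) \<le> norm (indicator {1<..<2} y * (M * G * 2 powr \<bar>2 * lam\<bar>))"
      proof (cases "y \<in> {1<..<2}")
        case True
        then have "y powr (2 * lam) \<le> 2 powr \<bar>2 * lam\<bar>" by (intro powr_two_sided) auto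
        then have "\<bar>?f y\<bar> \<le> M * G * 2 powr \<bar>2 * lam\<bar>"
          unfolding abs_mult using kernel[OF True] bdd[of y] order_trans[OF abs_ge_zero bdd[of y]]
          by (intro mult_mono) auto
        then show ?thesis using True by simp
      qed (simp add: supp)
    qed
  qed measurable
  show "riesz lam g x = integral\<^sup>L lborel ?f"
    unfolding riesz_def
  proof (rule tendsto_Lim)
    let ?I = "\<lambda>\<epsilon>. LINT y:{y. \<bar>x - y\<bar> > \<epsilon>}|half_line. riesz_kernel lam x y * g y * y powr (2 * lam)"
    have "?I \<epsilon> = integral\<^sup>L lborel ?f" if \<epsilon>: "\<epsilon> < 1 - x" for \<epsilon>
    proof -
      have "?I \<epsilon> = integral\<^sup>L half_line ?f"
        unfolding set_lebesgue_integral_def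
      proof (rule Bochner_Integration.integral_cong[OF refl])
        fix y
        show "indicator {y. \<bar>x - y\<bar> > \<epsilon>} y *\<^sub>R (riesz_kernel lam x y * g y * y powr (2 * lam)) = ?f y"
        proof (cases "y \<in> {1<..<2}")
          case True
          then show ?thesis using riesz_kernel_eq_kernel_below[OF lam, of x y] x \<epsilon> by simp
        qed (simp add: supp)
      qed
      also have "\<dots> = (LINT y|lborel. indicator {0<..} y * ?f y)" by (rule integral_half_line) measurable
      also have "\<dots> = integral\<^sup>L lborel ?f"
        using supp by (intro Bochner_Integration.integral_cong) (auto simp: indicator_def)
      finally show ?thesis .
    qed
    then have "\<forall>\<^sub>F \<epsilon> in at_right 0. ?I \<epsilon> = integral\<^sup>L lborel ?f"
      using x unfolding eventually_at_right_field by (intro exI[of _ "1 - x"]) auto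
    then show "(?I \<longlongrightarrow> integral\<^sup>L lborel ?f) (at_right 0)"
      by (rule tendsto_eventually)
  qed simp
qed

lemma riesz_commutator_off_support:
  assumes lam: "lam > - 1 / 2" and x: "0 < x" "x < 1"
    and [measurable]: "g \<in> borel_measurable borel" "b \<in> borel_measurable borel"
    and bdd: "\<And>y. \<bar>g y\<bar> \<le> G" "\<And>y. \<bar>b y * g y\<bar> \<le> G'"
    and supp: "\<And>y. y \<notin> {1<..<2} \<Longrightarrow> g y = 0"
  shows "integrable lborel (\<lambda>y. (b x - b y) * (kernel_below lam x y * g y * y powr (2 * lam)))"
    and "riesz_commutator lam b g x = (LINT y|lborel. (b x - b y) * (kernel_below lam x y * g y * y powr (2 * lam)))"
proof -
  let ?k = "\<lambda>g y. kernel_below lam x y * g y * y powr (2 * lam)"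
  have r: "integrable lborel (?k g)" "riesz lam g x = integral\<^sup>L lborel (?k g)"
    by (rule riesz_off_support[OF lam x _ bdd(1) supp]; simp)+
  have rb: "integrable lborel (?k (\<lambda>y. b y * g y))" "riesz lam (\<lambda>y. b y * g y) x = integral\<^sup>L lborel (?k (\<lambda>y. b y * g y))"
    by (rule riesz_off_support[OF lam x _ bdd(2)]; simp add: supp)+
  have eq: "(b x - b y) * ?k g y = b x * ?k g y - ?k (\<lambda>y. b y * g y) y" for y
    by (simp add: algebra_simps)
  show "integrable lborel (\<lambda>y. (b x - b y) * ?k g y)"
    unfolding eq using r(1) rb(1) by simp
  show "riesz_commutator lam b g x = (LINT y|lborel. (b x - b y) * ?k g y)"
    unfolding eq riesz_commutator_def r(2) rb(2)
    by (subst Bochner_Integration.integral_diff) (use r(1) rb(1) in auto)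
qed

section \<open>Test functions on shells around 1\<close>

text \<open>
  The measure \<open>dx / \<bar>x - 1\<bar>\<close> is invariant under dilations about 1; all norms are reduced to
  it.
\<close>

lemma nn_integral_inverse_dist_one:
  assumes "0 < \<alpha>" "\<alpha> < \<beta>"
  shows "(\<integral>\<^sup>+x\<in>{1 + \<alpha><..<1 + \<beta>}. ennreal (1 / dist_one x) \<partial>lborel) = ennreal (ln \<beta> - ln \<alpha>)"
    and "(\<integral>\<^sup>+x\<in>{1 - \<beta><..<1 - \<alpha>}. ennreal (1 / dist_one x) \<partial>lborel) = ennreal (ln \<beta> - ln \<alpha>)"
proof -
  have "((\<lambda>x. 1 / x) has_integral (ln \<beta> - ln \<alpha>)) {\<alpha>..\<beta>}"
  proof (rule fundamental_theorem_of_calculus)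
    fix x assume "x \<in> {\<alpha>..\<beta>}"
    then have "(ln has_real_derivative 1 / x) (at x)"
      using assms by (auto intro!: derivative_eq_intros)
    then show "(ln has_vector_derivative 1 / x) (at x within {\<alpha>..\<beta>})"
      by (simp add: has_real_derivative_iff_has_vector_derivative has_vector_derivative_at_within)
  qed (use assms in auto)
  then have "((\<lambda>x. 1 / x) has_integral (ln \<beta> - ln \<alpha>)) {\<alpha><..<\<beta>}"
    by (simp add: has_integral_Icc_iff_Ioo)
  then have base: "(\<integral>\<^sup>+x. ennreal (1 / x) * indicator {\<alpha><..<\<beta>} x \<partial>lborel) = ennreal (ln \<beta> - ln \<alpha>)"
    using assms by (intro nn_integral_has_integral_lebesgue') auto
  show "(\<integral>\<^sup>+x\<in>{1 + \<alpha><..<1 + \<beta>}. ennreal (1 / dist_one x) \<partial>lborel) = ennreal (ln \<beta> - ln \<alpha>)"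
    unfolding base[symmetric] using assms
    by (subst nn_integral_real_affine[where t = 1 and c = 1])
       (auto intro!: nn_integral_cong simp: indicator_def dist_one_def)
  show "(\<integral>\<^sup>+x\<in>{1 - \<beta><..<1 - \<alpha>}. ennreal (1 / dist_one x) \<partial>lborel) = ennreal (ln \<beta> - ln \<alpha>)"
    unfolding base[symmetric] using assms
    by (subst nn_integral_real_affine[where t = 1 and c = "- 1"])
       (auto intro!: nn_integral_cong simp: indicator_def dist_one_def)
qed

lemma Lp_norm_ge:
  assumes [measurable]: "w \<in> borel_measurable borel" "h \<in> borel_measurable borel" "A \<in> sets borel"
    and A: "A \<subseteq> {0<..}" and p: "p > 1"
    and h: "\<And>x. x \<in> A \<Longrightarrow> 0 \<le> h x \<and> h x \<le> \<bar>g x\<bar>"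
  shows "ennpowr (\<integral>\<^sup>+x\<in>A. ennreal (h x powr p * w x) \<partial>lborel) (1 / p) \<le> Lp_norm p w g"
  unfolding Lp_norm_def
proof (rule ennpowr_mono)
  let ?D = "density half_line (\<lambda>x. ennreal (w x))"
  have "(\<integral>\<^sup>+x\<in>A. ennreal (h x powr p * w x) \<partial>lborel) = (\<integral>\<^sup>+x. ennreal (w x) * (ennreal (h x powr p) * indicator A x) \<partial>half_line)"
    using A by (subst nn_integral_half_line)
      (auto intro!: nn_integral_cong simp: indicator_def ennreal_mult'' mult.commute)
  also have "\<dots> = (\<integral>\<^sup>+x. ennreal (h x powr p) * indicator A x \<partial>?D)"
    by (rule nn_integral_density[symmetric]) (auto intro: borel_measurable_half_line)
  also have "\<dots> \<le> (\<integral>\<^sup>+x. ennreal (\<bar>g x\<bar> powr p) \<partial>?D)"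
    using h p by (intro nn_integral_mono) (auto simp: indicator_def intro!: ennreal_leI powr_mono2)
  finally show "(\<integral>\<^sup>+x\<in>A. ennreal (h x powr p * w x) \<partial>lborel) \<le> (\<integral>\<^sup>+x. ennreal (\<bar>g x\<bar> powr p) \<partial>?D)" .
qed (use p in simp)

lemma Lp_norm_half_line:
  assumes [measurable]: "w \<in> borel_measurable borel" "f \<in> borel_measurable borel"
  shows "Lp_norm p w f = ennpowr (\<integral>\<^sup>+x\<in>{0<..}. ennreal (\<bar>f x\<bar> powr p * w x) \<partial>lborel) (1 / p)"
proof -
  have "(\<integral>\<^sup>+x. ennreal (\<bar>f x\<bar> powr p) \<partial>density half_line (\<lambda>x. ennreal (w x))) =
      (\<integral>\<^sup>+x. ennreal (w x) * ennreal (\<bar>f x\<bar> powr p) \<partial>half_line)"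
    by (rule nn_integral_density) (auto intro: borel_measurable_half_line)
  also have "\<dots> = (\<integral>\<^sup>+x\<in>{0<..}. ennreal (\<bar>f x\<bar> powr p * w x) \<partial>lborel)"
    by (subst nn_integral_half_line) (auto intro!: nn_integral_cong simp: ennreal_mult'' mult.commute)
  finally show ?thesis by (simp add: Lp_norm_def)
qed

definition test_function :: "real \<Rightarrow> real \<Rightarrow> real \<Rightarrow> real \<Rightarrow> real" where
  "test_function a \<alpha> \<beta> y = indicator {1 + \<alpha><..<1 + \<beta>} y * dist_one y powr (- a)"

lemma borel_measurable_test_function [measurable]: "test_function a \<alpha> \<beta> \<in> borel_measurable borel"
  unfolding test_function_def[abs_def] by measurable

lemma compactly_supported_test_function:
  assumes "0 < \<alpha>"
  shows "compactly_supported (test_function a \<alpha> \<beta>)"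
proof -
  have sub: "closure {x. 0 < x \<and> test_function a \<alpha> \<beta> x \<noteq> 0} \<subseteq> {1 + \<alpha>..1 + \<beta>}"
    by (rule closure_minimal) (auto simp: test_function_def indicator_def split: if_splits)
  then have "bounded (closure {x. 0 < x \<and> test_function a \<alpha> \<beta> x \<noteq> 0})"
    by (rule bounded_subset[rotated]) simp
  then show ?thesis
    using sub assms unfolding compactly_supported_def compact_eq_bounded_closed by auto
qed

text \<open>
  With \<open>s = 1 - x\<close> and \<open>u = y - 1\<close> the kernel is at least \<open>c / (s + u)\<close>, hence at least
  \<open>c / (2 max s u)\<close>. Under the assumption \<open>dom\<close> the product of this with \<open>u\<^bsup>-a\<^esup>\<close> is at least
  \<open>(c/2) s\<^bsup>-a\<^esup> / u\<close>, and the integral of \<open>du / u\<close> over the shell is \<open>L\<close>. Under the assumption \<open>sep\<close> the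
  difference \<open>b(x) - b(y)\<close> has a constant sign and size at least \<open>L\<close>, and as the kernel is positive, the
  commutator gains a second factor \<open>L\<close>.
\<close>

lemma riesz_test_function_ge:
  assumes lam: "lam > - 1 / 2"
    and c: "c > 0" "\<And>x y. 1 / 2 < x \<Longrightarrow> x < 1 \<Longrightarrow> 1 < y \<Longrightarrow> y < 2 \<Longrightarrow> c / (y - x) \<le> kernel_below lam x y"
    and S: "0 < \<alpha>" "\<alpha> < \<beta>" "\<beta> \<le> 1" and L: "L > 0" "ln \<beta> - ln \<alpha> = L"
    and x: "1 / 2 < x" "x < 1" and a: "0 \<le> a"
    and dom: "\<And>u. \<alpha> < u \<Longrightarrow> u < \<beta> \<Longrightarrow> max (1 - x) u \<le> (1 - x) powr a * u powr (1 - a)"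
    and sep: "(\<forall>u. \<alpha> < u \<longrightarrow> u < \<beta> \<longrightarrow> L \<le> ln (1 - x) - ln u) \<or> (\<forall>u. \<alpha> < u \<longrightarrow> u < \<beta> \<longrightarrow> L \<le> ln u - ln (1 - x))"
  shows "c / 4 * L * dist_one x powr (- a) \<le> \<bar>riesz lam (test_function a \<alpha> \<beta>) x\<bar>"
    and "c / 4 * L\<^sup>2 * dist_one x powr (- a) \<le> \<bar>riesz_commutator lam (\<lambda>y. ln (dist_one y)) (test_function a \<alpha> \<beta>) x\<bar>"
proof -
  let ?S = "{1 + \<alpha><..<1 + \<beta>}"
  let ?f = "test_function a \<alpha> \<beta>"
  let ?b = "\<lambda>y. ln (dist_one y)"
  let ?F = "\<lambda>y. kernel_below lam x y * ?f y * y powr (2 * lam)"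
  have u: "dist_one y = y - 1" "\<alpha> < dist_one y" "dist_one y < \<beta>" "1 < y" "y < 2" if "y \<in> ?S" for y
    using that S by (auto simp: dist_one_def)
  have dx: "dist_one x = 1 - x" using x by (simp add: dist_one_def)
  have fbd: "\<bar>?f y\<bar> \<le> \<alpha> powr (- a)" for y
    using S a u(2)[of y] by (auto simp: test_function_def indicator_def intro!: powr_mono2')
  have bfbd: "\<bar>?b y * ?f y\<bar> \<le> \<bar>ln \<alpha>\<bar> * \<alpha> powr (- a)" for y
  proof (cases "y \<in> ?S")
    case True
    have "\<bar>?b y\<bar> \<le> \<bar>ln \<alpha>\<bar>"
    proof -
      have "ln \<alpha> \<le> ?b y" using u(2)[OF True] S by (subst ln_le_cancel_iff) auto
      moreover have "?b y \<le> 0" using u(3)[OF True] S by simp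
      ultimately show ?thesis by linarith
    qed
    then show ?thesis unfolding abs_mult by (intro mult_mono fbd) auto
  qed (simp add: test_function_def)
  have supp: "?f y = 0" if "y \<notin> {1<..<2}" for y
    using that S by (auto simp: test_function_def indicator_def)
  have x0: "0 < x" using x by simp
  have R: "integrable lborel ?F" "riesz lam ?f x = integral\<^sup>L lborel ?F"
    by (rule riesz_off_support[OF lam x0 x(2) borel_measurable_test_function fbd supp]; simp)+
  have F0: "0 \<le> ?F y" for y
  proof (cases "y \<in> ?S")
    case True
    then show ?thesis using u[OF True] x integrable_kernel_below(2)[OF lam x0, of y] by (simp add: test_function_def)
  qed (simp add: test_function_def)
  let ?G = "\<lambda>y. c / 4 * dist_one x powr (- a) * (indicator ?S y * (1 / dist_one y))"
  have GF: "?G y \<le> ?F y" for y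
  proof (cases "y \<in> ?S")
    case True
    define s t where "s = 1 - x" and "t = dist_one y"
    have st: "0 < s" "0 < t" using x by (auto simp: s_def t_def)
    have m: "max s t \<le> s powr a * t powr (1 - a)" unfolding s_def t_def using dom u(2,3)[OF True] by blast
    have "1 / 2 \<le> y powr (- 1)" using u(4,5)[OF True] by (simp add: powr_minus_divide field_simps)
    also have "\<dots> \<le> y powr (2 * lam)" using u(4)[OF True] lam by (intro powr_mono) auto
    finally have y2: "1 / 2 \<le> y powr (2 * lam)" .
    have "s powr (- a) * (1 / t) \<le> t powr (- a) / max s t"
    proof -
      have "s powr (- a) * (1 / t) = t powr (- a) / (s powr a * t powr (1 - a))"
        using st by (simp add: powr_diff powr_minus field_simps)
      also have "\<dots> \<le> t powr (- a) / max s t" using m st by (intro divide_left_mono mult_pos_pos) auto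
      finally show ?thesis .
    qed
    \<comment> \<open>The sum of two numbers is at most twice their maximum.\<close>
    also have "\<dots> = 2 * (t powr (- a) / (2 * max s t))" by simp
    also have "\<dots> \<le> 2 * (t powr (- a) / (s + t))" using st by (intro mult_left_mono divide_left_mono) auto
    finally have "c / 4 * (s powr (- a) * (1 / t)) \<le> c / 4 * (2 * (t powr (- a) / (s + t)))"
      using c by (intro mult_left_mono) auto
    also have "\<dots> = c / (s + t) * t powr (- a) * (1 / 2)" by simp
    also have "\<dots> \<le> kernel_below lam x y * t powr (- a) * y powr (2 * lam)"
    proof (intro mult_mono y2)
      have "s + t = y - x" unfolding s_def t_def u(1)[OF True] by simp
      then show "c / (s + t) \<le> kernel_below lam x y" using c(2)[OF x u(4,5)[OF True]] by simp
    qed (use integrable_kernel_below(2)[OF lam x0, of y] x u[OF True] in auto)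
    finally show ?thesis using True by (simp add: test_function_def s_def t_def dx mult_ac)
  next
    case False
    then show ?thesis using F0[of y] by simp
  qed
  have G: "has_bochner_integral lborel ?G (c / 4 * dist_one x powr (- a) * L)"
  proof (intro has_bochner_integral_mult_right has_bochner_integral_nn_integral)
    have "(\<integral>\<^sup>+y. ennreal (indicator ?S y * (1 / dist_one y)) \<partial>lborel) = (\<integral>\<^sup>+y\<in>?S. ennreal (1 / dist_one y) \<partial>lborel)"
      by (intro nn_integral_cong) (auto simp: indicator_def)
    then show "(\<integral>\<^sup>+y. ennreal (indicator ?S y * (1 / dist_one y)) \<partial>lborel) = ennreal L"
      using nn_integral_inverse_dist_one(1)[OF S(1,2)] L by simp
  qed (use L in \<open>auto simp: less_imp_le\<close>)
  have FL: "c / 4 * L * dist_one x powr (- a) \<le> integral\<^sup>L lborel ?F"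
  proof -
    have "integral\<^sup>L lborel ?G \<le> integral\<^sup>L lborel ?F"
      using G by (intro integral_mono R(1) GF) (auto simp: has_bochner_integral_iff)
    then show ?thesis using G by (simp add: has_bochner_integral_iff mult_ac)
  qed
  then show "c / 4 * L * dist_one x powr (- a) \<le> \<bar>riesz lam ?f x\<bar>" unfolding R(2) by linarith
  note C = riesz_commutator_off_support[OF lam x0 x(2) borel_measurable_test_function _ fbd bfbd supp]
  have C1: "integrable lborel (\<lambda>y. (?b x - ?b y) * ?F y)"
    and C2: "riesz_commutator lam ?b ?f x = (LINT y|lborel. (?b x - ?b y) * ?F y)"
    by (rule C; simp)+
  have "L * integral\<^sup>L lborel ?F \<le> \<bar>riesz_commutator lam ?b ?f x\<bar>"
    using sep
  proof
    assume A: "\<forall>u. \<alpha> < u \<longrightarrow> u < \<beta> \<longrightarrow> L \<le> ln (1 - x) - ln u"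
    have "(LINT y|lborel. L * ?F y) \<le> (LINT y|lborel. (?b x - ?b y) * ?F y)"
    proof (intro integral_mono C1)
      fix y
      show "L * ?F y \<le> (?b x - ?b y) * ?F y"
      proof (cases "y \<in> ?S")
        case True
        then show ?thesis using A u(2,3)[OF True] by (intro mult_right_mono F0) (simp add: dx)
      qed (simp add: test_function_def)
    qed (use R(1) in simp)
    then show ?thesis unfolding C2 by simp
  next
    assume A: "\<forall>u. \<alpha> < u \<longrightarrow> u < \<beta> \<longrightarrow> L \<le> ln u - ln (1 - x)"
    have "(LINT y|lborel. L * ?F y) \<le> (LINT y|lborel. - ((?b x - ?b y) * ?F y))"
    proof (intro integral_mono)
      fix y
      have "L * ?F y \<le> (?b y - ?b x) * ?F y"
      proof (cases "y \<in> ?S")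
        case True
        then show ?thesis using A u(2,3)[OF True] by (intro mult_right_mono F0) (simp add: dx)
      qed (simp add: test_function_def)
      then show "L * ?F y \<le> - ((?b x - ?b y) * ?F y)" by (simp add: algebra_simps)
    qed (use R(1) C1 in auto)
    then show ?thesis unfolding C2 by simp
  qed
  moreover have "L * (c / 4 * L * dist_one x powr (- a)) \<le> L * integral\<^sup>L lborel ?F"
    using FL L by (intro mult_left_mono) auto
  ultimately show "c / 4 * L\<^sup>2 * dist_one x powr (- a) \<le> \<bar>riesz_commutator lam ?b ?f x\<bar>"
    by (simp add: power2_eq_square mult_ac)
qed

text \<open>
  An exponent of size at most \<open>p / L\<close> changes a distance in \<open>[exp (- 4 L), 1]\<close> to a number between
  \<open>exp (- 4 p)\<close> and \<open>exp (4 p)\<close>, uniformly in \<open>L\<close>. So on these scales \<open>\<bar>x - 1\<bar>\<^bsup>-a p\<^esup> w(x)\<close> may be treated as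
  if the exponent of \<open>\<bar>x - 1\<bar>\<close> were exactly the critical value \<open>-1\<close>.
\<close>

lemma power_weight_two_sided:
  fixes lam p L x \<sigma> a :: real
  assumes p: "p > 1" and L: "L > 0" and x: "1 / 2 \<le> x" "x \<le> 2"
    and d: "exp (- 4 * L) \<le> dist_one x" "dist_one x \<le> 1" and \<sigma>: "\<bar>\<sigma> - a * p + 1\<bar> \<le> p / L"
  defines "M \<equiv> 2 powr \<bar>2 * lam + 1 - p\<bar> * exp (4 * p)"
  shows "1 / M * (1 / dist_one x) \<le> dist_one x powr (- a * p) * power_weight lam p \<sigma> x"
    and "dist_one x powr (- a * p) * power_weight lam p \<sigma> x \<le> M * (1 / dist_one x)"
proof -
  define \<rho> where "\<rho> = \<sigma> - a * p + 1"
  have e: "dist_one x powr (- a * p) * power_weight lam p \<sigma> x =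
      x powr (2 * lam + 1 - p) * dist_one x powr \<rho> * (1 / dist_one x)"
  proof -
    have "dist_one x powr (- a * p) * dist_one x powr \<sigma> = dist_one x powr (\<rho> - 1)"
      by (simp add: powr_add[symmetric] \<rho>_def)
    also have "\<dots> = dist_one x powr \<rho> * (1 / dist_one x)" by (simp add: powr_diff less_imp_le)
    finally have k: "dist_one x powr (- a * p) * dist_one x powr \<sigma> = dist_one x powr \<rho> * (1 / dist_one x)" .
    have "dist_one x powr (- a * p) * power_weight lam p \<sigma> x =
        x powr (2 * lam + 1 - p) * (dist_one x powr (- a * p) * dist_one x powr \<sigma>)"
      by (simp only: power_weight_def mult_ac)
    then show ?thesis unfolding k by (simp only: mult.assoc)
  qed
  have "\<bar>ln (dist_one x)\<bar> \<le> 4 * L"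
  proof -
    have "- 4 * L \<le> ln (dist_one x)" using d by (simp add: ln_ge_iff)
    moreover have "ln (dist_one x) \<le> 0" using d by simp
    ultimately show ?thesis by linarith
  qed
  then have "\<bar>\<rho> * ln (dist_one x)\<bar> \<le> p / L * (4 * L)"
    unfolding abs_mult using \<sigma> by (intro mult_mono) (auto simp: \<rho>_def)
  then have "\<bar>\<rho> * ln (dist_one x)\<bar> \<le> 4 * p" using L by simp
  then have r: "exp (- (4 * p)) \<le> dist_one x powr \<rho>" "dist_one x powr \<rho> \<le> exp (4 * p)"
    by (auto simp: powr_def)
  have q: "2 powr (- \<bar>2 * lam + 1 - p\<bar>) \<le> x powr (2 * lam + 1 - p)" "x powr (2 * lam + 1 - p) \<le> 2 powr \<bar>2 * lam + 1 - p\<bar>"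
    using x by (auto intro!: powr_two_sided)
  have "1 / M = 2 powr (- \<bar>2 * lam + 1 - p\<bar>) * exp (- (4 * p))"
    by (simp add: M_def powr_minus exp_minus field_simps)
  also have "\<dots> \<le> x powr (2 * lam + 1 - p) * dist_one x powr \<rho>" by (intro mult_mono q r) auto
  finally show "1 / M * (1 / dist_one x) \<le> dist_one x powr (- a * p) * power_weight lam p \<sigma> x"
    unfolding e by (intro mult_right_mono) (auto simp: less_imp_le)
  have "x powr (2 * lam + 1 - p) * dist_one x powr \<rho> \<le> M" unfolding M_def by (intro mult_mono q r) auto
  then show "dist_one x powr (- a * p) * power_weight lam p \<sigma> x \<le> M * (1 / dist_one x)"
    unfolding e by (intro mult_right_mono) (auto simp: less_imp_le)
qed

lemma Lp_norm_test_function_le: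
  assumes p: "p > 1" and L: "L > 0" "ln \<beta> - ln \<alpha> = L" and S: "exp (- 4 * L) \<le> \<alpha>" "\<alpha> < \<beta>" "\<beta> \<le> 1"
    and \<sigma>: "\<bar>\<sigma> - a * p + 1\<bar> \<le> p / L"
  shows "Lp_norm p (power_weight lam p \<sigma>) (test_function a \<alpha> \<beta>) \<le>
    ennreal ((2 powr \<bar>2 * lam + 1 - p\<bar> * exp (4 * p) * L) powr (1 / p))"
proof -
  define M where "M = 2 powr \<bar>2 * lam + 1 - p\<bar> * exp (4 * p)"
  have M: "M > 0" by (simp add: M_def)
  have \<alpha>: "\<alpha> > 0" using S(1) exp_gt_zero[of "- 4 * L"] by linarith
  let ?S = "{1 + \<alpha><..<1 + \<beta>}"
  have "(\<integral>\<^sup>+x\<in>{0<..}. ennreal (\<bar>test_function a \<alpha> \<beta> x\<bar> powr p * power_weight lam p \<sigma> x) \<partial>lborel) \<le>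
      (\<integral>\<^sup>+x. ennreal M * (ennreal (1 / dist_one x) * indicator ?S x) \<partial>lborel)"
  proof (intro nn_integral_mono)
    fix x
    show "ennreal (\<bar>test_function a \<alpha> \<beta> x\<bar> powr p * power_weight lam p \<sigma> x) * indicator {0<..} x \<le>
        ennreal M * (ennreal (1 / dist_one x) * indicator ?S x)"
    proof (cases "x \<in> ?S")
      case True
      then have "dist_one x powr (- a * p) * power_weight lam p \<sigma> x \<le> M * (1 / dist_one x)"
        unfolding M_def using S \<alpha>
        by (intro power_weight_two_sided[OF p L(1) _ _ _ _ \<sigma>]) (auto simp: dist_one_def)
      then show ?thesis
        using True M \<alpha> by (simp add: test_function_def powr_powr ennreal_mult''[symmetric] ennreal_leI)
    qed (simp add: test_function_def)
  qed
  also have "\<dots> = ennreal M * ennreal L"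
    using nn_integral_inverse_dist_one(1)[OF \<alpha> S(2)] L by (subst nn_integral_cmult) auto
  also have "\<dots> = ennreal (M * L)" using M L by (simp add: ennreal_mult)
  finally have "Lp_norm p (power_weight lam p \<sigma>) (test_function a \<alpha> \<beta>) \<le> ennpowr (ennreal (M * L)) (1 / p)"
    using p by (subst Lp_norm_half_line) (auto intro!: ennpowr_mono)
  then show ?thesis using M L by (simp add: ennpowr_ennreal M_def)
qed

lemma Lp_norm_ge_power:
  assumes p: "p > 1" and L: "L > 0" "ln \<beta> - ln \<alpha> = L" and T: "exp (- 4 * L) \<le> \<alpha>" "\<alpha> < \<beta>" "\<beta> \<le> 1 / 2"
    and \<sigma>: "\<bar>\<sigma> - a * p + 1\<bar> \<le> p / L" and A: "A \<ge> 0"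
    and g: "\<And>x. 1 - \<beta> < x \<Longrightarrow> x < 1 - \<alpha> \<Longrightarrow> A * dist_one x powr (- a) \<le> \<bar>g x\<bar>"
  shows "ennreal (A * (1 / (2 powr \<bar>2 * lam + 1 - p\<bar> * exp (4 * p)) * L) powr (1 / p)) \<le> Lp_norm p (power_weight lam p \<sigma>) g"
proof -
  define M where "M = 2 powr \<bar>2 * lam + 1 - p\<bar> * exp (4 * p)"
  have M: "M > 0" by (simp add: M_def)
  have \<alpha>: "\<alpha> > 0" using T(1) exp_gt_zero[of "- 4 * L"] by linarith
  let ?T = "{1 - \<beta><..<1 - \<alpha>}"
  have "ennreal (A powr p * (1 / M * L)) = ennreal (A powr p / M) * (\<integral>\<^sup>+x\<in>?T. ennreal (1 / dist_one x) \<partial>lborel)"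
    unfolding nn_integral_inverse_dist_one(2)[OF \<alpha> T(2)] using M L by (simp add: ennreal_mult[symmetric])
  also have "\<dots> = (\<integral>\<^sup>+x. ennreal (A powr p / M) * (ennreal (1 / dist_one x) * indicator ?T x) \<partial>lborel)"
    by (intro nn_integral_cmult[symmetric]) auto
  also have "\<dots> \<le> (\<integral>\<^sup>+x\<in>?T. ennreal ((A * dist_one x powr (- a)) powr p * power_weight lam p \<sigma> x) \<partial>lborel)"
  proof (intro nn_integral_mono)
    fix x
    show "ennreal (A powr p / M) * (ennreal (1 / dist_one x) * indicator ?T x) \<le>
        ennreal ((A * dist_one x powr (- a)) powr p * power_weight lam p \<sigma> x) * indicator ?T x"
    proof (cases "x \<in> ?T")
      case True
      then have "1 / M * (1 / dist_one x) \<le> dist_one x powr (- a * p) * power_weight lam p \<sigma> x"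
        unfolding M_def using T \<alpha>
        by (intro power_weight_two_sided[OF p L(1) _ _ _ _ \<sigma>]) (auto simp: dist_one_def)
      from mult_left_mono[OF this, of "A powr p"]
      have "A powr p / M * (1 / dist_one x) \<le> (A * dist_one x powr (- a)) powr p * power_weight lam p \<sigma> x"
        using A by (simp add: powr_mult powr_powr mult.assoc)
      then show ?thesis
        using True M by (simp add: ennreal_mult''[symmetric] less_imp_le del: times_divide_eq_right divide_divide_eq_left) (auto intro!: ennreal_leI)
    qed simp
  qed
  finally have "ennpowr (ennreal (A powr p * (1 / M * L))) (1 / p) \<le>
      ennpowr (\<integral>\<^sup>+x\<in>?T. ennreal ((A * dist_one x powr (- a)) powr p * power_weight lam p \<sigma> x) \<partial>lborel) (1 / p)"
    using p by (intro ennpowr_mono) auto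
  also have "\<dots> \<le> Lp_norm p (power_weight lam p \<sigma>) g"
    using T \<alpha> A p g by (intro Lp_norm_ge) auto
  also have "ennpowr (ennreal (A powr p * (1 / M * L))) (1 / p) = ennreal ((A powr p * (1 / M * L)) powr (1 / p))"
    using M L(1) by (intro ennpowr_ennreal) auto
  also have "(A powr p * (1 / M * L)) powr (1 / p) = (A powr p) powr (1 / p) * (1 / M * L) powr (1 / p)"
    by (rule powr_mult)
  also have "(A powr p) powr (1 / p) = A" using A p by (simp add: powr_powr)
  finally show ?thesis unfolding M_def .
qed

text \<open>
  The shells at the scales \<open>exp (- i L)\<close> and \<open>exp (- j L)\<close> have logarithmic length \<open>L\<close>, and there is a
  gap of length \<open>L\<close> between them. For \<open>a = 1\<close> the function lives on the inner shell and its image is measured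
  on the outer one, where \<open>f\<close> acts like a point mass at 1; for \<open>a = 0\<close> the roles are exchanged
  and the image picks up a logarithm.
\<close>

lemma sharpness_test:
  fixes lam p a \<sigma> L i j :: real
  assumes lam: "lam > - 1 / 2" and p: "p > 1"
    and c: "c > 0" "\<And>x y. 1 / 2 < x \<Longrightarrow> x < 1 \<Longrightarrow> 1 < y \<Longrightarrow> y < 2 \<Longrightarrow> c / (y - x) \<le> kernel_below lam x y"
    and L: "L \<ge> 1" and \<sigma>: "\<bar>\<sigma> - a * p + 1\<bar> \<le> p / L"
    and case_ij: "(a = 1 \<and> i = 3 \<and> j = 1) \<or> (a = 0 \<and> i = 1 \<and> j = 3)"
  defines "M \<equiv> 2 powr \<bar>2 * lam + 1 - p\<bar> * exp (4 * p)"
    and "f \<equiv> test_function a (exp (- (i + 1) * L)) (exp (- i * L))"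
  shows "Lp_norm p (power_weight lam p \<sigma>) f \<le> ennreal ((M * L) powr (1 / p))"
    and "ennreal (c / 4 * L * (1 / M * L) powr (1 / p)) \<le> Lp_norm p (power_weight lam p \<sigma>) (riesz lam f)"
    and "ennreal (c / 4 * L\<^sup>2 * (1 / M * L) powr (1 / p)) \<le>
      Lp_norm p (power_weight lam p \<sigma>) (riesz_commutator lam (\<lambda>y. ln (dist_one y)) f)"
proof -
  let ?\<alpha> = "exp (- (i + 1) * L)" and ?\<beta> = "exp (- i * L)"
  let ?\<alpha>' = "exp (- (j + 1) * L)" and ?\<beta>' = "exp (- j * L)"
  have ij: "1 \<le> i" "i \<le> 3" "1 \<le> j" "j \<le> 3" using case_ij by auto
  have L0: "L > 0" using L by simp
  have lens: "ln ?\<beta> - ln ?\<alpha> = L" "ln ?\<beta>' - ln ?\<alpha>' = L" by (simp_all add: algebra_simps)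
  have ijL: "i * L \<le> 3 * L" "j * L \<le> 3 * L" "0 \<le> i * L" using ij L0 by auto
  have S: "exp (- 4 * L) \<le> ?\<alpha>" "?\<alpha> < ?\<beta>" "?\<beta> \<le> 1" using ijL L0 by (simp_all add: algebra_simps)
  have T: "exp (- 4 * L) \<le> ?\<alpha>'" "?\<alpha>' < ?\<beta>'" using ijL L0 by (simp_all add: algebra_simps)
  have half: "?\<beta>' \<le> 1 / 2"
  proof -
    have "1 * 1 \<le> j * L" using ij L by (intro mult_mono) auto
    then have "?\<beta>' \<le> exp (- 1)" by simp
    also have "\<dots> \<le> 1 / 2" using exp_ge_add_one_self[of 1] by (simp add: exp_minus field_simps)
    finally show ?thesis .
  qed
  show "Lp_norm p (power_weight lam p \<sigma>) f \<le> ennreal ((M * L) powr (1 / p))"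
    unfolding f_def M_def by (rule Lp_norm_test_function_le[OF p L0 lens(1) S \<sigma>])
  have pt: "c / 4 * L * dist_one x powr (- a) \<le> \<bar>riesz lam f x\<bar>"
      "c / 4 * L\<^sup>2 * dist_one x powr (- a) \<le> \<bar>riesz_commutator lam (\<lambda>y. ln (dist_one y)) f x\<bar>"
    if x: "1 - ?\<beta>' < x" "x < 1 - ?\<alpha>'" for x
  proof -
    have s: "?\<alpha>' < 1 - x" "1 - x < ?\<beta>'" using x by auto
    have s0: "0 < 1 - x" using s(1) exp_gt_zero[of "- (j + 1) * L"] by linarith
    have lns: "- (j + 1) * L < ln (1 - x)" "ln (1 - x) < - j * L"
      using s s0 ln_less_cancel_iff[of ?\<alpha>' "1 - x"] ln_less_cancel_iff[of "1 - x" ?\<beta>'] by auto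
    have lnu: "0 < u" "- (i + 1) * L < ln u" "ln u < - i * L" if "?\<alpha> < u" "u < ?\<beta>" for u
    proof -
      show "0 < u" using that(1) exp_gt_zero[of "- (i + 1) * L"] by linarith
      then show "- (i + 1) * L < ln u" "ln u < - i * L"
        using that ln_less_cancel_iff[of ?\<alpha> u] ln_less_cancel_iff[of u ?\<beta>] by auto
    qed
    have dom: "max (1 - x) u \<le> (1 - x) powr a * u powr (1 - a)" if u: "?\<alpha> < u" "u < ?\<beta>" for u
      using case_ij
    proof
      assume "a = 1 \<and> i = 3 \<and> j = 1"
      then have "ln u < ln (1 - x)" using lns lnu[OF u] L0 by (auto simp: algebra_simps)
      then show ?thesis using s0 lnu(1)[OF u] \<open>a = 1 \<and> _\<close> by simp
    next
      assume "a = 0 \<and> i = 1 \<and> j = 3"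
      then have "ln (1 - x) < ln u" using lns lnu[OF u] L0 by (auto simp: algebra_simps)
      then show ?thesis using s0 lnu(1)[OF u] \<open>a = 0 \<and> _\<close> by simp
    qed
    have sep: "(\<forall>u. ?\<alpha> < u \<longrightarrow> u < ?\<beta> \<longrightarrow> L \<le> ln (1 - x) - ln u) \<or>
        (\<forall>u. ?\<alpha> < u \<longrightarrow> u < ?\<beta> \<longrightarrow> L \<le> ln u - ln (1 - x))"
      using case_ij
    proof
      assume A: "a = 1 \<and> i = 3 \<and> j = 1"
      have "L \<le> ln (1 - x) - ln u" if "?\<alpha> < u" "u < ?\<beta>" for u
        using lns(1) lnu(3)[OF that] A by (auto simp: algebra_simps)
      then show ?thesis by blast
    next
      assume A: "a = 0 \<and> i = 1 \<and> j = 3"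
      have "L \<le> ln u - ln (1 - x)" if "?\<alpha> < u" "u < ?\<beta>" for u
        using lns(2) lnu(2)[OF that] A by (auto simp: algebra_simps)
      then show ?thesis by blast
    qed
    have x': "1 / 2 < x" "x < 1" using s(2) half s0 by linarith+
    have a: "0 \<le> a" using case_ij by auto
    note R = riesz_test_function_ge[OF lam c exp_gt_zero S(2,3) L0 lens(1) x' a dom sep]
    show "c / 4 * L * dist_one x powr (- a) \<le> \<bar>riesz lam f x\<bar>"
      unfolding f_def by (rule R(1))
    show "c / 4 * L\<^sup>2 * dist_one x powr (- a) \<le> \<bar>riesz_commutator lam (\<lambda>y. ln (dist_one y)) f x\<bar>"
      unfolding f_def by (rule R(2))
  qed
  show "ennreal (c / 4 * L * (1 / M * L) powr (1 / p)) \<le> Lp_norm p (power_weight lam p \<sigma>) (riesz lam f)"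
    unfolding M_def using c L0 pt(1)
    by (intro Lp_norm_ge_power[OF p L0 lens(2) T half \<sigma>]) auto
  show "ennreal (c / 4 * L\<^sup>2 * (1 / M * L) powr (1 / p)) \<le>
      Lp_norm p (power_weight lam p \<sigma>) (riesz_commutator lam (\<lambda>y. ln (dist_one y)) f)"
    unfolding M_def using c L0 pt(2)
    by (intro Lp_norm_ge_power[OF p L0 lens(2) T half \<sigma>]) auto
qed

section \<open>Comparison of exponents\<close>

text \<open>
  Let \<open>L\<close> tend to infinity. The lower bound \<open>\<kappa>\<close> takes care of negative \<open>\<theta>\<close>.
\<close>

lemma exponent_lower_bound:
  fixes A :: "real \<Rightarrow> real"
  assumes "k > 0" "q > 0" "c > 0"
    and A: "\<And>L. L \<ge> 1 \<Longrightarrow> \<kappa> \<le> A L \<and> A L \<le> K * L powr q" "\<kappa> > 0"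
    and est: "\<And>L. L \<ge> 1 \<Longrightarrow> c * L powr k \<le> C * A L powr \<theta>"
  shows "k / q \<le> \<theta>"
proof (rule ccontr)
  assume "\<not> k / q \<le> \<theta>"
  then have lt: "q * \<theta> < k" using \<open>q > 0\<close> by (simp add: field_simps)
  have K: "K > 0" using A(1)[of 1] A(2) by simp
  have "c * 1 powr k \<le> C * A 1 powr \<theta>" using est[of 1] by simp
  then have "0 < C * A 1 powr \<theta>" using \<open>c > 0\<close> by simp
  then have C: "C > 0" by (simp add: zero_less_mult_iff)
  \<comment> \<open>Up to a constant, the power of A L is at most the power e of L, for either sign of the exponent.\<close>
  define e where "e = max 0 (q * \<theta>)"
  have e: "e < k" using lt \<open>k > 0\<close> by (simp add: e_def)
  define B where "B = C * max (K powr \<theta>) (\<kappa> powr \<theta>)"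
  have bound: "c * L powr (k - e) \<le> B" if L: "L \<ge> 1" for L
  proof -
    have "A L powr \<theta> \<le> max (K powr \<theta>) (\<kappa> powr \<theta>) * L powr e"
    proof (cases "\<theta> \<ge> 0")
      case True
      have "A L powr \<theta> \<le> (K * L powr q) powr \<theta>"
        using A(1)[OF L] A(2) True by (intro powr_mono2) auto
      also have "\<dots> = K powr \<theta> * L powr e"
        using K L True \<open>q > 0\<close> by (simp add: powr_mult powr_powr e_def)
      also have "\<dots> \<le> max (K powr \<theta>) (\<kappa> powr \<theta>) * L powr e" by (intro mult_right_mono) auto
      finally show ?thesis .
    next
      case False
      have "A L powr \<theta> \<le> \<kappa> powr \<theta>" using A(1)[OF L] A(2) False by (intro powr_mono2') auto
      moreover have "e = 0" using False \<open>q > 0\<close> by (simp add: e_def mult_le_0_iff)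
      ultimately show ?thesis using L by simp
    qed
    then have "C * A L powr \<theta> \<le> B * L powr e"
      unfolding B_def using C by (simp add: mult.assoc mult_left_mono)
    then have "c * L powr k \<le> B * L powr e" using est[OF L] by linarith
    then have "c * L powr k / L powr e \<le> B" using L by (simp add: divide_le_eq)
    then show ?thesis by (simp add: powr_diff)
  qed
  have B: "B > 0" unfolding B_def using C A(2) by (intro mult_pos_pos) (auto simp: less_max_iff_disj)
  \<comment> \<open>Large enough to violate the bound.\<close>
  define L where "L = max 1 ((B / c + 1) powr (1 / (k - e)))"
  have "B / c + 1 = ((B / c + 1) powr (1 / (k - e))) powr (k - e)"
    using B \<open>c > 0\<close> e by (simp add: powr_powr add_pos_pos less_imp_le)
  also have "\<dots> \<le> L powr (k - e)" using e by (intro powr_mono2) (auto simp: L_def)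
  finally have "B < c * L powr (k - e)" using \<open>c > 0\<close> by (simp add: field_simps)
  then show False using bound[of L] by (simp add: L_def)
qed

text \<open>
  In both families one of the two averages degenerates like \<open>L\<close>. In the first one it is the average of
  \<open>w\<^bsup>-1/(p-1)\<^esup>\<close>, which enters with the power \<open>p - 1\<close>; in the second one it is the average of \<open>w\<close> itself.
\<close>

lemma power_weight_extremal:
  fixes lam p L :: real
  assumes lam: "lam > - 1 / 2" and p: "p > 1" and L: "L \<ge> 1"
    and \<sigma>: "(\<sigma> = (p - 1) * (1 - 1 / L) \<and> q = p - 1) \<or> (\<sigma> = - (1 - 1 / L) \<and> q = 1)"
  shows "power_weight lam p \<sigma> \<in> AK_class lam p"
    and "2 powr (- 2 * p) \<le> enn2real (AK_const lam p (power_weight lam p \<sigma>))"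
    and "enn2real (AK_const lam p (power_weight lam p \<sigma>)) \<le> 2 powr ((2 * lam + 3) * p) * L powr q"
proof -
  have l: "0 \<le> 1 - 1 / L" "1 - 1 / L < 1" "1 - 1 / L \<le> 1" using L by auto
  have "- 1 < \<sigma> \<and> \<sigma> < p - 1 \<and> \<bar>\<sigma>\<bar> \<le> p \<and>
      max 1 (1 / (1 + \<sigma>)) * max 1 (1 / (1 - \<sigma> / (p - 1))) powr (p - 1) = L powr q"
    using \<sigma>
  proof
    assume A: "\<sigma> = (p - 1) * (1 - 1 / L) \<and> q = p - 1"
    have n: "0 \<le> \<sigma>" "\<sigma> \<le> (p - 1) * 1" unfolding A[THEN conjunct1] using p l by (auto intro!: mult_nonneg_nonneg mult_left_mono)
    have "\<sigma> < (p - 1) * 1" unfolding A[THEN conjunct1] using p l by (intro mult_strict_left_mono) auto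
    moreover have "\<sigma> / (p - 1) = 1 - 1 / L" using A p by simp
    then have "max 1 (1 / (1 - \<sigma> / (p - 1))) = L" using L by (simp add: max_def)
    moreover have "max 1 (1 / (1 + \<sigma>)) = 1" using n by (simp add: max_def)
    ultimately show ?thesis using n conjunct2[OF A] p by auto
  next
    assume A: "\<sigma> = - (1 - 1 / L) \<and> q = 1"
    then have "\<sigma> \<le> 0" "- 1 < \<sigma>" using l L by auto
    then have "\<sigma> / (p - 1) \<le> 0" using p by (simp add: divide_nonpos_pos)
    then have "max 1 (1 / (1 - \<sigma> / (p - 1))) = 1" by (simp add: divide_le_eq_1 max_def)
    moreover have "1 / (1 + \<sigma>) = L" using A L by simp
    then have "max 1 (1 / (1 + \<sigma>)) = L" using L by (simp add: max_def)
    ultimately show ?thesis using conjunct2[OF A] L p \<open>\<sigma> \<le> 0\<close> \<open>- 1 < \<sigma>\<close> by auto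
  qed
  then have s: "- 1 < \<sigma>" "\<sigma> < p - 1" "\<bar>\<sigma>\<bar> \<le> p"
    and e: "max 1 (1 / (1 + \<sigma>)) * max 1 (1 / (1 - \<sigma> / (p - 1))) powr (p - 1) = L powr q" by auto
  let ?A = "AK_const lam p (power_weight lam p \<sigma>)"
  have up: "?A \<le> ennreal (2 powr ((2 * lam + 3) * p) * L powr q)"
    using AK_const_power_weight_le[OF lam p s(1,2)] unfolding mult.assoc e .
  then have fin: "?A < top" by (rule le_less_trans) simp
  then show "power_weight lam p \<sigma> \<in> AK_class lam p"
    by (simp add: AK_class_def weight_power_weight)
  show "enn2real ?A \<le> 2 powr ((2 * lam + 3) * p) * L powr q"
    using enn2real_mono[OF up] by simp
  have "2 powr (- 2 * p) \<le> (2::real) powr (- 2 * \<bar>\<sigma>\<bar>)" using s(3) by simp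
  also have "\<dots> \<le> enn2real ?A"
    using enn2real_mono[OF AK_const_power_weight_ge[OF lam p, of \<sigma>] fin] by simp
  finally show "2 powr (- 2 * p) \<le> enn2real ?A" .
qed

text \<open>
  The norms of \<open>f\<close> and of its image share the factor \<open>L\<^bsup>1/p\<^esup>\<close>; what remains is one power of \<open>L\<close> for the
  transform, two for the commutator, against the \<open>\<theta>\<close>-th or \<open>\<delta>\<close>-th power of a constant of size at most
  \<open>L\<^sup>q\<close>.
\<close>

lemma sharp_exponents:
  fixes lam p q :: real
  assumes lam: "lam > - 1 / 2" and p: "p > 1" and q: "q = p - 1 \<or> q = 1"
  shows "(C \<ge> 0 \<Longrightarrow> (\<And>w f. w \<in> AK_class lam p \<Longrightarrow> f \<in> Lp_space p w \<Longrightarrow> compactly_supported f \<Longrightarrow>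
      Lp_norm p w (riesz lam f) \<le> ennreal (C * enn2real (AK_const lam p w) powr \<theta>) * Lp_norm p w f) \<Longrightarrow> 1 / q \<le> \<theta>)"
    and "(C \<ge> 0 \<Longrightarrow> (\<And>w f b. w \<in> AK_class lam p \<Longrightarrow> f \<in> Lp_space p w \<Longrightarrow> b \<in> BMO lam \<Longrightarrow> compactly_supported f \<Longrightarrow>
      Lp_norm p w (riesz_commutator lam b f) \<le>
        ennreal C * BMO_norm lam b * ennreal (enn2real (AK_const lam p w) powr \<delta>) * Lp_norm p w f) \<Longrightarrow> 2 / q \<le> \<delta>)"
proof -
  obtain c where c: "c > 0"
    "\<And>x y. 1 / 2 < x \<Longrightarrow> x < 1 \<Longrightarrow> 1 < y \<Longrightarrow> y < 2 \<Longrightarrow> c / (y - x) \<le> kernel_below lam x y"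
    using kernel_below_lower_bound[OF lam] by blast
  obtain a i j :: real where aij: "(a = 1 \<and> i = 3 \<and> j = 1 \<and> q = p - 1) \<or> (a = 0 \<and> i = 1 \<and> j = 3 \<and> q = 1)"
    using q by metis
  define \<sigma> where "\<sigma> L = (if a = 1 then (p - 1) * (1 - 1 / L) else - (1 - 1 / L))" for L :: real
  have \<sigma>: "(\<sigma> L = (p - 1) * (1 - 1 / L) \<and> q = p - 1) \<or> (\<sigma> L = - (1 - 1 / L) \<and> q = 1)" for L
    using aij by (auto simp: \<sigma>_def)
  have case_ij: "(a = 1 \<and> i = 3 \<and> j = 1) \<or> (a = 0 \<and> i = 1 \<and> j = 3)" using aij by auto
  have \<sigma>': "\<bar>\<sigma> L - a * p + 1\<bar> \<le> p / L" if "L \<ge> 1" for L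
    using case_ij
  proof
    assume A: "a = 1 \<and> i = 3 \<and> j = 1"
    then have "\<sigma> L - a * p + 1 = - ((p - 1) / L)" by (simp add: \<sigma>_def right_diff_distrib)
    then show ?thesis using p that by (simp add: divide_right_mono)
  next
    assume A: "a = 0 \<and> i = 1 \<and> j = 3"
    then have "\<sigma> L - a * p + 1 = 1 / L" by (simp add: \<sigma>_def)
    then show ?thesis using p that by (simp add: divide_right_mono)
  qed
  have q0: "q > 0" using q p by auto
  define M where "M = 2 powr \<bar>2 * lam + 1 - p\<bar> * exp (4 * p)"
  have M: "M > 0" by (simp add: M_def)
  define w where "w L = power_weight lam p (\<sigma> L)" for L
  define f where "f L = test_function a (exp (- (i + 1) * L)) (exp (- i * L))" for L
  define A where "A L = enn2real (AK_const lam p (w L))" for L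
  have A: "2 powr (- 2 * p) \<le> A L \<and> A L \<le> 2 powr ((2 * lam + 3) * p) * L powr q" if "L \<ge> 1" for L
    unfolding A_def w_def using power_weight_extremal(2,3)[OF lam p that \<sigma>] by blast
  have w: "w L \<in> AK_class lam p" if "L \<ge> 1" for L
    unfolding w_def by (rule power_weight_extremal(1)[OF lam p that \<sigma>])
  have f: "Lp_norm p (w L) (f L) \<le> ennreal ((M * L) powr (1 / p))"
    "ennreal (c / 4 * L * (1 / M * L) powr (1 / p)) \<le> Lp_norm p (w L) (riesz lam (f L))"
    "ennreal (c / 4 * L\<^sup>2 * (1 / M * L) powr (1 / p)) \<le> Lp_norm p (w L) (riesz_commutator lam (\<lambda>y. ln (dist_one y)) (f L))"
    if "L \<ge> 1" for L
    unfolding w_def f_def M_def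
    subgoal by (rule sharpness_test(1)[OF lam p c that \<sigma>'[OF that] case_ij])
    subgoal by (rule sharpness_test(2)[OF lam p c that \<sigma>'[OF that] case_ij])
    subgoal by (rule sharpness_test(3)[OF lam p c that \<sigma>'[OF that] case_ij])
    done
  have fL: "f L \<in> Lp_space p (w L)" "compactly_supported (f L)" if "L \<ge> 1" for L
  proof -
    have "Lp_norm p (w L) (f L) < \<infinity>" using f(1)[OF that] by (rule le_less_trans) simp
    then show "f L \<in> Lp_space p (w L)" by (simp add: Lp_space_def f_def borel_measurable_half_line)
    show "compactly_supported (f L)" unfolding f_def by (rule compactly_supported_test_function) simp
  qed
  \<comment> \<open>What is left of the constants after division by the common power of L.\<close>
  define c' where "c' = c / 4 * ((1 / M) powr (1 / p) / M powr (1 / p))"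
  have c': "c' > 0" using c M by (simp add: c'_def)
  have reduce: "c' * L powr k \<le> D"
    if L: "L \<ge> 1" and le: "ennreal (c / 4 * L powr k * (1 / M * L) powr (1 / p)) \<le> ennreal D * Lp_norm p (w L) (f L)" and D: "D \<ge> 0"
    for L k D
  proof -
    have "ennreal (c / 4 * L powr k * (1 / M * L) powr (1 / p)) \<le> ennreal D * ennreal ((M * L) powr (1 / p))"
      using le by (rule order_trans) (intro mult_left_mono f(1)[OF L], simp)
    also have "\<dots> = ennreal (D * (M * L) powr (1 / p))" using D by (simp add: ennreal_mult)
    finally have "c / 4 * L powr k * (1 / M * L) powr (1 / p) \<le> D * (M * L) powr (1 / p)"
      using D by (simp add: ennreal_le_iff)
    moreover have "(1 / M * L) powr (1 / p) = (1 / M) powr (1 / p) * L powr (1 / p)"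
      by (rule powr_mult)
    moreover have "(M * L) powr (1 / p) = M powr (1 / p) * L powr (1 / p)"
      by (rule powr_mult)
    ultimately have "(c / 4 * L powr k * (1 / M) powr (1 / p)) * L powr (1 / p) \<le> (D * M powr (1 / p)) * L powr (1 / p)"
      by (simp only: mult.assoc)
    then have "c / 4 * L powr k * (1 / M) powr (1 / p) \<le> D * M powr (1 / p)"
      using L by (subst (asm) mult_le_cancel_right_pos) auto
    then have "c / 4 * L powr k * (1 / M) powr (1 / p) / M powr (1 / p) \<le> D"
      using M by (simp add: divide_le_eq)
    then show ?thesis by (simp add: c'_def mult_ac)
  qed
  show "1 / q \<le> \<theta>" if C: "C \<ge> 0" and est: "\<And>w f. w \<in> AK_class lam p \<Longrightarrow> f \<in> Lp_space p w \<Longrightarrow> compactly_supported f \<Longrightarrow>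
      Lp_norm p w (riesz lam f) \<le> ennreal (C * enn2real (AK_const lam p w) powr \<theta>) * Lp_norm p w f"
  proof (rule exponent_lower_bound[OF _ q0 c' A])
    fix L :: real assume L: "L \<ge> 1"
    have "ennreal (c / 4 * L powr 1 * (1 / M * L) powr (1 / p)) \<le> Lp_norm p (w L) (riesz lam (f L))"
      using f(2)[OF L] L by simp
    also have "\<dots> \<le> ennreal (C * A L powr \<theta>) * Lp_norm p (w L) (f L)"
      unfolding A_def by (rule est[OF w[OF L] fL[OF L]])
    finally show "c' * L powr 1 \<le> C * A L powr \<theta>" using C by (intro reduce[OF L]) auto
  qed auto
  show "2 / q \<le> \<delta>" if C: "C \<ge> 0" and est: "\<And>w f b. w \<in> AK_class lam p \<Longrightarrow> f \<in> Lp_space p w \<Longrightarrow> b \<in> BMO lam \<Longrightarrow> compactly_supported f \<Longrightarrow>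
      Lp_norm p w (riesz_commutator lam b f) \<le>
        ennreal C * BMO_norm lam b * ennreal (enn2real (AK_const lam p w) powr \<delta>) * Lp_norm p w f"
  proof (rule exponent_lower_bound[OF _ q0 c' A])
    fix L :: real assume L: "L \<ge> 1"
    let ?b = "\<lambda>y. ln (dist_one y)" and ?B = "2 powr (2 * lam + 6) :: real"
    have "ennreal (c / 4 * L powr 2 * (1 / M * L) powr (1 / p)) \<le> Lp_norm p (w L) (riesz_commutator lam ?b (f L))"
      using f(3)[OF L] L by simp
    also have "\<dots> \<le> ennreal C * BMO_norm lam ?b * ennreal (A L powr \<delta>) * Lp_norm p (w L) (f L)"
      unfolding A_def by (rule est[OF w[OF L] fL(1)[OF L] log_in_BMO[OF lam] fL(2)[OF L]])
    also have "\<dots> \<le> ennreal C * ennreal ?B * ennreal (A L powr \<delta>) * Lp_norm p (w L) (f L)"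
      by (intro mult_right_mono mult_left_mono BMO_norm_log_le[OF lam]) auto
    also have "ennreal C * ennreal ?B * ennreal (A L powr \<delta>) = ennreal (C * ?B * A L powr \<delta>)"
      using C by (simp add: ennreal_mult)
    finally show "c' * L powr 2 \<le> C * ?B * A L powr \<delta>" using C by (intro reduce[OF L]) auto
  qed auto
qed

theorem proposition8p3:
  fixes lam p \<gamma> :: real
  assumes lam: "lam > - 1 / 2" "lam \<noteq> 0"
    and p: "1 < p"
    and gamma: "\<gamma> = max 1 (1 / (p - 1))"
  shows
    "(\<forall>\<theta>::real.
        (\<exists>C::real. C \<ge> 0 \<and>
          (\<forall>w\<in>AK_class lam p. \<forall>f\<in>Lp_space p w. compactly_supported f \<longrightarrow>
            Lp_norm p w (riesz lam f)
              \<le> ennreal (C * enn2real (AK_const lam p w) powr \<theta>) * Lp_norm p w f))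
        \<longrightarrow> \<theta> \<ge> \<gamma>)
     \<and>
     (\<forall>\<delta>::real.
        (\<exists>C::real. C \<ge> 0 \<and>
          (\<forall>w\<in>AK_class lam p. \<forall>f\<in>Lp_space p w. \<forall>b\<in>BMO lam. compactly_supported f \<longrightarrow>
            Lp_norm p w (riesz_commutator lam b f)
              \<le> ennreal C * BMO_norm lam b * ennreal (enn2real (AK_const lam p w) powr \<delta>)
                 * Lp_norm p w f))
        \<longrightarrow> \<delta> \<ge> 2 * \<gamma>)"
proof (intro conjI allI impI; elim exE conjE)
  fix \<theta> C :: real
  assume C: "C \<ge> 0"
    and est: "\<forall>w\<in>AK_class lam p. \<forall>f\<in>Lp_space p w. compactly_supported f \<longrightarrow>
            Lp_norm p w (riesz lam f) \<le> ennreal (C * enn2real (AK_const lam p w) powr \<theta>) * Lp_norm p w f"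
  have "1 / q \<le> \<theta>" if "q = p - 1 \<or> q = 1" for q
    by (rule sharp_exponents(1)[OF lam(1) p that C]) (use est in blast)
  from this[of "p - 1"] this[of 1] show "\<theta> \<ge> \<gamma>" by (simp add: gamma)
next
  fix \<delta> C :: real
  assume C: "C \<ge> 0"
    and est: "\<forall>w\<in>AK_class lam p. \<forall>f\<in>Lp_space p w. \<forall>b\<in>BMO lam. compactly_supported f \<longrightarrow>
            Lp_norm p w (riesz_commutator lam b f)
              \<le> ennreal C * BMO_norm lam b * ennreal (enn2real (AK_const lam p w) powr \<delta>) * Lp_norm p w f"
  have "2 / q \<le> \<delta>" if "q = p - 1 \<or> q = 1" for q
    by (rule sharp_exponents(2)[OF lam(1) p that C]) (use est in blast)
  from this[of "p - 1"] this[of 1] show "\<delta> \<ge> 2 * \<gamma>" by (simp add: gamma max_def)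
qed

end
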